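(* Consider the planar piecewise-smooth system $(\dot x,\dot y)=(X^+(x,y),Y^+(x,y))$ for $y>0$, $(\dot x,\dot y)=(X^-(x,y),Y^-(x,y))$ for $y<0$, where $X^\pm,Y^\pm$ are real analytic and the origin $O$ is a monodromic singular point. Suppose that $O$ is a stable (resp. an unstable) focus of order $\varsigma^+\in\mathbb N$ for the upper subsystem. Then the following statements hold. (a) If $O$ is a stable (resp. an unstable) focus of order $\varsigma^-\in\mathbb N$ for the lower subsystem, then $O$ is a focus of the piecewise-smooth system of order $$\varsigma\in\bigcup_{i=1}^{\mathcal M}\left\{\frac{2i-1}{2}\right\}\cup\{\mathcal M\},\qquad \mathcal M:=\min\{\varsigma^+,\varsigma^-\},$$ and it is stable (resp. unstable) when $\varsigma=\mathcal M$. (b) If $O$ is an invisible tangent point of the lower subsystem, then $O$ is a focus of the piecewise-smooth system of order $$\varsigma\in\bigcup_{i=1}^{\varsigma^+}\left\{\frac{2i-1}{2}\right\}\cup\{\varsigma^+\},$$ and it is stable (resp. unstable) when $\varsigma=\varsigma^+$.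
   Context: Orbits are understood in Filippov's sense. The system with $(X^+,Y^+)$ (resp. $(X^-,Y^-)$) is called the upper (resp. lower) subsystem; both vector fields are regarded as defined in a full neighborhood of $O=(0,0)$. $\mathbb N$ includes $0$. **Monodromic singular point.** $O$ is monodromic if no orbits approach it in a definite direction as $t\to\pm\infty$. Nearby orbits are assumed to rotate counterclockwise around $O$ (if they rotate clockwise, first apply the reflection $(x,y)\mapsto(-x,y)$). **Foci and tangent points of subsystems.** A focus of a subsystem is assumed to be a linear focus, i.e. the Jacobian matrix at $O$ has eigenvalues $\alpha\pm\beta i$ with $\beta\ne0$. $O$ is an invisible tangent point of the lower subsystem, of multiplicity $2\ell^--1$ with $\ell^-\in\mathbb Z^+$, if $Y^-(0,0)=\partial_xY^-(0,0)=\dots=\partial_x^{2\ell^--2}Y^-(0,0)=0$ and $X^-(0,0)\,\partial_x^{2\ell^--1}Y^-(0,0)>0$. **Lyapunov constants, order.** For small $x>0$ the orbit starting at $(x,0)$ first meets the negative $x$-axis at $(\Pi^+(x),0)$ after travelling in $y>0$; for small $x<0$ the orbit starting at $(x,0)$ first meets the positive $x$-axis at $(\Pi^-(x),0)$ after travelling in $y<0$; set $\Pi^\pm(0)=0$. The Lyapunov constants $V_k$ are the coefficients in the expansion at $x=0$ of $\Delta(x):=(\Pi^-)^{-1}(x)-\Pi^+(x)=\sum_{k\ge1}V_kx^k$. The monodromic point $O$ is of order $\varsigma\in\bigcup_{i=0}^{+\infty}\{i/2\}$ if $V_{2\varsigma+1}\ne0$ and $V_i=0$ for all $i\in\{1,\dots,2\varsigma\}$;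 in that case $O$ is a focus, stable if $V_{2\varsigma+1}<0$ and unstable if $V_{2\varsigma+1}>0$. (Order $0$ is a rough focus; all $V_k=0$ means a center.) For a smooth subsystem, the order and stability of $O$ are defined in the same way, regarding the smooth system as a piecewise-smooth system whose upper and lower subsystems are identical; the order is then an integer if $O$ is a focus. *)

theory Defs
  imports "HOL-Analysis.Analysis" "Jordan_Normal_Form.Char_Poly"
begin

text \<open>Points of the plane are pairs; \<open>U\<close> is always an open neighbourhood of the origin on which
  all vector fields are defined, and orbits are required to stay in \<open>U\<close>.\<close>

definition real_analytic_on :: "(real \<times> real \<Rightarrow> real) \<Rightarrow> (real \<times> real) set \<Rightarrow> bool" where
  "real_analytic_on f U \<longleftrightarrow>
     (\<forall>(a, b)\<in>U. \<exists>c :: nat \<Rightarrow> nat \<Rightarrow> real. \<exists>r>0. \<forall>h k. \<bar>h\<bar> < r \<longrightarrow> \<bar>k\<bar> < r \<longrightarrow>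
        ((\<lambda>(i, j). c i j * h ^ i * k ^ j) has_sum f (a + h, b + k)) UNIV)"

definition vector_field :: "(real \<times> real \<Rightarrow> real) \<Rightarrow> (real \<times> real \<Rightarrow> real) \<Rightarrow> real \<times> real \<Rightarrow> real \<times> real"
  where "vector_field X Y = (\<lambda>p. (X p, Y p))"


subsection \<open>Filippov orbits and monodromic singular points\<close>

text \<open>Both fields are continuous across the \<open>x\<close>-axis, so there the Filippov set is the convex
  hull of their two values.\<close>

definition filippov ::
  "(real \<times> real \<Rightarrow> real \<times> real) \<Rightarrow> (real \<times> real \<Rightarrow> real \<times> real) \<Rightarrow> real \<times> real \<Rightarrow> (real \<times> real) set"
  where "filippov F\<^sub>p F\<^sub>m p =
    (if snd p > 0 then {F\<^sub>p p} else if snd p < 0 then {F\<^sub>m p} else convex hull {F\<^sub>p p, F\<^sub>m p})"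

text \<open>\<open>I\<close> is an interval of times. Absolute continuity is expressed by the existence of an
  integrable density \<open>g\<close>, which is then the derivative of \<open>\<gamma>\<close> almost everywhere.\<close>

definition filippov_orbit ::
  "(real \<times> real) set \<Rightarrow> (real \<times> real \<Rightarrow> real \<times> real) \<Rightarrow> (real \<times> real \<Rightarrow> real \<times> real)
    \<Rightarrow> real set \<Rightarrow> (real \<Rightarrow> real \<times> real) \<Rightarrow> bool"
  where "filippov_orbit U F\<^sub>p F\<^sub>m I \<gamma> \<longleftrightarrow> \<gamma> ` I \<subseteq> U \<and>
    (\<forall>a b. a \<le> b \<longrightarrow> {a..b} \<subseteq> I \<longrightarrow>
      (\<exists>g. g absolutely_integrable_on {a..b} \<and>
           (\<forall>t\<in>{a..b}. \<gamma> t = \<gamma> a + integral {a..t} g) \<and>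
           (\<exists>N. negligible N \<and> (\<forall>t\<in>{a..b} - N. g t \<in> filippov F\<^sub>p F\<^sub>m (\<gamma> t)))))"

text \<open>Here \<open>sgn\<close> is the normalisation of a vector, with \<open>sgn 0 = 0\<close>; hence requiring the limit
  direction to be a unit vector excludes the stationary orbit.\<close>

definition approaches_in_direction ::
  "(real \<Rightarrow> real \<times> real) \<Rightarrow> real filter \<Rightarrow> real \<times> real \<Rightarrow> bool"
  where "approaches_in_direction \<gamma> G v \<longleftrightarrow>
    norm v = 1 \<and> (\<gamma> \<longlongrightarrow> 0) G \<and> ((\<lambda>t. sgn (\<gamma> t)) \<longlongrightarrow> v) G"

definition monodromic_singular_point ::
  "(real \<times> real) set \<Rightarrow> (real \<times> real \<Rightarrow> real \<times> real) \<Rightarrow> (real \<times> real \<Rightarrow> real \<times> real) \<Rightarrow> bool"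
  where "monodromic_singular_point U F\<^sub>p F\<^sub>m \<longleftrightarrow>
    0 \<in> filippov F\<^sub>p F\<^sub>m 0 \<and>
    (\<nexists>\<gamma> v. filippov_orbit U F\<^sub>p F\<^sub>m {0..} \<gamma> \<and> approaches_in_direction \<gamma> at_top v) \<and>
    (\<nexists>\<gamma> v. filippov_orbit U F\<^sub>p F\<^sub>m {..0} \<gamma> \<and> approaches_in_direction \<gamma> at_bot v)"


subsection \<open>Half-return maps\<close>

definition orbit_arc ::
  "(real \<times> real) set \<Rightarrow> (real \<times> real \<Rightarrow> real \<times> real) \<Rightarrow> (real \<Rightarrow> real \<times> real) \<Rightarrow> real \<Rightarrow> bool"
  where "orbit_arc U F \<gamma> T \<longleftrightarrow> 0 < T \<and> \<gamma> ` {0..T} \<subseteq> U \<and>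
    (\<forall>t\<in>{0..T}. (\<gamma> has_vector_derivative F (\<gamma> t)) (at t within {0..T}))"

definition upper_half_return ::
  "(real \<times> real) set \<Rightarrow> (real \<times> real \<Rightarrow> real \<times> real) \<Rightarrow> real \<Rightarrow> real \<Rightarrow> bool"
  where "upper_half_return U F x y \<longleftrightarrow> x > 0 \<and> y < 0 \<and>
    (\<exists>\<gamma> T. orbit_arc U F \<gamma> T \<and> \<gamma> 0 = (x, 0) \<and> \<gamma> T = (y, 0) \<and> (\<forall>t\<in>{0<..<T}. snd (\<gamma> t) > 0))"

definition lower_half_return ::
  "(real \<times> real) set \<Rightarrow> (real \<times> real \<Rightarrow> real \<times> real) \<Rightarrow> real \<Rightarrow> real \<Rightarrow> bool"
  where "lower_half_return U F x y \<longleftrightarrow> x < 0 \<and> y > 0 \<and>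
    (\<exists>\<gamma> T. orbit_arc U F \<gamma> T \<and> \<gamma> 0 = (x, 0) \<and> \<gamma> T = (y, 0) \<and> (\<forall>t\<in>{0<..<T}. snd (\<gamma> t) < 0))"

text \<open>Nearby orbits go from the positive to the negative \<open>x\<close>-axis through the upper half-plane
  and from the negative to the positive one through the lower half-plane.\<close>

definition rotates_counterclockwise ::
  "(real \<times> real) set \<Rightarrow> (real \<times> real \<Rightarrow> real \<times> real) \<Rightarrow> (real \<times> real \<Rightarrow> real \<times> real) \<Rightarrow> bool"
  where "rotates_counterclockwise U F\<^sub>p F\<^sub>m \<longleftrightarrow>
    (\<exists>r>0. (\<forall>x\<in>{0<..<r}. \<exists>y. upper_half_return U F\<^sub>p x y) \<and>
           (\<forall>x\<in>{-r<..<0}. \<exists>y. lower_half_return U F\<^sub>m x y))"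

text \<open>For locally Lipschitz fields the end point of a half-return is determined by its starting
  point and conversely, so the maps below are well defined and injective on their domains.\<close>

definition dom_upper where
  "dom_upper U F = {x. x = 0 \<or> (\<exists>y. upper_half_return U F x y)}"

definition dom_lower where
  "dom_lower U F = {x. x = 0 \<or> (\<exists>y. lower_half_return U F x y)}"

definition upper_map :: "(real \<times> real) set \<Rightarrow> (real \<times> real \<Rightarrow> real \<times> real) \<Rightarrow> real \<Rightarrow> real" where
  "upper_map U F x = (if x = 0 then 0 else (THE y. upper_half_return U F x y))"

definition lower_map :: "(real \<times> real) set \<Rightarrow> (real \<times> real \<Rightarrow> real \<times> real) \<Rightarrow> real \<Rightarrow> real" where
  "lower_map U F x = (if x = 0 then 0 else (THE y. lower_half_return U F x y))"


subsection \<open>Lyapunov constants, order and stability\<close>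

definition displacement ::
  "(real \<times> real) set \<Rightarrow> (real \<times> real \<Rightarrow> real \<times> real) \<Rightarrow> (real \<times> real \<Rightarrow> real \<times> real) \<Rightarrow> real \<Rightarrow> real"
  where "displacement U F\<^sub>p F\<^sub>m x = inv_into (dom_lower U F\<^sub>m) (lower_map U F\<^sub>m) x - upper_map U F\<^sub>p x"

text \<open>\<open>V k\<close> is the coefficient of \<open>x ^ k\<close> for \<open>k \<ge> 1\<close>; the value \<open>V 0\<close> is irrelevant.\<close>

definition lyapunov_constants ::
  "(real \<times> real) set \<Rightarrow> (real \<times> real \<Rightarrow> real \<times> real) \<Rightarrow> (real \<times> real \<Rightarrow> real \<times> real)
    \<Rightarrow> (nat \<Rightarrow> real) \<Rightarrow> bool"
  where "lyapunov_constants U F\<^sub>p F\<^sub>m V \<longleftrightarrow>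
    (\<exists>r>0. \<forall>x\<in>{0..<r}. x \<in> dom_upper U F\<^sub>p \<and> x \<in> lower_map U F\<^sub>m ` dom_lower U F\<^sub>m \<and>
       (\<lambda>k. V (Suc k) * x ^ Suc k) sums displacement U F\<^sub>p F\<^sub>m x)"

datatype stability = Stable | Unstable

text \<open>With \<open>n = 2 * \<sigma>\<close>, the first nonvanishing Lyapunov constant is \<open>V (n + 1)\<close>. The order and
  stability of a focus of a smooth field \<open>F\<close> are obtained by taking both fields equal to \<open>F\<close>.\<close>

definition focus_of_order ::
  "(real \<times> real) set \<Rightarrow> (real \<times> real \<Rightarrow> real \<times> real) \<Rightarrow> (real \<times> real \<Rightarrow> real \<times> real)
    \<Rightarrow> real \<Rightarrow> bool"
  where "focus_of_order U F\<^sub>p F\<^sub>m \<sigma> \<longleftrightarrow>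
    (\<exists>(n::nat) V. \<sigma> = real n / 2 \<and> lyapunov_constants U F\<^sub>p F\<^sub>m V \<and>
       (\<forall>i\<in>{1..n}. V i = 0) \<and> V (n + 1) \<noteq> 0)"

definition focus_of_order_with_stability ::
  "(real \<times> real) set \<Rightarrow> (real \<times> real \<Rightarrow> real \<times> real) \<Rightarrow> (real \<times> real \<Rightarrow> real \<times> real)
    \<Rightarrow> real \<Rightarrow> stability \<Rightarrow> bool"
  where "focus_of_order_with_stability U F\<^sub>p F\<^sub>m \<sigma> s \<longleftrightarrow>
    (\<exists>(n::nat) V. \<sigma> = real n / 2 \<and> lyapunov_constants U F\<^sub>p F\<^sub>m V \<and>
       (\<forall>i\<in>{1..n}. V i = 0) \<and>
       (case s of Stable \<Rightarrow> V (n + 1) < 0 | Unstable \<Rightarrow> V (n + 1) > 0))"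


subsection \<open>Foci and invisible tangent points of subsystems\<close>

definition jacobian_at_origin ::
  "(real \<times> real \<Rightarrow> real) \<Rightarrow> (real \<times> real \<Rightarrow> real) \<Rightarrow> real mat"
  where "jacobian_at_origin X Y = mat_of_rows_list 2
    [[deriv (\<lambda>x. X (x, 0)) 0, deriv (\<lambda>y. X (0, y)) 0],
     [deriv (\<lambda>x. Y (x, 0)) 0, deriv (\<lambda>y. Y (0, y)) 0]]"

definition linear_focus :: "(real \<times> real \<Rightarrow> real) \<Rightarrow> (real \<times> real \<Rightarrow> real) \<Rightarrow> bool" where
  "linear_focus X Y \<longleftrightarrow> X (0, 0) = 0 \<and> Y (0, 0) = 0 \<and>
    (\<exists>\<alpha> \<beta>. \<beta> \<noteq> 0 \<and>
       eigenvalue (map_mat complex_of_real (jacobian_at_origin X Y)) (Complex \<alpha> \<beta>) \<and>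
       eigenvalue (map_mat complex_of_real (jacobian_at_origin X Y)) (Complex \<alpha> (- \<beta>)))"

definition subsystem_focus ::
  "(real \<times> real) set \<Rightarrow> (real \<times> real \<Rightarrow> real) \<Rightarrow> (real \<times> real \<Rightarrow> real) \<Rightarrow> nat \<Rightarrow> stability \<Rightarrow> bool"
  where "subsystem_focus U X Y \<sigma> s \<longleftrightarrow> linear_focus X Y \<and>
    focus_of_order_with_stability U (vector_field X Y) (vector_field X Y) (real \<sigma>) s"

definition invisible_tangent_lower ::
  "(real \<times> real \<Rightarrow> real) \<Rightarrow> (real \<times> real \<Rightarrow> real) \<Rightarrow> nat \<Rightarrow> bool"
  where "invisible_tangent_lower X Y l \<longleftrightarrow> l \<ge> 1 \<and>
    (\<forall>k\<le>2 * l - 2. (deriv ^^ k) (\<lambda>x. Y (x, 0)) 0 = 0) \<and>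
    X (0, 0) * (deriv ^^ (2 * l - 1)) (\<lambda>x. Y (x, 0)) 0 > 0"

definition admissible_orders :: "nat \<Rightarrow> real set" where
  "admissible_orders m = (\<Union>i\<in>{1..m}. {(2 * real i - 1) / 2}) \<union> {real m}"

end

theory Submission
  imports Defs "HOL-Complex_Analysis.Complex_Analysis"
begin

text \<open>In polar coordinates a linear focus has one analytic map \<open>A\<close>, \<open>A 0 = 0\<close>, that equals the upper
  half-return for \<open>x > 0\<close> and the lower half-return for \<open>x < 0\<close>; so the displacement of the smooth
  system is \<open>A\<inverse> - A\<close>. An invisible tangent point has an analytic involution \<open>\<tau>\<close> instead: if \<open>h x\<close> is
  the height at which the orbit through \<open>(x, 0)\<close> crosses the \<open>y\<close>-axis, then \<open>- h x\<close> is the even power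
  \<open>(\<xi> x) ^ (2 * l)\<close> of an analytic chart and \<open>\<tau> x = \<xi>\<inverse> (- \<xi> x)\<close>.

  The displacement of the piecewise-smooth system is \<open>B - A\<close>, where \<open>B\<close> is the inverse of the map of
  the lower focus or \<open>B = \<tau>\<close>. Put \<open>m = 2 * M + 1\<close> and let \<open>A\<inverse> - A = c\<^sub>1 x ^ m + \<dots>\<close> and
  \<open>B - B\<inverse> = c\<^sub>2 x ^ m + \<dots>\<close>. If \<open>M > 0\<close>, both slopes at \<open>0\<close> are \<open>- 1\<close>, and \<open>B - A = d x ^ k + \<dots>\<close> forces
  \<open>B\<inverse> - A\<inverse> = (- 1) ^ k d x ^ k + \<dots>\<close>. Adding up, \<open>d = (- 1) ^ k d\<close> for \<open>k < m\<close>, hence \<open>d = 0\<close> for odd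
  \<open>k < m\<close>, and \<open>2 d = c\<^sub>1 + c\<^sub>2\<close> for \<open>k = m\<close>.\<close>


subsection \<open>Analytic dependence of solutions on a parameter\<close>

text \<open>The Lyapunov constants see only \<open>x > 0\<close>, but the sign
  \<open>(- 1) ^ k\<close> comes from evaluating \<open>B - A\<close> at the negative point
  \<open>B\<inverse> x\<close>. The half-maps must therefore be continued analytically through
  \<open>0\<close>, exactly where the flow degenerates: a singular point in one case, a tangency in
  the other. Each time a change of variables produces an equation that is regular at parameter
  \<open>0\<close>; analytic dependence comes from Picard iteration with a complex parameter, and
  real values return because every object is real on the real axis. Composing a half-map with its
  inverse gives slopes with product \<open>1\<close>. If \<open>M > 0\<close>, a map and its inverse
  have equal slopes, both negative, hence \<open>- 1\<close>. If \<open>M = 0\<close> the slopes may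
  differ, and their signs are compared directly. A focus of order above \<open>M\<close> contributes
  \<open>0\<close> to \<open>c\<^sub>1 + c\<^sub>2\<close>, and so does a tangent point,
  \<open>\<tau>\<close> being its own inverse; the sum still has the sign of the given stability.
  Rotation is known for the upper subsystem on the positive axis only and for the lower one on the
  negative axis only; either half fixes the orientation.\<close>

text \<open>Morera's theorem: exchanging the integrations turns the integral of \<open>?I\<close>
  over the boundary of a triangle into an integral over \<open>{a..b}\<close> of boundary integrals
  of \<open>f t\<close>, and these are zero by Cauchy's theorem.\<close>

lemma holomorphic_on_integral_param:
  fixes f :: "real \<Rightarrow> complex \<Rightarrow> complex"
  assumes cont: "continuous_on ({a..b} \<times> S) (\<lambda>(t, l). f t l)" and "open S"
    and hol: "\<And>t. t \<in> {a..b} \<Longrightarrow> f t holomorphic_on S"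
  shows "(\<lambda>l. integral {a..b} (\<lambda>t. f t l)) holomorphic_on S"
proof -
  let ?I = "\<lambda>l. integral {a..b} (\<lambda>t. f t l)"
  have sw: "continuous_on (S \<times> cbox a b) (\<lambda>(l, t). f t l)"
    unfolding case_prod_unfold
    by (rule continuous_on_compose2[OF cont[unfolded case_prod_unfold],
          of _ "\<lambda>x. (snd x, fst x)", simplified]) (auto intro!: continuous_intros)
  have contI: "continuous_on S ?I"
    using integral_continuous_on_param[OF sw] by simp
  have seg: "contour_integral (linepath p q) ?I
      = integral {a..b} (\<lambda>t. contour_integral (linepath p q) (f t))"
    and int: "(\<lambda>t. contour_integral (linepath p q) (f t)) integrable_on {a..b}"
    if "closed_segment p q \<subseteq> S" for p q
  proof -
    let ?l = "linepath p q"
    have l: "?l u \<in> S" if "u \<in> {0..1}" for u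
      using that \<open>closed_segment p q \<subseteq> S\<close> linepath_in_path by blast
    have c2: "continuous_on (cbox (0, a) (1, b)) (\<lambda>(u, t). f t (?l u) * (q - p))"
      unfolding case_prod_unfold
      by (rule continuous_on_mult[OF continuous_on_compose2[OF cont[unfolded case_prod_unfold],
            of _ "\<lambda>x. (snd x, ?l (fst x))", simplified]])
        (use l in \<open>auto simp: linepath_def intro!: continuous_intros\<close>)
    have 1: "contour_integral ?l g = integral {0..1} (\<lambda>u. g (?l u) * (q - p))" for g
      by (simp add: contour_integral_integral)
    have "contour_integral ?l ?I = integral {0..1} (\<lambda>u. integral {a..b} (\<lambda>t. f t (?l u) * (q - p)))"
      unfolding 1 by simp
    also have "\<dots> = integral {a..b} (\<lambda>t. integral {0..1} (\<lambda>u. f t (?l u) * (q - p)))"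
      using integral_swap_continuous[OF c2] by simp
    finally show "contour_integral ?l ?I = integral {a..b} (\<lambda>t. contour_integral ?l (f t))"
      unfolding 1 .
    have "continuous_on {a..b} (\<lambda>t. integral (cbox 0 1) (\<lambda>u. f t (?l u) * (q - p)))"
      by (rule integral_continuous_on_param, unfold case_prod_unfold,
          rule continuous_on_mult[OF continuous_on_compose2[OF cont[unfolded case_prod_unfold],
            of _ "\<lambda>x. (fst x, ?l (snd x))", simplified]])
        (use l in \<open>auto simp: linepath_def intro!: continuous_intros\<close>)
    then show "(\<lambda>t. contour_integral ?l (f t)) integrable_on {a..b}"
      unfolding 1 by (simp add: integrable_continuous_interval)
  qed
  have "?I analytic_on S"
  proof (rule Morera_triangle[OF contI \<open>open S\<close>], intro impI)
    fix p q r assume S: "convex hull {p, q, r} \<subseteq> S"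
    have s: "closed_segment p q \<subseteq> S" "closed_segment q r \<subseteq> S" "closed_segment r p \<subseteq> S"
      using S by (meson insert_subset order_trans closed_segment_subset convex_convex_hull
          hull_subset hull_inc insertI1 insertI2 subset_trans)+
    have z: "contour_integral (linepath p q) (f t) + contour_integral (linepath q r) (f t)
        + contour_integral (linepath r p) (f t) = 0" if "t \<in> {a..b}" for t
    proof -
      have h: "f t holomorphic_on S" using hol that .
      have T: "(f t has_contour_integral 0) (linepath p q +++ linepath q r +++ linepath r p)"
        by (rule Cauchy_theorem_triangle) (rule holomorphic_on_subset[OF h S])
      have ci: "(f t has_contour_integral contour_integral (linepath x y) (f t)) (linepath x y)"
        if "closed_segment x y \<subseteq> S" for x y
        by (rule has_contour_integral_integral, rule contour_integrable_continuous_linepath)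
          (meson h holomorphic_on_imp_continuous_on continuous_on_subset that)
      have "(f t has_contour_integral (contour_integral (linepath p q) (f t) +
          (contour_integral (linepath q r) (f t) + contour_integral (linepath r p) (f t))))
          (linepath p q +++ linepath q r +++ linepath r p)"
        using s by (intro has_contour_integral_join ci valid_path_join valid_path_linepath) auto
      from has_contour_integral_unique[OF this T] show ?thesis by (simp add: add.assoc)
    qed
    have "contour_integral (linepath p q) ?I + contour_integral (linepath q r) ?I
        + contour_integral (linepath r p) ?I
      = integral {a..b} (\<lambda>t. contour_integral (linepath p q) (f t) + contour_integral (linepath q r) (f t)
        + contour_integral (linepath r p) (f t))"
      using s by (simp add: seg int integral_add integrable_add)
    also have "\<dots> = integral {a..b} (\<lambda>t. 0)"
      by (rule integral_cong) (simp add: z)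
    finally show "contour_integral (linepath p q) ?I + contour_integral (linepath q r) ?I
        + contour_integral (linepath r p) ?I = 0" by simp
  qed
  then show ?thesis by (rule analytic_imp_holomorphic)
qed

text \<open>Moves the variable limit of integration into the integrand, so that joint continuity in
  \<open>t\<close> and further parameters becomes continuity of an integral over a fixed interval.
  Differentiating \<open>?H (t * u)\<close> in \<open>u\<close> covers \<open>t = 0\<close>
  too.\<close>

lemma integral_scale_unit:
  fixes g :: "real \<Rightarrow> complex"
  assumes "continuous_on {0..t} g" "0 \<le> t"
  shows "integral {0..t} g = t *\<^sub>R integral {0..1} (\<lambda>u. g (t * u))"
proof -
  let ?H = "\<lambda>x. integral {0..x} g"
  have m: "(\<lambda>u. t * u) ` {0..1} \<subseteq> {0..t}"
    using assms(2) by (auto simp: mult_left_le)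
  have "((\<lambda>u. ?H (t * u)) has_vector_derivative t *\<^sub>R g (t * u)) (at u within {0..1})"
    if "u \<in> {0..1}" for u
  proof -
    have "(?H has_vector_derivative g (t * u)) (at (t * u) within {0..t})"
      using m that by (intro integral_has_vector_derivative assms(1)) blast
    then have H: "(?H has_vector_derivative g (t * u)) (at (t * u) within (\<lambda>u. t * u) ` {0..1})"
      by (rule has_vector_derivative_within_subset) (rule m)
    have "((\<lambda>u. t * u) has_vector_derivative t) (at u within {0..1})"
      by (auto intro!: derivative_eq_intros)
    from vector_diff_chain_within[OF this H] show ?thesis by (simp add: o_def)
  qed
  then have "((\<lambda>u. t *\<^sub>R g (t * u)) has_integral ?H (t * 1) - ?H (t * 0)) {0..1}"
    by (intro fundamental_theorem_of_calculus) auto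
  then show ?thesis by (simp add: integral_unique flip: integral_cmul)
qed

text \<open>Picard iteration with geometric convergence in the weight \<open>exp (2 * L * t)\<close>. Asking \<open>G\<close> to be
  holomorphic only after composition with holomorphic curves avoids several complex variables.\<close>

lemma picard_holomorphic:
  fixes G :: "real \<Rightarrow> complex \<Rightarrow> complex \<Rightarrow> complex" and z0 :: "complex \<Rightarrow> complex"
  assumes T: "0 < T" and L: "0 \<le> L"
    and cont: "continuous_on ({0..T} \<times> ball 0 R \<times> ball 0 \<epsilon>) (\<lambda>(t, z, l). G t z l)"
    and hol: "\<And>t z. t \<in> {0..T} \<Longrightarrow> z holomorphic_on ball 0 \<epsilon> \<Longrightarrow> z ` ball 0 \<epsilon> \<subseteq> ball 0 R
      \<Longrightarrow> (\<lambda>l. G t (z l) l) holomorphic_on ball 0 \<epsilon>"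
    and lip: "\<And>t z w l. t \<in> {0..T} \<Longrightarrow> z \<in> ball 0 R \<Longrightarrow> w \<in> ball 0 R \<Longrightarrow> l \<in> ball 0 \<epsilon>
      \<Longrightarrow> norm (G t z l - G t w l) \<le> L * norm (z - w)"
    and bd: "\<And>t l. t \<in> {0..T} \<Longrightarrow> l \<in> ball 0 \<epsilon> \<Longrightarrow> norm (G t 0 l) \<le> K"
    and z0: "z0 holomorphic_on ball 0 \<epsilon>"
    and small: "\<And>l. l \<in> ball 0 \<epsilon>
      \<Longrightarrow> norm (z0 l) + 2 * (T * (K + L * norm (z0 l)) * exp (2 * L * T)) < R"
    and real: "\<And>t z l. t \<in> {0..T} \<Longrightarrow> z \<in> ball 0 R \<Longrightarrow> l \<in> ball 0 \<epsilon> \<Longrightarrow> z \<in> \<real> \<Longrightarrow> l \<in> \<real>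
      \<Longrightarrow> G t z l \<in> \<real>"
    and real0: "\<And>l. l \<in> ball 0 \<epsilon> \<Longrightarrow> l \<in> \<real> \<Longrightarrow> z0 l \<in> \<real>"
  obtains z where
    "\<And>l. l \<in> ball 0 \<epsilon> \<Longrightarrow> z 0 l = z0 l"
    "\<And>t l. t \<in> {0..T} \<Longrightarrow> l \<in> ball 0 \<epsilon> \<Longrightarrow> z t l \<in> ball 0 R"
    "\<And>t l. t \<in> {0..T} \<Longrightarrow> l \<in> ball 0 \<epsilon>
      \<Longrightarrow> ((\<lambda>t. z t l) has_vector_derivative G t (z t l) l) (at t within {0..T})"
    "\<And>t. t \<in> {0..T} \<Longrightarrow> z t holomorphic_on ball 0 \<epsilon>"
    "\<And>t l. t \<in> {0..T} \<Longrightarrow> l \<in> ball 0 \<epsilon> \<Longrightarrow> l \<in> \<real> \<Longrightarrow> z t l \<in> \<real>"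
proof -
  let ?D = "ball (0::complex) \<epsilon>" and ?I = "{0..T}"
  define \<Phi> where "\<Phi> = (\<lambda>z t l. z0 l + integral {0..t} (\<lambda>s. G s (z s l) l))"
  \<comment> \<open>The invariant of the iteration. One application of \<open>\<Phi>\<close>
    preserves all of it by \<open>step\<close>, except the bound by \<open>R\<close>; that one needs
    the quantitative estimate in \<open>main\<close>.\<close>
  define good where "good = (\<lambda>z. continuous_on (?I \<times> ?D) (\<lambda>(t, l). z t l) \<and>
      (\<forall>t\<in>?I. z t holomorphic_on ?D) \<and> (\<forall>t\<in>?I. \<forall>l\<in>?D. z t l \<in> ball 0 R) \<and>
      (\<forall>t\<in>?I. \<forall>l\<in>?D. l \<in> \<real> \<longrightarrow> z t l \<in> \<real>))"
  have Gcont: "continuous_on (?I \<times> ?D) (\<lambda>(t, l). G t (z t l) l)" 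
    if "continuous_on (?I \<times> ?D) (\<lambda>(t, l). z t l)" "\<forall>t\<in>?I. \<forall>l\<in>?D. z t l \<in> ball 0 R" for z
  proof -
    have "continuous_on (?I \<times> ?D) (\<lambda>x. (\<lambda>(t, z, l). G t z l) (fst x, z (fst x) (snd x), snd x))"
      by (rule continuous_on_compose2[OF cont])
        (use that in \<open>auto intro!: continuous_intros simp: case_prod_unfold\<close>)
    then show ?thesis by (simp add: case_prod_unfold)
  qed
  have cz0: "continuous_on (?I \<times> ?D) (\<lambda>x. z0 (snd x))"
    by (rule continuous_on_compose2[OF holomorphic_on_imp_continuous_on[OF z0]])
      (auto intro: continuous_intros)
  have slice: "continuous_on {0..t} (\<lambda>s. f s l)"
    if "continuous_on (?I \<times> ?D) (\<lambda>(t, l). f t l)" "t \<in> ?I" "l \<in> ?D"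
        for f :: "real \<Rightarrow> complex \<Rightarrow> complex" and t l
  proof -
    have "continuous_on {0..t} (\<lambda>s. (\<lambda>(t, l). f t l) (s, l))"
      by (rule continuous_on_compose2[OF that(1)]) (use that in \<open>auto intro!: continuous_intros\<close>)
    then show ?thesis by simp
  qed
  have int: "(\<lambda>s. G s (z s l) l) integrable_on {0..t}" if "good z" "t \<in> ?I" "l \<in> ?D" for z t l
    using slice[OF Gcont] that integrable_continuous_interval unfolding good_def by blast
  have step: "continuous_on (?I \<times> ?D) (\<lambda>(t, l). \<Phi> z t l) \<and> (\<forall>t\<in>?I. \<Phi> z t holomorphic_on ?D)
      \<and> (\<forall>t\<in>?I. \<forall>l\<in>?D. l \<in> \<real> \<longrightarrow> \<Phi> z t l \<in> \<real>)" if g: "good z" for z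
  proof (intro conjI ballI impI)
    note Gc = Gcont[of z]
    have gc: "continuous_on (?I \<times> ?D) (\<lambda>(t, l). G t (z t l) l)"
      using g Gc unfolding good_def by blast
    have eq: "\<Phi> z t l = z0 l + t *\<^sub>R integral (cbox 0 1) (\<lambda>u. G (t * u) (z (t * u) l) l)"
      if "t \<in> ?I" "l \<in> ?D" for t l
      unfolding \<Phi>_def using integral_scale_unit[OF slice[OF gc that]] that by simp
    have m: "t * u \<in> ?I" if "t \<in> ?I" "u \<in> {0..1}" for t u
      using that mult_mono[of t T u 1] by auto
    have "continuous_on ((?I \<times> ?D) \<times> cbox 0 1)
        (\<lambda>x. (\<lambda>(t, l). G t (z t l) l) (fst (fst x) * snd x, snd (fst x)))"
      by (rule continuous_on_compose2[OF gc]) (use m in \<open>auto intro!: continuous_intros\<close>)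
    then have "continuous_on ((?I \<times> ?D) \<times> cbox 0 1)
        (\<lambda>(x, u). G (fst x * u) (z (fst x * u) (snd x)) (snd x))"
      by (simp add: case_prod_unfold)
    from integral_continuous_on_param[OF this]
    have "continuous_on (?I \<times> ?D) (\<lambda>x. z0 (snd x) + fst x *\<^sub>R
        integral (cbox 0 1) (\<lambda>u. G (fst x * u) (z (fst x * u) (snd x)) (snd x)))"
      by (intro continuous_on_add continuous_on_scaleR cz0 continuous_on_fst continuous_on_id)
    then show "continuous_on (?I \<times> ?D) (\<lambda>(t, l). \<Phi> z t l)"
      by (rule continuous_on_eq) (auto simp: eq)
  next
    fix t assume t: "t \<in> ?I"
    have "(\<lambda>l. integral {0..t} (\<lambda>s. G s (z s l) l)) holomorphic_on ?D"
    proof (rule holomorphic_on_integral_param)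
      show "continuous_on ({0..t} \<times> ?D) (\<lambda>(s, l). G s (z s l) l)"
        by (rule continuous_on_subset[OF Gcont]) (use g t in \<open>auto simp: good_def\<close>)
      show "(\<lambda>l. G s (z s l) l) holomorphic_on ?D" if "s \<in> {0..t}" for s
        by (rule hol) (use g t that in \<open>auto simp: good_def\<close>)
    qed simp
    then show "\<Phi> z t holomorphic_on ?D"
      unfolding \<Phi>_def by (intro holomorphic_intros z0)
  next
    fix t l assume t: "t \<in> ?I" and l: "l \<in> ?D" "l \<in> \<real>"
    have "Im (integral {0..t} (\<lambda>s. G s (z s l) l)) = integral {0..t} (\<lambda>s. Im (G s (z s l) l))"
      using integral_linear[OF int[OF g t l(1)] bounded_linear_Im] by (simp add: o_def)
    also have "\<dots> = integral {0..t} (\<lambda>s. 0)"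
      by (rule integral_cong) (use real g t l in \<open>auto simp: good_def complex_is_Real_iff\<close>)
    finally show "\<Phi> z t l \<in> \<real>"
      using real0 l by (simp add: \<Phi>_def complex_is_Real_iff)
  qed
  \<comment> \<open>Bounds the first increment \<open>\<Phi> (\<lambda>t. z0) t l - z0 l\<close>:
    the integrand has norm at most \<open>K + L * norm (z0 l)\<close> and the time is at most
    \<open>T\<close>.\<close>
  define M where "M = (\<lambda>l. T * (K + L * norm (z0 l)))"
  have K: "0 \<le> K" if "l \<in> ?D" for l
    using order_trans[OF norm_ge_zero bd[of 0 l]] that T by simp
  have M0: "0 \<le> M l" if "l \<in> ?D" for l
    using K that T L by (simp add: M_def)
  have rad: "norm (z0 l) + 2 * (M l * exp (2 * L * T)) < R" if "l \<in> ?D" for l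
    using small[OF that] by (simp add: M_def)
  have expT: "M l * exp (2 * L * t) \<le> M l * exp (2 * L * T)" if "t \<in> ?I" "l \<in> ?D" for t l
    using that M0 L by (intro mult_left_mono) (auto intro: mult_left_mono)
  define zs where "zs = (\<lambda>n. (\<Phi> ^^ n) (\<lambda>t. z0))"
  have zsS: "zs (Suc n) = \<Phi> (zs n)" and zs0: "zs 0 = (\<lambda>t. z0)" for n
    by (simp_all add: zs_def)
  have diff: "norm (\<Phi> z t l - \<Phi> w t l) \<le> integral {0..t} (\<lambda>s. L * B s)"
    if "good z" "good w" "t \<in> ?I" "l \<in> ?D" "\<And>s. s \<in> {0..t} \<Longrightarrow> norm (z s l - w s l) \<le> B s"
      "continuous_on {0..t} B" for z w t l B
  proof -
    have "\<Phi> z t l - \<Phi> w t l = integral {0..t} (\<lambda>s. G s (z s l) l - G s (w s l) l)"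
      unfolding \<Phi>_def using that int by (simp add: integral_diff)
    also have "norm \<dots> \<le> integral {0..t} (\<lambda>s. L * B s)"
    proof (rule integral_norm_bound_integral)
      show "(\<lambda>s. G s (z s l) l - G s (w s l) l) integrable_on {0..t}"
        using that int by (intro integrable_diff) auto
      show "(\<lambda>s. L * B s) integrable_on {0..t}"
        using that by (intro integrable_continuous_interval continuous_intros)
      show "norm (G s (z s l) l - G s (w s l) l) \<le> L * B s" if s: "s \<in> {0..t}" for s
      proof -
        have "norm (G s (z s l) l - G s (w s l) l) \<le> L * norm (z s l - w s l)"
          using s \<open>t \<in> ?I\<close> \<open>l \<in> ?D\<close> \<open>good z\<close> \<open>good w\<close> by (intro lip) (auto simp: good_def)
        also have "\<dots> \<le> L * B s"
          using L by (intro mult_left_mono) (use s \<open>\<And>s. s \<in> {0..t} \<Longrightarrow> norm (z s l - w s l) \<le> B s\<close> in auto)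
        finally show ?thesis .
      qed
    qed
    finally show ?thesis .
  qed
  \<comment> \<open>In the weight \<open>exp (2 * L * t)\<close> each increment is at most half the
    preceding one, and \<open>2 - 2 / 2 ^ n\<close> is the sum of the first \<open>n\<close> powers
    of \<open>1 / 2\<close>. Hence no iterate moves farther from \<open>z0 l\<close> than twice the
    weighted first increment, which is what the assumption on \<open>R\<close> allows.\<close>
  have main: "good (zs n) \<and> (\<forall>t\<in>?I. \<forall>l\<in>?D.
      norm (zs n t l - z0 l) \<le> M l * exp (2 * L * t) * (2 - 2 / 2 ^ n) \<and>
      norm (zs (Suc n) t l - zs n t l) \<le> M l * exp (2 * L * t) / 2 ^ n)" for n
  proof (induction n)
    case 0
    have nz: "norm (z0 l) < R" if "l \<in> ?D" for l
      using rad[OF that] mult_nonneg_nonneg[OF M0[OF that] exp_ge_zero[of "2 * L * T"]] by linarith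
    then have g: "good (zs 0)"
      unfolding good_def zs0 case_prod_unfold using z0 real0 cz0 by simp
    have "norm (\<Phi> (\<lambda>t. z0) t l - z0 l) \<le> M l * exp (2 * L * t)" if t: "t \<in> ?I" and l: "l \<in> ?D" for t l
    proof -
      have b: "norm (G s (z0 l) l) \<le> K + L * norm (z0 l)" if "s \<in> {0..t}" for s
      proof -
        have "0 < R" using nz[OF l] norm_ge_zero[of "z0 l"] by linarith
        then have "norm (G s (z0 l) l - G s 0 l) \<le> L * norm (z0 l - 0)"
          using g t l that by (intro lip) (auto simp: good_def zs0)
        moreover have "norm (G s 0 l) \<le> K" using bd t l that by auto
        ultimately show ?thesis
          using norm_triangle_sub[of "G s (z0 l) l" "G s 0 l"] by simp
      qed
      have i: "(\<lambda>s. G s (z0 l) l) integrable_on {0..t}" using int[OF g t l] by (simp add: zs0)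
      have "norm (integral {0..t} (\<lambda>s. G s (z0 l) l)) \<le> integral {0..t} (\<lambda>s. K + L * norm (z0 l))"
        by (rule integral_norm_bound_integral) (use i b in auto)
      also have "\<dots> = t * (K + L * norm (z0 l))" using t by simp
      also have "\<dots> \<le> M l"
        unfolding M_def using t K[OF l] L by (intro mult_right_mono) auto
      also have "\<dots> \<le> M l * exp (2 * L * t)"
        using M0[OF l] L t by (simp add: mult_le_cancel_left1)
      finally show ?thesis by (simp add: \<Phi>_def)
    qed
    then show ?case using g by (simp add: zs0 zsS)
  next
    case (Suc n)
    then have g: "good (zs n)" by blast
    have b1: "norm (zs (Suc n) t l - z0 l) \<le> M l * exp (2 * L * t) * (2 - 2 / 2 ^ Suc n)"
      if t: "t \<in> ?I" "l \<in> ?D" for t l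
    proof -
      have "norm (zs (Suc n) t l - z0 l) \<le> norm (zs (Suc n) t l - zs n t l) + norm (zs n t l - z0 l)"
        using norm_triangle_ineq[of "zs (Suc n) t l - zs n t l" "zs n t l - z0 l"] by simp
      also have "\<dots> \<le> M l * exp (2 * L * t) / 2 ^ n + M l * exp (2 * L * t) * (2 - 2 / 2 ^ n)"
        using Suc.IH t by (intro add_mono) (simp_all del: times_divide_eq_right)
      also have "\<dots> = M l * exp (2 * L * t) * (2 - 2 / 2 ^ Suc n)"
        by (simp add: field_simps)
      finally show ?thesis .
    qed
    have "zs (Suc n) t l \<in> ball 0 R" if t: "t \<in> ?I" "l \<in> ?D" for t l
    proof -
      have "norm (zs (Suc n) t l - z0 l) \<le> M l * exp (2 * L * t) * 2"
        by (rule order_trans[OF b1[OF t]], rule mult_left_mono) (use M0[OF t(2)] in simp_all)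
      then have "norm (zs (Suc n) t l - z0 l) \<le> 2 * (M l * exp (2 * L * T))"
        using expT[OF t] by simp
      then show ?thesis
        using rad[OF t(2)] norm_triangle_sub[of "zs (Suc n) t l" "z0 l"] by simp
    qed
    then have g': "good (zs (Suc n))"
      using step[OF g] unfolding good_def zsS by blast
    have "norm (zs (Suc (Suc n)) t l - zs (Suc n) t l) \<le> M l * exp (2 * L * t) / 2 ^ Suc n"
      if t: "t \<in> ?I" and l: "l \<in> ?D" for t l
    proof -
      have "norm (\<Phi> (zs (Suc n)) t l - \<Phi> (zs n) t l)
          \<le> integral {0..t} (\<lambda>s. L * (M l * exp (2 * L * s) / 2 ^ n))"
      proof (rule diff[OF g' g t l])
        show "norm (zs (Suc n) s l - zs n s l) \<le> M l * exp (2 * L * s) / 2 ^ n" if "s \<in> {0..t}" for s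
          using Suc.IH that t l by (simp del: times_divide_eq_right)
      qed (intro continuous_intros, simp)
      \<comment> \<open>The weight yields the factor \<open>1 / 2\<close> here: its exponent
        differentiates to \<open>2 * L\<close>, twice the Lipschitz constant. Checking the primitive
        instead of dividing by \<open>L\<close> includes \<open>L = 0\<close>.\<close>
      also have "((\<lambda>s. L * (M l * exp (2 * L * s) / 2 ^ n)) has_integral
          (M l * exp (2 * L * t) / 2 ^ Suc n - M l * exp (2 * L * 0) / 2 ^ Suc n)) {0..t}"
        using t by (intro fundamental_theorem_of_calculus)
          (auto intro!: derivative_eq_intros simp flip: has_real_derivative_iff_has_vector_derivative)
      then have "integral {0..t} (\<lambda>s. L * (M l * exp (2 * L * s) / 2 ^ n))
          = M l * exp (2 * L * t) / 2 ^ Suc n - M l * exp (2 * L * 0) / 2 ^ Suc n"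
        by (rule integral_unique)
      also have "\<dots> \<le> M l * exp (2 * L * t) / 2 ^ Suc n" using M0[OF l] by simp
      finally show ?thesis by (simp add: zsS)
    qed
    then show ?case using g' b1 by blast
  qed
  \<comment> \<open>The limit is written as a telescoping series, so that the Weierstrass test gives
    convergence uniformly in \<open>t\<close> and \<open>l\<close> together; continuity and
    holomorphy of the limit follow.\<close>
  define Z where "Z = (\<lambda>x. z0 (snd x) + (\<Sum>n. zs (Suc n) (fst x) (snd x) - zs n (fst x) (snd x)))"
  have "uniform_limit (?I \<times> ?D) (\<lambda>N x. \<Sum>n<N. zs (Suc n) (fst x) (snd x) - zs n (fst x) (snd x))
      (\<lambda>x. \<Sum>n. zs (Suc n) (fst x) (snd x) - zs n (fst x) (snd x)) sequentially"
  proof (rule Weierstrass_m_test)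
    show "summable (\<lambda>n. R * (1 / 2) ^ n)" by (intro summable_mult summable_geometric) simp
    fix n x assume x: "x \<in> ?I \<times> ?D"
    then obtain t l where [simp]: "x = (t, l)" and t: "t \<in> ?I" "l \<in> ?D" by auto
    have "norm (zs (Suc n) t l - zs n t l) \<le> M l * exp (2 * L * t) / 2 ^ n"
      using main t by blast
    also have "\<dots> \<le> R / 2 ^ n"
    proof (rule divide_right_mono)
      show "M l * exp (2 * L * t) \<le> R"
        using expT[OF t] rad[OF t(2)] mult_nonneg_nonneg[OF M0[OF t(2)] exp_ge_zero[of "2 * L * T"]]
          norm_ge_zero[of "z0 l"] by linarith
    qed simp
    finally show "norm (zs (Suc n) (fst x) (snd x) - zs n (fst x) (snd x)) \<le> R * (1 / 2) ^ n"
      by (simp add: power_one_over field_simps)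
  qed
  then have "uniform_limit (?I \<times> ?D) (\<lambda>N x. z0 (snd x) + (\<Sum>n<N. zs (Suc n) (fst x) (snd x) - zs n (fst
      x) (snd x)))
      Z sequentially"
    unfolding Z_def by (intro uniform_limit_intros)
  then have ul: "uniform_limit (?I \<times> ?D) (\<lambda>N x. zs N (fst x) (snd x)) Z sequentially"
    by (simp add: sum_lessThan_telescope[of "\<lambda>n. zs n _ _"] zs0)
  define z where "z = (\<lambda>t l. Z (t, l))"
  have lim: "(\<lambda>n. zs n t l) \<longlonglongrightarrow> z t l" if "t \<in> ?I" "l \<in> ?D" for t l
    using tendsto_uniform_limitI[OF ul, of "(t, l)"] that by (simp add: z_def)
  have zb: "z t l \<in> ball 0 R" if t: "t \<in> ?I" "l \<in> ?D" for t l
  proof -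
    have "norm (zs n t l - z0 l) \<le> 2 * (M l * exp (2 * L * T))" for n
    proof -
      have "norm (zs n t l - z0 l) \<le> M l * exp (2 * L * t) * (2 - 2 / 2 ^ n)"
        using main t by blast
      also have "\<dots> \<le> M l * exp (2 * L * t) * 2"
        by (rule mult_left_mono) (use M0[OF t(2)] in simp_all)
      finally show ?thesis using expT[OF t] by simp
    qed
    then have "norm (z t l - z0 l) \<le> 2 * (M l * exp (2 * L * T))"
      by (intro LIMSEQ_le_const2[OF tendsto_norm[OF tendsto_diff[OF lim[OF t] tendsto_const]]]) auto
    then show ?thesis
      using rad[OF t(2)] norm_triangle_sub[of "z t l" "z0 l"] by simp
  qed
  have zc: "continuous_on (?I \<times> ?D) (\<lambda>(t, l). z t l)"
  proof -
    have "continuous_on (?I \<times> ?D) Z"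
      by (rule uniform_limit_theorem[OF _ ul])
        (use main in \<open>simp_all add: good_def case_prod_unfold\<close>)
    then show ?thesis by (simp add: z_def)
  qed
  have zh: "z t holomorphic_on ?D" if t: "t \<in> ?I" for t
  proof (rule holomorphic_uniform_sequence)
    show "zs n t holomorphic_on ?D" for n using main t by (auto simp: good_def)
    fix l assume "l \<in> ?D"
    then have "\<exists>d>0. cball l d \<subseteq> ?D"
      using open_contains_cball open_ball by blast
    then obtain d where d: "0 < d" "cball l d \<subseteq> ?D" by blast
    have "uniform_limit (cball l d) (\<lambda>n l. zs n t l) (z t) sequentially"
      unfolding uniform_limit_iff z_def
    proof (intro allI impI)
      fix e :: real assume "e > 0"
      from uniform_limitD[OF ul this]
      show "\<forall>\<^sub>F n in sequentially. \<forall>x\<in>cball l d. dist (zs n t x) (Z (t, x)) < e"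
        by (rule eventually_mono) (use d t in force)
    qed
    with d show "\<exists>d>0. cball l d \<subseteq> ?D \<and> uniform_limit (cball l d) (\<lambda>n. zs n t) (z t) sequentially"
      by blast
  qed simp
  have zr: "z t l \<in> \<real>" if "t \<in> ?I" "l \<in> ?D" "l \<in> \<real>" for t l
    by (rule Lim_in_closed_set[OF closed_complex_Reals _ _ lim])
      (use main that in \<open>auto simp: good_def\<close>)
  have gz: "good z" using zb zc zh zr by (simp add: good_def)
  have fix_eq: "z t l = \<Phi> z t l" if t: "t \<in> ?I" and l: "l \<in> ?D" for t l
  proof (rule LIMSEQ_unique)
    show "(\<lambda>n. zs (Suc n) t l) \<longlonglongrightarrow> z t l" using LIMSEQ_Suc[OF lim[OF t l]] .
    show "(\<lambda>n. zs (Suc n) t l) \<longlonglongrightarrow> \<Phi> z t l"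
      unfolding tendsto_iff
    proof (intro allI impI)
      fix e :: real assume e: "e > 0"
      \<comment> \<open>The summand \<open>1\<close> keeps the denominator positive when
        \<open>L = 0\<close>.\<close>
      define e' where "e' = e / (2 * (T * L + 1))"
      have TL: "0 < T * L + 1" using T L by (simp add: add_nonneg_pos)
      then have "e' > 0" using e by (simp add: e'_def)
      from uniform_limitD[OF ul this]
      show "\<forall>\<^sub>F n in sequentially. dist (zs (Suc n) t l) (\<Phi> z t l) < e"
      proof (rule eventually_mono)
        fix n assume n: "\<forall>x\<in>?I \<times> ?D. dist (zs n (fst x) (snd x)) (Z x) < e'"
        have "norm (\<Phi> (zs n) t l - \<Phi> z t l) \<le> integral {0..t} (\<lambda>s. L * e')"
          by (rule diff) (use n t l main gz in \<open>auto simp: z_def dist_norm less_imp_le\<close>)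
        also have "\<dots> = t * L * e'" using t by simp
        also have "\<dots> \<le> T * L * e'" using t L \<open>e' > 0\<close> by (intro mult_right_mono) auto
        also have "\<dots> \<le> (T * L + 1) * e'" using \<open>e' > 0\<close> by (simp add: algebra_simps)
        also have "\<dots> = e / 2"
        proof -
          have "C * (e / (2 * C)) = e / 2" if "0 < C" for C using that by simp
          from this[OF TL] show ?thesis by (simp only: e'_def)
        qed
        finally show "dist (zs (Suc n) t l) (\<Phi> z t l) < e" using e by (simp add: dist_norm zsS)
      qed
    qed
  qed
  have der: "((\<lambda>t. z t l) has_vector_derivative G t (z t l) l) (at t within ?I)"
    if t: "t \<in> ?I" and l: "l \<in> ?D" for t l
  proof -
    have "((\<lambda>t. integral {0..t} (\<lambda>s. G s (z s l) l)) has_vector_derivative G t (z t l) l) (at t within ?I)"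
      by (rule integral_has_vector_derivative[OF slice[OF Gcont[OF zc]]]) (use zb T t l in auto)
    then have "((\<lambda>t. \<Phi> z t l) has_vector_derivative G t (z t l) l) (at t within ?I)"
      unfolding \<Phi>_def by (auto intro!: derivative_eq_intros)
    then show ?thesis
      by (rule has_vector_derivative_transform[OF t, rotated]) (use fix_eq l in auto)
  qed
  have "z 0 l = z0 l" if "l \<in> ?D" for l
    using fix_eq[of 0 l] that T by (simp add: \<Phi>_def)
  from that[OF this zb der zh zr] show thesis .
qed


subsection \<open>Orbit arcs and half-returns\<close>

definition locally_lipschitz :: "'a::real_normed_vector set \<Rightarrow> ('a \<Rightarrow> 'a) \<Rightarrow> bool" where
  "locally_lipschitz U F \<longleftrightarrow>
    (\<forall>p\<in>U. \<exists>r>0. \<exists>L. \<forall>q\<in>ball p r. \<forall>q'\<in>ball p r. norm (F q - F q') \<le> L * norm (q - q'))"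

lemma locally_lipschitz_uminus: "locally_lipschitz U F \<Longrightarrow> locally_lipschitz U (\<lambda>p. - F p)"
  unfolding locally_lipschitz_def by (simp add: norm_minus_commute)

lemma orbit_arc_restrict:
  assumes "orbit_arc U F \<gamma> T" "0 < S" "S \<le> T"
  shows "orbit_arc U F \<gamma> S"
proof -
  have s: "{0..S} \<subseteq> {0..T}" using assms by auto
  show ?thesis
    using assms s unfolding orbit_arc_def
    by (auto intro: has_vector_derivative_within_subset[OF _ s])
qed

lemma orbit_arc_reverse:
  assumes "orbit_arc U F \<gamma> T"
  shows "orbit_arc U (\<lambda>p. - F p) (\<lambda>t. \<gamma> (T - t)) T"
  unfolding orbit_arc_def
proof (intro conjI ballI)
  show "0 < T" using assms by (simp add: orbit_arc_def)
  show "(\<lambda>t. \<gamma> (T - t)) ` {0..T} \<subseteq> U" using assms by (auto simp: orbit_arc_def)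
  fix t assume t: "t \<in> {0..T}"
  have im: "(\<lambda>t. T - t) ` {0..T} = {0..T}" by auto
  have 1: "((\<lambda>t. T - t) has_vector_derivative - 1) (at t within {0..T})"
    by (auto intro!: derivative_eq_intros)
  have 2: "(\<gamma> has_vector_derivative F (\<gamma> (T - t))) (at (T - t) within (\<lambda>t. T - t) ` {0..T})"
    using assms t im by (auto simp: orbit_arc_def)
  show "((\<lambda>t. \<gamma> (T - t)) has_vector_derivative - F (\<gamma> (T - t))) (at t within {0..T})"
    using vector_diff_chain_within[OF 1 2] by (simp add: o_def)
qed

section \<open>Uniqueness of orbits with a given initial point\<close>

text \<open>The times at which both arcs agree form a closed subset of the connected interval
  \<open>{0..T}\<close> that contains \<open>0\<close>; the local Lipschitz bound makes it open as
  well.\<close>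

lemma orbit_arc_unique:
  assumes lip: "locally_lipschitz U F" and \<gamma>: "orbit_arc U F \<gamma> T" and \<delta>: "orbit_arc U F \<delta> T"
    and 0: "\<gamma> 0 = \<delta> 0" and t: "t \<in> {0..T}"
  shows "\<gamma> t = \<delta> t"
proof -
  let ?I = "{0..T}"
  define w where "w = (\<lambda>t. \<gamma> t - \<delta> t)"
  have d: "(\<gamma> has_vector_derivative F (\<gamma> t)) (at t within ?I)" "(\<delta> has_vector_derivative F (\<delta> t)) (at t
      within ?I)"
    if "t \<in> ?I" for t using \<gamma> \<delta> that by (auto simp: orbit_arc_def)
  have c: "continuous_on ?I \<gamma>" "continuous_on ?I \<delta>"
    unfolding continuous_on_eq_continuous_within using d by (blast intro: has_vector_derivative_continuous)+
  have cw: "continuous_on ?I w" unfolding w_def by (intro continuous_intros c)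
  have loc: "\<exists>h>0. \<forall>t\<in>?I. dist t t0 < h \<longrightarrow> w t = 0" if t0: "t0 \<in> ?I" "w t0 = 0" for t0
  proof -
    have "\<gamma> t0 \<in> U" using \<gamma> t0 by (auto simp: orbit_arc_def)
    then obtain r L where r: "r > 0" and
      L: "\<And>q q'. q \<in> ball (\<gamma> t0) r \<Longrightarrow> q' \<in> ball (\<gamma> t0) r \<Longrightarrow> norm (F q - F q') \<le> L * norm (q - q')"
      using lip unfolding locally_lipschitz_def by blast
    obtain h1 where h1: "h1 > 0" "\<And>t. t \<in> ?I \<Longrightarrow> dist t t0 < h1 \<Longrightarrow> dist (\<gamma> t) (\<gamma> t0) < r"
      using c(1) t0 r by (metis continuous_on_iff)
    obtain h2 where h2: "h2 > 0" "\<And>t. t \<in> ?I \<Longrightarrow> dist t t0 < h2 \<Longrightarrow> dist (\<delta> t) (\<delta> t0) < r"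
      using c(2) t0 r by (metis continuous_on_iff)
    \<comment> \<open>\<open>L\<close> is not known to be positive; \<open>K\<close> is, and
      \<open>h\<close> can then be chosen with \<open>K * h \<le> 1 / 2\<close>.\<close>
    define K where "K = max L 1"
    define h where "h = min (min (h1 / 2) (h2 / 2)) (1 / (2 * K))"
    have K: "1 \<le> K" "L \<le> K" by (auto simp: K_def)
    have h: "0 < h" "h < h1" "h < h2" "K * h \<le> 1 / 2"
    proof -
      show "0 < h" "h < h1" "h < h2" using h1 h2 K by (auto simp: h_def)
      have "K * h \<le> K * (1 / (2 * K))" using K by (intro mult_left_mono) (auto simp: h_def)
      then show "K * h \<le> 1 / 2" using K by simp
    qed
    let ?J = "?I \<inter> cball t0 h"
    have J: "compact ?J" "convex ?J" "t0 \<in> ?J" "?J \<noteq> {}"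
      using t0 h by (auto intro: compact_Int_closed convex_Int)
    \<comment> \<open>At a maximum point of \<open>norm (w t)\<close> near \<open>t0\<close> the
      mean value inequality gives \<open>norm (w t1) \<le> 1 / 2 * norm (w t1)\<close>, so
      \<open>w\<close> vanishes near \<open>t0\<close>.\<close>
    obtain t1 where t1: "t1 \<in> ?J" "\<And>t. t \<in> ?J \<Longrightarrow> norm (w t) \<le> norm (w t1)"
      using continuous_attains_sup[OF J(1,4) continuous_on_norm[OF continuous_on_subset[OF cw]]] by auto
    have b: "norm (F (\<gamma> t) - F (\<delta> t)) \<le> K * norm (w t1)" if "t \<in> ?J" for t
    proof -
      have "dist t t0 \<le> h" using that by (simp add: dist_commute)
      then have "norm (F (\<gamma> t) - F (\<delta> t)) \<le> L * norm (\<gamma> t - \<delta> t)"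
        using that h h1(2)[of t] h2(2)[of t] t0(2) by (intro L) (auto simp: dist_commute w_def)
      also have "\<dots> \<le> K * norm (\<gamma> t - \<delta> t)" using K by (intro mult_right_mono) auto
      also have "\<dots> \<le> K * norm (w t1)" using t1(2)[OF that] K by (intro mult_left_mono) (auto simp: w_def)
      finally show ?thesis .
    qed
    have "norm (w t1 - w t0) \<le> (K * norm (w t1)) * norm (t1 - t0)"
    proof (rule differentiable_bound[OF J(2) _ _ t1(1) J(3)])
      fix t assume t: "t \<in> ?J"
      have "(w has_vector_derivative F (\<gamma> t) - F (\<delta> t)) (at t within ?J)"
        unfolding w_def using t has_vector_derivative_within_subset[OF d(1), of t ?J]
          has_vector_derivative_within_subset[OF d(2), of t ?J]
        by (intro has_vector_derivative_diff) auto
      then show "(w has_derivative (\<lambda>h. h *\<^sub>R (F (\<gamma> t) - F (\<delta> t)))) (at t within ?J)"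
        by (simp add: has_vector_derivative_def)
      show "onorm (\<lambda>h. h *\<^sub>R (F (\<gamma> t) - F (\<delta> t))) \<le> K * norm (w t1)"
      proof (rule onorm_bound)
        show "norm (x *\<^sub>R (F (\<gamma> t) - F (\<delta> t))) \<le> K * norm (w t1) * norm x" for x :: real
          using mult_right_mono[OF b[OF t], of "norm x"] by (simp add: mult.commute)
      qed (use K in auto)
    qed
    also have "\<dots> \<le> (K * norm (w t1)) * h"
      using t1(1) K by (intro mult_left_mono) (auto simp: dist_norm norm_minus_commute)
    also have "\<dots> = (K * h) * norm (w t1)" by simp
    also have "\<dots> \<le> 1 / 2 * norm (w t1)" using h(4) by (intro mult_right_mono) auto
    finally have "norm (w t1) = 0" using t0(2) by simp
    then have "w t = 0" if "t \<in> ?J" for t using t1(2)[OF that] by simp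
    then show ?thesis using h(1) by (intro exI[of _ h]) (auto simp: dist_commute)
  qed
  let ?E = "{t \<in> ?I. w t = 0}"
  have "closedin (top_of_set ?I) ?E" by (rule continuous_closedin_preimage_constant[OF cw])
  moreover have "openin (top_of_set ?I) ?E"
    unfolding openin_euclidean_subtopology_iff using loc by fastforce
  moreover have "connected ?I" by simp
  ultimately have "?E = {} \<or> ?E = ?I" unfolding connected_clopen by blast
  moreover have "0 \<in> ?E" using 0 t by (simp add: w_def)
  ultimately have "?E = ?I" by blast
  then have "t \<in> ?E" using t by simp
  then show ?thesis by (simp add: w_def)
qed

section \<open>Half-returns and uniqueness of their end points\<close>

text \<open>The part common to the upper and the lower half-return. Leaving out the signs of the end
  points makes the relation compatible with time reversal, which exchanges them.\<close>

definition half_return ::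
  "(real \<Rightarrow> bool) \<Rightarrow> (real \<times> real) set \<Rightarrow> (real \<times> real \<Rightarrow> real \<times> real) \<Rightarrow> real \<Rightarrow> real \<Rightarrow> bool" where
  "half_return P U F x y \<longleftrightarrow>
    (\<exists>\<gamma> T. orbit_arc U F \<gamma> T \<and> \<gamma> 0 = (x, 0) \<and> \<gamma> T = (y, 0) \<and> (\<forall>t\<in>{0<..<T}. P (snd (\<gamma> t))))"

lemma upper_half_return_iff:
  "upper_half_return U F x y \<longleftrightarrow> x > 0 \<and> y < 0 \<and> half_return (\<lambda>v. v > 0) U F x y"
  unfolding upper_half_return_def half_return_def ..

lemma lower_half_return_iff:
  "lower_half_return U F x y \<longleftrightarrow> x < 0 \<and> y > 0 \<and> half_return (\<lambda>v. v < 0) U F x y"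
  unfolding lower_half_return_def half_return_def ..

text \<open>If one arc ended before the other, uniqueness would put the longer one at height
  \<open>0\<close> at an interior time, against \<open>\<not> P 0\<close>. So the durations agree,
  and with them the end points.\<close>

lemma half_return_unique_end:
  assumes lip: "locally_lipschitz U F" and P: "\<not> P 0"
    and "half_return P U F x y" "half_return P U F x y'"
  shows "y = y'"
proof -
  have *: "T \<le> S" if \<gamma>: "orbit_arc U F \<gamma> T" "\<forall>t\<in>{0<..<T}. P (snd (\<gamma> t))"
    and \<delta>: "orbit_arc U F \<delta> S" "\<delta> S = (z, 0)" and 0: "\<gamma> 0 = \<delta> 0" for \<gamma> \<delta> T S z
  proof (rule ccontr)
    assume "\<not> T \<le> S"
    moreover have "0 < S" using \<delta> by (simp add: orbit_arc_def)
    ultimately have "orbit_arc U F \<gamma> S" "S \<in> {0..S}" "S \<in> {0<..<T}"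
      using orbit_arc_restrict[OF \<gamma>(1)] by auto
    from orbit_arc_unique[OF lip this(1) \<delta>(1) 0 this(2)] this(3) \<gamma>(2) \<delta>(2) P show False by force
  qed
  obtain \<gamma> T \<delta> S where \<gamma>: "orbit_arc U F \<gamma> T" "\<gamma> 0 = (x, 0)" "\<gamma> T = (y, 0)" "\<forall>t\<in>{0<..<T}. P (snd (\<gamma> t))"
    and \<delta>: "orbit_arc U F \<delta> S" "\<delta> 0 = (x, 0)" "\<delta> S = (y', 0)" "\<forall>t\<in>{0<..<S}. P (snd (\<delta> t))"
    using assms unfolding half_return_def by blast
  have "T = S"
    using *[OF \<gamma>(1,4) \<delta>(1,3)] *[OF \<delta>(1,4) \<gamma>(1,3)] \<gamma>(2) \<delta>(2) by simp
  moreover have "0 < T" using \<gamma>(1) by (simp add: orbit_arc_def)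
  moreover have "orbit_arc U F \<delta> T" "\<gamma> 0 = \<delta> 0" using \<open>T = S\<close> \<delta>(1,2) \<gamma>(2) by simp_all
  ultimately have "\<gamma> T = \<delta> T"
    using orbit_arc_unique[OF lip \<gamma>(1), of \<delta> T] by simp
  then show ?thesis using \<gamma>(3) \<delta>(3) \<open>T = S\<close> by simp
qed

lemma half_return_reverse:
  assumes "half_return P U F x y"
  shows "half_return P U (\<lambda>p. - F p) y x"
proof -
  obtain \<gamma> T where \<gamma>: "orbit_arc U F \<gamma> T" "\<gamma> 0 = (x, 0)" "\<gamma> T = (y, 0)" "\<forall>t\<in>{0<..<T}. P (snd (\<gamma> t))"
    using assms unfolding half_return_def by blast
  then show ?thesis
    unfolding half_return_def
    by (intro exI[of _ "\<lambda>t. \<gamma> (T - t)"] exI[of _ T]) (simp add: orbit_arc_reverse)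
qed

text \<open>The start of a half-return of \<open>F\<close> is the end of a half-return of
  \<open>- F\<close>.\<close>

lemma half_return_unique_start:
  assumes "locally_lipschitz U F" "\<not> P 0" "half_return P U F x y" "half_return P U F x' y"
  shows "x = x'"
  using half_return_unique_end[OF locally_lipschitz_uminus] half_return_reverse assms by blast

section \<open>Reparametrising a curve as an orbit\<close>

text \<open>The half-returns are constructed as curves in a convenient parameter, the polar angle or
  the abscissa. Here \<open>k\<close> is the time spent per unit of that parameter, and composition
  with the inverse of a primitive of \<open>k\<close> gives an orbit.\<close>

lemma orbit_arc_time_change:
  fixes c :: "real \<Rightarrow> real \<times> real"
  assumes ab: "a < b" and U: "c ` {a..b} \<subseteq> U"
    and der: "\<And>s. s \<in> {a..b} \<Longrightarrow> (c has_vector_derivative k s *\<^sub>R F (c s)) (at s within {a..b})"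
    and k: "continuous_on {a..b} k" and pos: "\<And>s. s \<in> {a..b} \<Longrightarrow> 0 < k s"
  obtains \<gamma> T where "orbit_arc U F \<gamma> T" "\<gamma> 0 = c a" "\<gamma> T = c b" "\<gamma> ` {0<..<T} \<subseteq> c ` {a<..<b}"
proof -
  \<comment> \<open>Continuing \<open>k\<close> by constants makes \<open>\<tau>\<close> strictly
    increasing on the larger interval \<open>?J\<close>, so that the two-sided inverse function
    theorem also covers the end points \<open>0\<close> and \<open>T\<close>.\<close>
  define q where "q = (\<lambda>s. k (max a (min b s)))"
  have qpos: "0 < q s" for s using ab by (auto simp: q_def intro!: pos)
  have qc: "continuous_on A q" for A
    unfolding q_def by (rule continuous_on_compose2[OF k]) (use ab in \<open>auto intro!: continuous_intros\<close>)
  let ?J = "{a - 1..b + 1}"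
  define \<tau> where "\<tau> = (\<lambda>s. integral {a - 1..s} q - integral {a - 1..a} q)"
  have dw: "(\<tau> has_real_derivative q s) (at s within ?J)" if "s \<in> ?J" for s
    unfolding \<tau>_def using integral_has_real_derivative[OF qc that] by (auto intro!: derivative_eq_intros)
  have d: "(\<tau> has_real_derivative q s) (at s)" if "a - 1 < s" "s < b + 1" for s
    using dw[of s] that by (simp add: at_within_Icc_at)
  have tc: "continuous_on ?J \<tau>" using dw DERIV_continuous by (metis continuous_on_eq_continuous_within)
  have mono: "\<tau> s < \<tau> t" if st: "s \<in> ?J" "t \<in> ?J" "s < t" for s t
  proof (rule DERIV_pos_imp_increasing_open[OF st(3)])
    show "\<exists>y. DERIV \<tau> x :> y \<and> y > 0" if "s < x" "x < t" for x
      using d[of x] qpos[of x] that st by (intro exI[of _ "q x"]) simp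
    show "continuous_on {s..t} \<tau>"
      by (rule continuous_on_subset[OF tc]) (use st in simp)
  qed
  have inj: "inj_on \<tau> ?J" by (rule linorder_inj_onI') (metis mono less_irrefl)
  define g where "g = inv_into ?J \<tau>"
  have gt: "g (\<tau> s) = s" if "s \<in> ?J" for s using inv_into_f_f[OF inj that] by (simp add: g_def)
  have tg: "\<tau> (g y) = y \<and> g y \<in> ?J" if y: "\<tau> (a - 1) \<le> y" "y \<le> \<tau> (b + 1)" for y
  proof -
    obtain s where "s \<in> ?J" "\<tau> s = y"
      using IVT'[of \<tau> "a - 1" y "b + 1", OF y _ tc] ab by auto
    then show ?thesis using gt by auto
  qed
  have ta: "\<tau> a = 0" by (simp add: \<tau>_def)
  define T where "T = \<tau> b"
  have T: "0 < T" using mono[of a b] ab ta by (simp add: T_def)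
  have lo: "\<tau> (a - 1) < 0" and hi: "T < \<tau> (b + 1)"
    using mono[of "a - 1" a] mono[of b "b + 1"] ab ta by (auto simp: T_def)
  have ends: "g 0 = a" "g T = b" using gt[of a] gt[of b] ab ta by (auto simp: T_def)
  have gin: "g t \<in> {a<..<b}" if "0 < t" "t < T" for t
  proof -
    have t: "\<tau> (g t) = t" "g t \<in> ?J" using tg[of t] that lo hi by auto
    have "\<not> g t \<le> a" using mono[of "g t" a] t that ta ab by (cases "g t = a") auto
    moreover have "\<not> b \<le> g t" using mono[of b "g t"] t that ab by (cases "g t = b") (auto simp: T_def)
    ultimately show ?thesis by auto
  qed
  have gin': "g t \<in> {a..b}" if "t \<in> {0..T}" for t
    using gin[of t] ends that ab by (cases "t = 0"; cases "t = T") auto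
  have gd: "(g has_real_derivative inverse (k (g t))) (at t)" if t: "t \<in> {0..T}" for t
  proof (rule DERIV_inverse_function[where f = \<tau> and a = "\<tau> (a - 1)" and b = "\<tau> (b + 1)"])
    have gt': "g t \<in> {a..b}" using gin' t .
    then show "(\<tau> has_real_derivative k (g t)) (at (g t))"
      using d[of "g t"] by (simp add: q_def)
    show "k (g t) \<noteq> 0" using pos[OF gt'] by simp
    show "\<tau> (a - 1) < t" "t < \<tau> (b + 1)" using t lo hi by auto
    show "\<tau> (g y) = y" if "\<tau> (a - 1) < y" "y < \<tau> (b + 1)" for y
      using tg[of y] that by auto
    have "isCont g (\<tau> (g t))"
    proof (rule isCont_inverse_function2[where f = \<tau> and x = "g t" and a = "a - 1 / 2" and b = "b + 1 / 2"])
      show "a - 1 / 2 < g t" "g t < b + 1 / 2" using gt' by auto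
      show "g (\<tau> z) = z" if "a - 1 / 2 \<le> z" "z \<le> b + 1 / 2" for z using gt that by auto
      show "isCont \<tau> z" if "a - 1 / 2 \<le> z" "z \<le> b + 1 / 2" for z
        using d[of z] that by (intro DERIV_isCont) auto
    qed
    then show "isCont g t" using tg[of t] t lo hi by auto
  qed
  have "orbit_arc U F (c \<circ> g) T"
    unfolding orbit_arc_def
  proof (intro conjI ballI)
    show "(c \<circ> g) ` {0..T} \<subseteq> U" using gin' U by auto
    fix t assume t: "t \<in> {0..T}"
    have 1: "(g has_vector_derivative inverse (k (g t))) (at t within {0..T})"
      using gd[OF t] by (simp add: has_field_derivative_at_within flip:
          has_real_derivative_iff_has_vector_derivative)
    have 2: "(c has_vector_derivative k (g t) *\<^sub>R F (c (g t))) (at (g t) within g ` {0..T})"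
      by (rule has_vector_derivative_within_subset[OF der]) (use gin' t in auto)
    show "((c \<circ> g) has_vector_derivative F ((c \<circ> g) t)) (at t within {0..T})"
      using vector_diff_chain_within[OF 1 2] pos[OF gin'[OF t]] by simp
  qed (rule T)
  moreover have "(c \<circ> g) ` {0<..<T} \<subseteq> c ` {a<..<b}" using gin by auto
  ultimately show thesis using that[of "c \<circ> g" T] ends by simp
qed


subsection \<open>Holomorphic functions on a bidisc\<close>

text \<open>Absolute summability at the corner \<open>(\<rho>, \<rho>)\<close> dominates the complex
  series on the whole closed bidisc, as the Weierstrass test requires.\<close>

definition bidisc_summable :: "(nat \<Rightarrow> nat \<Rightarrow> real) \<Rightarrow> real \<Rightarrow> bool" where
  "bidisc_summable c \<rho> \<longleftrightarrow> 0 < \<rho> \<and> (\<lambda>(i, j). \<bar>c i j\<bar> * \<rho> ^ i * \<rho> ^ j) summable_on UNIV"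

definition double_series :: "(nat \<Rightarrow> nat \<Rightarrow> real) \<Rightarrow> complex \<Rightarrow> complex \<Rightarrow> complex" where
  "double_series c z w = (\<Sum>\<^sub>\<infinity>(i, j). of_real (c i j) * z ^ i * w ^ j)"

text \<open>Holomorphy in two variables is encoded by composition with pairs of holomorphic curves.\<close>

definition holomorphic_bidisc :: "real \<Rightarrow> (complex \<Rightarrow> complex \<Rightarrow> complex) \<Rightarrow> bool" where
  "holomorphic_bidisc \<rho> f \<longleftrightarrow>
    continuous_on (cball 0 \<rho> \<times> cball 0 \<rho>) (\<lambda>(z, w). f z w) \<and>
    (\<forall>S p q. open S \<longrightarrow> p holomorphic_on S \<longrightarrow> q holomorphic_on S \<longrightarrow> p ` S \<subseteq> cball 0 \<rho> \<longrightarrow>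
      q ` S \<subseteq> cball 0 \<rho> \<longrightarrow> (\<lambda>x. f (p x) (q x)) holomorphic_on S) \<and>
    (\<forall>z\<in>cball 0 \<rho> \<inter> \<real>. \<forall>w\<in>cball 0 \<rho> \<inter> \<real>. f z w \<in> \<real>)"

lemma holomorphic_bidisc_compose:
  assumes "holomorphic_bidisc \<rho> f" "open S" "p holomorphic_on S" "q holomorphic_on S"
    "\<And>x. x \<in> S \<Longrightarrow> norm (p x) \<le> \<rho>" "\<And>x. x \<in> S \<Longrightarrow> norm (q x) \<le> \<rho>"
  shows "(\<lambda>x. f (p x) (q x)) holomorphic_on S"
  using assms unfolding holomorphic_bidisc_def by (simp add: image_subset_iff)

lemma holomorphic_bidisc_continuous:
  fixes p q :: "'a::topological_space \<Rightarrow> complex"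
  assumes "holomorphic_bidisc \<rho> f" "continuous_on S p" "continuous_on S q"
    "\<And>x. x \<in> S \<Longrightarrow> norm (p x) \<le> \<rho>" "\<And>x. x \<in> S \<Longrightarrow> norm (q x) \<le> \<rho>"
  shows "continuous_on S (\<lambda>x. f (p x) (q x))"
proof -
  have "continuous_on (cball 0 \<rho> \<times> cball 0 \<rho>) (\<lambda>(z, w). f z w)"
    using assms(1) by (simp add: holomorphic_bidisc_def)
  from continuous_on_compose2[OF this continuous_on_Pair[OF assms(2,3)]] show ?thesis
    using assms(4,5) by (auto simp: image_subset_iff)
qed

lemma holomorphic_bidisc_real:
  "holomorphic_bidisc \<rho> f \<Longrightarrow> norm z \<le> \<rho> \<Longrightarrow> norm w \<le> \<rho> \<Longrightarrow> z \<in> \<real> \<Longrightarrow> w \<in> \<real> \<Longrightarrow> f z w \<in> \<real>"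
  by (simp add: holomorphic_bidisc_def)

lemma holomorphic_bidisc_mono:
  assumes "holomorphic_bidisc \<rho> f" "\<rho>' \<le> \<rho>"
  shows "holomorphic_bidisc \<rho>' f"
proof -
  have *: "cball (0::complex) \<rho>' \<subseteq> cball 0 \<rho>" using assms(2) by auto
  show ?thesis
    unfolding holomorphic_bidisc_def
  proof (intro conjI allI impI ballI)
    show "continuous_on (cball 0 \<rho>' \<times> cball 0 \<rho>') (\<lambda>(z, w). f z w)"
      by (rule continuous_on_subset[of "cball 0 \<rho> \<times> cball 0 \<rho>"])
        (use assms * in \<open>auto simp: holomorphic_bidisc_def\<close>)
    fix S p q assume "open S" "p holomorphic_on S" "q holomorphic_on S"
      and "p ` S \<subseteq> cball 0 \<rho>'" "q ` S \<subseteq> cball 0 \<rho>'"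
    then show "(\<lambda>x. f (p x) (q x)) holomorphic_on S"
      using assms(1) * unfolding holomorphic_bidisc_def by (meson subset_trans)
  next
    fix z w :: complex assume "z \<in> cball 0 \<rho>' \<inter> \<real>" "w \<in> cball 0 \<rho>' \<inter> \<real>"
    then show "f z w \<in> \<real>" by (intro holomorphic_bidisc_real[OF assms(1)]) (use assms(2) in auto)
  qed
qed

lemma holomorphic_bidisc_divide:
  assumes "holomorphic_bidisc \<rho> f" "holomorphic_bidisc \<rho> g"
    and "\<And>z w. norm z \<le> \<rho> \<Longrightarrow> norm w \<le> \<rho> \<Longrightarrow> g z w \<noteq> 0"
  shows "holomorphic_bidisc \<rho> (\<lambda>z w. f z w / g z w)"
  using assms unfolding holomorphic_bidisc_def case_prod_unfold
  by (auto intro!: continuous_intros holomorphic_intros Reals_divide simp: image_subset_iff)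

lemma holomorphic_bidisc_one_variable:
  assumes f: "f holomorphic_on ball 0 r" "\<rho> < r"
    and real: "\<And>z. z \<in> ball 0 r \<Longrightarrow> z \<in> \<real> \<Longrightarrow> f z \<in> \<real>"
  shows "holomorphic_bidisc \<rho> (\<lambda>z w. f z)"
  unfolding holomorphic_bidisc_def
proof (intro conjI allI impI ballI)
  show "continuous_on (cball 0 \<rho> \<times> cball 0 \<rho>) (\<lambda>(z, w). f z)"
    unfolding case_prod_unfold
    by (rule continuous_on_compose2[OF holomorphic_on_imp_continuous_on[OF f(1)]])
      (use f(2) in \<open>auto intro!: continuous_intros\<close>)
  fix S :: "complex set" and p q :: "complex \<Rightarrow> complex"
  assume "open S" "p holomorphic_on S" "p ` S \<subseteq> cball 0 \<rho>"
  moreover have "cball 0 \<rho> \<subseteq> ball (0::complex) r" using f(2) by auto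
  ultimately show "(\<lambda>x. f (p x)) holomorphic_on S"
    using holomorphic_on_compose_gen[OF _ f(1), of p S] by (auto simp: o_def)
qed (use real f(2) in auto)

section \<open>Bounds and Lipschitz constants on the bidisc\<close>

lemma holomorphic_bidisc_bounded:
  assumes "holomorphic_bidisc \<rho> f"
  obtains B where "0 < B" "\<And>z w. norm z \<le> \<rho> \<Longrightarrow> norm w \<le> \<rho> \<Longrightarrow> norm (f z w) \<le> B"
proof -
  have "compact ((\<lambda>(z, w). f z w) ` (cball 0 \<rho> \<times> cball 0 \<rho>))"
    using assms by (intro compact_continuous_image compact_Times) (auto simp: holomorphic_bidisc_def)
  then obtain B where "0 < B" "\<forall>x\<in>(\<lambda>(z, w). f z w) ` (cball 0 \<rho> \<times> cball 0 \<rho>). norm x \<le> B"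
    using compact_imp_bounded bounded_pos by blast
  with that show thesis by (force simp: image_iff)
qed

text \<open>Cauchy's estimate for the derivative on circles of radius \<open>r / 4\<close>; centred
  in \<open>cball 0 (r / 2)\<close> they stay inside \<open>ball 0 r\<close>, hence the factor
  \<open>4\<close>.\<close>

lemma holomorphic_bounded_lipschitz:
  assumes f: "f holomorphic_on ball 0 r" and r: "0 < r"
    and B: "\<And>z. z \<in> ball 0 r \<Longrightarrow> norm (f z) \<le> B"
    and zw: "z \<in> cball 0 (r / 2)" "w \<in> cball 0 (r / 2)"
  shows "norm (f z - f w) \<le> 4 * B / r * norm (z - w)"
proof (rule field_differentiable_bound[OF convex_cball _ _ zw])
  fix x :: complex assume x: "x \<in> cball 0 (r / 2)"
  have sub: "cball x (r / 4) \<subseteq> ball 0 r"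
  proof
    fix y assume "y \<in> cball x (r / 4)"
    then have "norm y \<le> norm x + r / 4"
      using norm_triangle_sub[of y x] by (simp add: dist_norm norm_minus_commute)
    then show "y \<in> ball 0 r" using x r by simp
  qed
  have "x \<in> ball 0 r" using x r by simp
  then show "(f has_field_derivative deriv f x) (at x within cball 0 (r / 2))"
    using f holomorphic_derivI open_ball by blast
  have "norm ((deriv ^^ 1) f x) \<le> fact 1 * B / (r / 4) ^ 1"
  proof (rule Cauchy_inequality)
    show "f holomorphic_on ball x (r / 4)"
      using f sub ball_subset_cball holomorphic_on_subset by (meson subset_trans)
    show "continuous_on (cball x (r / 4)) f"
      using f sub continuous_on_subset holomorphic_on_imp_continuous_on by blast
    show "norm (f y) \<le> B" if "norm (x - y) = r / 4" for y
      using sub that by (intro B) (auto simp: dist_norm)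
  qed (use r in simp)
  then show "norm (deriv f x) \<le> 4 * B / r" by (simp add: mult.commute)
qed

text \<open>One variable is moved at a time: freezing the other leaves a holomorphic function of one
  variable, to which Cauchy's estimate applies.\<close>

lemma holomorphic_bidisc_lipschitz:
  assumes f: "holomorphic_bidisc \<rho> f" and \<rho>: "0 < \<rho>"
  obtains L where "0 < L"
    "\<And>z w z' w'. norm z \<le> \<rho> / 2 \<Longrightarrow> norm w \<le> \<rho> / 2 \<Longrightarrow> norm z' \<le> \<rho> / 2 \<Longrightarrow> norm w' \<le> \<rho> / 2
      \<Longrightarrow> norm (f z w - f z' w') \<le> L * (norm (z - z') + norm (w - w'))"
proof -
  obtain B where B: "0 < B" "\<And>z w. norm z \<le> \<rho> \<Longrightarrow> norm w \<le> \<rho> \<Longrightarrow> norm (f z w) \<le> B"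
    using holomorphic_bidisc_bounded[OF f] by blast
  show thesis
  proof
    show "0 < 4 * B / \<rho>" using B \<rho> by simp
    fix z w z' w' :: complex assume n: "norm z \<le> \<rho> / 2" "norm w \<le> \<rho> / 2" "norm z' \<le> \<rho> / 2" "norm w' \<le> \<rho> / 2"
    have "norm (f z w - f z' w) \<le> 4 * B / \<rho> * norm (z - z')"
      by (rule holomorphic_bounded_lipschitz[where f = "\<lambda>z. f z w"])
        (use n \<rho> B in \<open>auto intro!: holomorphic_bidisc_compose[OF f] holomorphic_intros\<close>)
    moreover have "norm (f z' w - f z' w') \<le> 4 * B / \<rho> * norm (w - w')"
      by (rule holomorphic_bounded_lipschitz[where f = "f z'"])
        (use n \<rho> B in \<open>auto intro!: holomorphic_bidisc_compose[OF f] holomorphic_intros\<close>)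
    ultimately show "norm (f z w - f z' w') \<le> 4 * B / \<rho> * (norm (z - z') + norm (w - w'))"
      using norm_triangle_ineq[of "f z w - f z' w" "f z' w - f z' w'"] by (simp add: distrib_left)
  qed
qed

section \<open>Convergence and splitting of double power series\<close>

lemma norm_double_series_term_le:
  fixes z w :: complex
  assumes "norm z \<le> \<rho>" "norm w \<le> \<rho>"
  shows "norm (of_real a * z ^ i * w ^ j) \<le> \<bar>a\<bar> * \<rho> ^ i * \<rho> ^ j"
proof -
  have "0 \<le> \<rho>" using assms(1) norm_ge_zero order_trans by blast
  then show ?thesis
    using assms by (auto simp: norm_mult norm_power intro!: mult_mono power_mono)
qed

lemma double_series_has_sum:
  assumes "bidisc_summable c \<rho>" "norm z \<le> \<rho>" "norm w \<le> \<rho>"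
  shows "((\<lambda>(i, j). of_real (c i j) * z ^ i * w ^ j) has_sum double_series c z w) UNIV"
proof -
  have "(\<lambda>x. norm ((\<lambda>(i, j). of_real (c i j) * z ^ i * w ^ j) x)) summable_on UNIV"
    by (rule Infinite_Sum.abs_summable_on_comparison_test'[where g = "\<lambda>(i, j). \<bar>c i j\<bar> * \<rho> ^ i * \<rho> ^ j"])
      (use assms norm_double_series_term_le in \<open>auto simp: bidisc_summable_def\<close>)
  then show ?thesis
    unfolding double_series_def by (intro has_sum_infsum) (rule abs_summable_summable)
qed

lemma double_series_uniform_limit:
  assumes "bidisc_summable c \<rho>"
  shows "uniform_limit (cball 0 \<rho> \<times> cball 0 \<rho>)
    (\<lambda>X x. \<Sum>(i, j)\<in>X. complex_of_real (c i j) * fst x ^ i * snd x ^ j) (\<lambda>x. double_series c (fst x) (snd x))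
    (finite_subsets_at_top UNIV)"
proof -
  have "uniform_limit (cball 0 \<rho> \<times> cball 0 \<rho>)
    (\<lambda>X x. \<Sum>k\<in>X. (\<lambda>(i, j). complex_of_real (c i j) * fst x ^ i * snd x ^ j) k)
    (\<lambda>x. \<Sum>\<^sub>\<infinity>k. (\<lambda>(i, j). complex_of_real (c i j) * fst x ^ i * snd x ^ j) k)
    (finite_subsets_at_top UNIV)"
    by (rule Weierstrass_m_test_general[where M = "\<lambda>(i, j). \<bar>c i j\<bar> * \<rho> ^ i * \<rho> ^ j"])
      (use assms norm_double_series_term_le in \<open>auto simp: bidisc_summable_def\<close>)
  then show ?thesis unfolding double_series_def .
qed

text \<open>Composed with holomorphic curves, the finite partial sums are holomorphic and converge
  uniformly on closed discs. At real arguments all terms are real, so the imaginary part of the sum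
  is a sum of zeros.\<close>

lemma holomorphic_bidisc_double_series:
  assumes c: "bidisc_summable c \<rho>"
  shows "holomorphic_bidisc \<rho> (double_series c)"
  unfolding holomorphic_bidisc_def
proof (intro conjI allI impI ballI)
  note ul = double_series_uniform_limit[OF c]
  show "continuous_on (cball 0 \<rho> \<times> cball 0 \<rho>) (\<lambda>(z, w). double_series c z w)"
    unfolding case_prod_unfold
    by (rule uniform_limit_theorem[OF _ ul])
      (auto simp: case_prod_unfold intro!: always_eventually continuous_intros)
  fix S and p q :: "complex \<Rightarrow> complex"
  assume S: "open S" and p: "p holomorphic_on S" and q: "q holomorphic_on S"
    and b: "p ` S \<subseteq> cball 0 \<rho>" "q ` S \<subseteq> cball 0 \<rho>"
  let ?f = "\<lambda>x. double_series c (p x) (q x)"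
  have "?f field_differentiable at x" if "x \<in> S" for x
  proof -
    have "\<exists>d>0. cball x d \<subseteq> S" using S that unfolding open_contains_cball by simp
    then obtain d where d: "d > 0" "cball x d \<subseteq> S" by blast
    have ul': "uniform_limit (cball x d) (\<lambda>X x. \<Sum>(i, j)\<in>X. of_real (c i j) * p x ^ i * q x ^ j) ?f
        (finite_subsets_at_top UNIV)"
      unfolding uniform_limit_iff
    proof (intro allI impI)
      fix e :: real assume "e > 0"
      from uniform_limitD[OF ul this]
      show "\<forall>\<^sub>F X in finite_subsets_at_top UNIV. \<forall>x\<in>cball x d.
          dist (\<Sum>(i, j)\<in>X. of_real (c i j) * p x ^ i * q x ^ j) (?f x) < e"
      proof (rule eventually_mono)
        fix X assume *: "\<forall>x\<in>cball 0 \<rho> \<times> cball 0 \<rho>.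
          dist (\<Sum>(i, j)\<in>X. complex_of_real (c i j) * fst x ^ i * snd x ^ j) (double_series c (fst x)
              (snd x)) < e"
        show "\<forall>x\<in>cball x d. dist (\<Sum>(i, j)\<in>X. of_real (c i j) * p x ^ i * q x ^ j) (?f x) < e"
        proof
          fix y assume "y \<in> cball x d"
          then have "(p y, q y) \<in> cball 0 \<rho> \<times> cball 0 \<rho>" using d b by blast
          from bspec[OF * this] show "dist (\<Sum>(i, j)\<in>X. of_real (c i j) * p y ^ i * q y ^ j) (?f y) < e"
            by simp
        qed
      qed
    qed
    have h: "(\<lambda>x. \<Sum>(i, j)\<in>X. of_real (c i j) * p x ^ i * q x ^ j) holomorphic_on S" for X
      unfolding case_prod_unfold by (intro holomorphic_intros p q)
    then have ev: "\<forall>\<^sub>F X in finite_subsets_at_top UNIV.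
        continuous_on (cball x d) (\<lambda>x. \<Sum>(i, j)\<in>X. of_real (c i j) * p x ^ i * q x ^ j) \<and>
        (\<lambda>x. \<Sum>(i, j)\<in>X. of_real (c i j) * p x ^ i * q x ^ j) holomorphic_on ball x d"
      using d ball_subset_cball[of x d]
      by (intro always_eventually allI conjI holomorphic_on_subset[OF h]
          continuous_on_subset[OF holomorphic_on_imp_continuous_on[OF h]]) auto
    have "?f holomorphic_on ball x d"
      by (rule holomorphic_uniform_limit[OF ev ul']) simp_all
    then show ?thesis using d holomorphic_on_imp_differentiable_at[of ?f "ball x d" x] by simp
  qed
  then show "?f holomorphic_on S"
    unfolding holomorphic_on_def using field_differentiable_at_within by blast
next
  fix z w :: complex assume "z \<in> cball 0 \<rho> \<inter> \<real>" "w \<in> cball 0 \<rho> \<inter> \<real>"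
  then have n: "norm z \<le> \<rho>" "norm w \<le> \<rho>" and r: "Im z = 0" "Im w = 0"
    by (auto simp: complex_is_Real_iff)
  have "z ^ i \<in> \<real>" "w ^ i \<in> \<real>" for i using r by (auto simp: complex_is_Real_iff intro!: Reals_power)
  then have "(\<lambda>(i, j). of_real (c i j) * z ^ i * w ^ j) k \<in> \<real>" for k
    by (auto simp: case_prod_unfold intro!: Reals_mult)
  then have "((\<lambda>k. Im ((\<lambda>(i, j). of_real (c i j) * z ^ i * w ^ j) k)) has_sum 0) UNIV"
    by (simp add: complex_is_Real_iff has_sum_0)
  moreover have "((\<lambda>k. Im ((\<lambda>(i, j). of_real (c i j) * z ^ i * w ^ j) k)) has_sum Im (double_series c z
      w)) UNIV"
    using has_sum_bounded_linear[OF bounded_linear_Im double_series_has_sum[OF c n]] by (simp add: o_def)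
  ultimately have "Im (double_series c z w) = 0" using has_sum_unique by blast
  then show "double_series c z w \<in> \<real>" by (simp add: complex_is_Real_iff)
qed

lemma bidisc_summable_shift:
  assumes c: "bidisc_summable c \<rho>"
  shows "bidisc_summable (\<lambda>i j. c (Suc i) j) \<rho>"
    and "bidisc_summable (\<lambda>i j. if i = 0 then c 0 (Suc j) else 0) \<rho>"
proof -
  let ?g = "\<lambda>(i, j). \<bar>c i j\<bar> * \<rho> ^ i * \<rho> ^ j"
  have \<rho>: "0 < \<rho>" and g: "?g summable_on UNIV" using c by (auto simp: bidisc_summable_def)
  have "?g summable_on range (\<lambda>(i, j). (Suc i, j))" "?g summable_on range (\<lambda>(i, j). (i, Suc j))"
    using summable_on_subset_banach[OF g] by auto
  moreover have "inj (\<lambda>(i, j). (Suc i, j))" "inj (\<lambda>(i, j). (i, Suc j))" by (auto simp: inj_on_def)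
  ultimately have r: "(?g \<circ> (\<lambda>(i, j). (Suc i, j))) summable_on UNIV" "(?g \<circ> (\<lambda>(i, j). (i, Suc j)))
      summable_on UNIV"
    using summable_on_reindex by blast+
  note * = summable_on_cmult_left[OF r(1), of "inverse \<rho>"] summable_on_cmult_left[OF r(2), of "inverse \<rho>"]
  have "(\<lambda>(i, j). \<bar>c (Suc i) j\<bar> * \<rho> ^ i * \<rho> ^ j) summable_on UNIV"
    using *(1) by (rule back_subst[of "\<lambda>f. f summable_on UNIV"]) (use \<rho> in \<open>auto simp: fun_eq_iff\<close>)
  then show "bidisc_summable (\<lambda>i j. c (Suc i) j) \<rho>" using \<rho> by (simp add: bidisc_summable_def)
  have "(\<lambda>(i, j). \<bar>c i (Suc j)\<bar> * \<rho> ^ i * \<rho> ^ j) summable_on UNIV"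
    using *(2) by (rule back_subst[of "\<lambda>f. f summable_on UNIV"]) (use \<rho> in \<open>auto simp: fun_eq_iff\<close>)
  then have "(\<lambda>(i, j). \<bar>if i = 0 then c 0 (Suc j) else 0\<bar> * \<rho> ^ i * \<rho> ^ j) summable_on UNIV"
    by (rule summable_on_comparison_test) (use \<rho> in auto)
  then show "bidisc_summable (\<lambda>i j. if i = 0 then c 0 (Suc j) else 0) \<rho>"
    using \<rho> by (simp add: bidisc_summable_def)
qed

text \<open>Every nonconstant monomial is counted once: those containing \<open>z\<close> in the
  first series, the pure powers of \<open>w\<close> in the second. For a field that vanishes at the
  origin this exhibits the factor \<open>r\<close> of both components in polar coordinates.\<close>

lemma double_series_shift:
  assumes c: "bidisc_summable c \<rho>" and zw: "norm z \<le> \<rho>" "norm w \<le> \<rho>"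
  shows "double_series c z w = of_real (c 0 0) + z * double_series (\<lambda>i j. c (Suc i) j) z w
    + w * double_series (\<lambda>i j. if i = 0 then c 0 (Suc j) else 0) z w"
proof -
  let ?f = "\<lambda>(i, j). of_real (c i j) * z ^ i * w ^ j"
  let ?h1 = "\<lambda>(i, j). (Suc i, j)" and ?h2 = "\<lambda>(i, j). (i, Suc j)"
  have f: "?f summable_on UNIV" using double_series_has_sum[OF c zw] summable_on_def by blast
  have U: "UNIV = insert (0, 0) (range ?h1 \<union> ?h2 ` ({0} \<times> UNIV))"
  proof -
    have "x \<in> insert (0, 0) (range ?h1 \<union> ?h2 ` ({0} \<times> UNIV))" for x :: "nat \<times> nat"
      by (cases x; cases "fst x"; cases "snd x") (auto simp: image_iff)
    then show ?thesis by blast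
  qed
  have s: "?f summable_on A" for A using summable_on_subset_banach[OF f] by auto
  have "infsum ?f UNIV = infsum ?f (insert (0, 0) (range ?h1 \<union> ?h2 ` ({0} \<times> UNIV)))"
    using U by simp
  also have "\<dots> = ?f (0, 0) + infsum ?f (range ?h1 \<union> ?h2 ` ({0} \<times> UNIV))"
    by (rule infsum_insert) (auto intro: s)
  also have "infsum ?f (range ?h1 \<union> ?h2 ` ({0} \<times> UNIV)) = infsum ?f (range ?h1) + infsum ?f (?h2 ` ({0}
      \<times> UNIV))"
    by (rule infsum_Un_disjoint) (auto intro: s)
  also have "infsum ?f (range ?h1) = infsum (?f \<circ> ?h1) UNIV"
    by (rule infsum_reindex) (auto simp: inj_on_def)
  also have "\<dots> = (\<Sum>\<^sub>\<infinity>x. z * (\<lambda>(i, j). of_real (c (Suc i) j) * z ^ i * w ^ j) x)"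
    by (rule infsum_cong) auto
  also have "\<dots> = z * double_series (\<lambda>i j. c (Suc i) j) z w"
    unfolding double_series_def by (rule infsum_cmult_right')
  also have "infsum ?f (?h2 ` ({0} \<times> UNIV)) = infsum (?f \<circ> ?h2) ({0} \<times> UNIV)"
    by (rule infsum_reindex) (auto simp: inj_on_def)
  also have "\<dots> = (\<Sum>\<^sub>\<infinity>x. w * (\<lambda>(i, j). of_real (if i = 0 then c 0 (Suc j) else 0) * z ^ i * w ^ j) x)"
    by (rule infsum_cong_neutral) (auto split: if_splits)
  also have "\<dots> = w * double_series (\<lambda>i j. if i = 0 then c 0 (Suc j) else 0) z w"
    unfolding double_series_def by (rule infsum_cmult_right')
  finally show ?thesis by (simp add: double_series_def add.assoc)
qed

lemma double_series_0:
  assumes "bidisc_summable c \<rho>"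
  shows "double_series c 0 0 = of_real (c 0 0)"
  using double_series_shift[OF assms, of 0 0] assms by (simp add: bidisc_summable_def)


subsection \<open>Real holomorphic germs and leading coefficients\<close>

text \<open>The imaginary part vanishes identically along the real axis, and its derivative there is
  the imaginary part of \<open>deriv f\<close>.\<close>

lemma deriv_in_Reals:
  assumes f: "f holomorphic_on ball 0 r" and real: "\<And>z. z \<in> ball 0 r \<Longrightarrow> z \<in> \<real> \<Longrightarrow> f z \<in> \<real>"
    and z: "z \<in> ball 0 r" "z \<in> \<real>"
  shows "deriv f z \<in> \<real>"
proof -
  obtain x where x: "z = of_real x" using z(2) by (auto elim: Reals_cases)
  have "(f has_field_derivative deriv f z) (at (of_real x))"
    using holomorphic_derivI[OF f open_ball z(1)] x by simp
  then have "((\<lambda>x. f (of_real x)) has_vector_derivative deriv f z) (at x)"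
    by (rule has_vector_derivative_real_field)
  then have "((\<lambda>x. Im (f (of_real x))) has_vector_derivative Im (deriv f z)) (at x)"
    by (rule bounded_linear.has_vector_derivative[OF bounded_linear_Im])
  then have D: "((\<lambda>x. Im (f (of_real x))) has_real_derivative Im (deriv f z)) (at x)"
    by (simp add: has_real_derivative_iff_has_vector_derivative)
  have "((\<lambda>x. 0) has_real_derivative Im (deriv f z)) (at x)"
  proof (rule has_field_derivative_transform_within_open[OF D open_ball])
    show "x \<in> ball 0 r" using z x by simp
    show "Im (f (of_real t)) = 0" if "t \<in> ball 0 r" for t
      using real[of "of_real t"] that by (simp add: complex_is_Real_iff)
  qed
  then have "Im (deriv f z) = 0" using DERIV_const DERIV_unique by blast
  then show ?thesis by (simp add: complex_is_Real_iff)
qed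

lemma higher_deriv_in_Reals:
  assumes f: "f holomorphic_on ball 0 r" and real: "\<And>z. z \<in> ball 0 r \<Longrightarrow> z \<in> \<real> \<Longrightarrow> f z \<in> \<real>"
    and z: "z \<in> ball 0 r" "z \<in> \<real>"
  shows "(deriv ^^ n) f z \<in> \<real>"
  using z
proof (induction n arbitrary: z)
  case 0
  then show ?case using real by simp
next
  case (Suc n)
  then show ?case
    using deriv_in_Reals[OF holomorphic_higher_deriv[OF f open_ball], of n z] by simp
qed

text \<open>Schwarz reflection: the Taylor coefficients at \<open>0\<close> are real, so conjugation
  passes through the power series.\<close>

lemma cnj_holomorphic_real:
  assumes f: "f holomorphic_on ball 0 r" and real: "\<And>z. z \<in> ball 0 r \<Longrightarrow> z \<in> \<real> \<Longrightarrow> f z \<in> \<real>"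
    and z: "z \<in> ball 0 r"
  shows "f (cnj z) = cnj (f z)"
proof -
  have r: "0 < r" using z le_less_trans[OF norm_ge_zero] by auto
  have a: "cnj ((deriv ^^ n) f 0) = (deriv ^^ n) f 0" for n
    using higher_deriv_in_Reals[OF f real, of 0 n] r by (simp add: Reals_cnj_iff)
  have "(\<lambda>n. (deriv ^^ n) f 0 / fact n * (z - 0) ^ n) sums f z"
    by (rule holomorphic_power_series[OF f z])
  then have "(\<lambda>n. cnj ((deriv ^^ n) f 0 / fact n * (z - 0) ^ n)) sums cnj (f z)"
    by (simp only: sums_cnj)
  moreover have "(\<lambda>n. (deriv ^^ n) f 0 / fact n * (cnj z - 0) ^ n) sums f (cnj z)"
    by (rule holomorphic_power_series[OF f]) (use z in simp)
  ultimately show ?thesis using sums_unique2 by (simp add: a) blast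
qed

text \<open>The quotient is the Taylor series shifted by \<open>n\<close>, which converges on the
  same disc; its value at \<open>0\<close> is the coefficient of \<open>z ^ n\<close>.\<close>

lemma holomorphic_factor_power:
  assumes f: "f holomorphic_on ball 0 r" and r: "0 < r"
    and zero: "\<And>k. k < n \<Longrightarrow> (deriv ^^ k) f 0 = 0"
    and real: "\<And>z. z \<in> ball 0 r \<Longrightarrow> z \<in> \<real> \<Longrightarrow> f z \<in> \<real>"
  obtains e where "e holomorphic_on ball 0 r" "\<And>z. z \<in> ball 0 r \<Longrightarrow> f z = z ^ n * e z"
    "e 0 = (deriv ^^ n) f 0 / fact n" "\<And>z. z \<in> ball 0 r \<Longrightarrow> z \<in> \<real> \<Longrightarrow> e z \<in> \<real>"
proof -
  define a where "a = (\<lambda>k. (deriv ^^ k) f 0 / fact k)"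
  define e where "e = (\<lambda>z. if z = 0 then a n else f z / z ^ n)"
  have s: "(\<lambda>k. a (k + n) * (z - 0) ^ k) sums e z" if z: "z \<in> ball 0 r" for z
  proof (cases "z = 0")
    case True
    then show ?thesis using powser_sums_zero[of "\<lambda>k. a (k + n)"] by (simp add: e_def)
  next
    case False
    have "(\<lambda>k. a k * z ^ k) sums f z"
      using holomorphic_power_series[OF f z] by (simp add: a_def)
    moreover have "(\<Sum>k<n. a k * z ^ k) = 0" by (rule sum.neutral) (simp add: a_def zero)
    ultimately have "(\<lambda>k. a (k + n) * z ^ (k + n)) sums f z"
      using sums_iff_shift[of "\<lambda>k. a k * z ^ k" n "f z"] by simp
    then have "(\<lambda>k. a (k + n) * z ^ (k + n) / z ^ n) sums (f z / z ^ n)" by (rule sums_divide)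
    then show ?thesis using False by (simp add: e_def power_add)
  qed
  show thesis
  proof
    show "e holomorphic_on ball 0 r" by (rule power_series_holomorphic[OF s])
    show "f z = z ^ n * e z" if "z \<in> ball 0 r" for z
      using zero[of 0] by (cases "z = 0"; cases n) (auto simp: e_def a_def)
    show "e 0 = (deriv ^^ n) f 0 / fact n" by (simp add: e_def a_def)
    have "fact n \<in> (\<real> :: complex set)" by (metis Reals_of_real of_real_fact)
    then have "a n \<in> \<real>"
      unfolding a_def using higher_deriv_in_Reals[OF f real, of 0 n] r by (auto intro!: Reals_divide)
    then show "e z \<in> \<real>" if "z \<in> ball 0 r" "z \<in> \<real>" for z
      using real[OF that] that by (auto simp: e_def intro!: Reals_divide)
  qed
qed

text \<open>The inverse is real on the real axis because, for real \<open>y\<close>, reflection maps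
  \<open>g y\<close> to another preimage of \<open>y\<close> in the disc where \<open>f\<close> is
  injective.\<close>

lemma holomorphic_real_local_inverse:
  assumes f: "f holomorphic_on ball 0 r" and r: "0 < r" and f0: "f 0 = 0" and d: "deriv f 0 \<noteq> 0"
    and real: "\<And>z. z \<in> ball 0 r \<Longrightarrow> z \<in> \<real> \<Longrightarrow> f z \<in> \<real>"
  obtains g \<epsilon> \<delta> where "0 < \<epsilon>" "\<epsilon> \<le> r" "0 < \<delta>" "g holomorphic_on ball 0 \<delta>" "g 0 = 0"
    "\<And>y. y \<in> ball 0 \<delta> \<Longrightarrow> g y \<in> ball 0 \<epsilon>" "\<And>y. y \<in> ball 0 \<delta> \<Longrightarrow> f (g y) = y"
    "\<And>z. z \<in> ball 0 \<epsilon> \<Longrightarrow> g (f z) = z" "\<And>y. y \<in> ball 0 \<delta> \<Longrightarrow> y \<in> \<real> \<Longrightarrow> g y \<in> \<real>"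
proof -
  obtain \<epsilon> where \<epsilon>: "\<epsilon> > 0" and sub: "ball 0 \<epsilon> \<subseteq> ball (0::complex) r" and inj: "inj_on f (ball 0 \<epsilon>)"
    using has_complex_derivative_locally_injective[OF f _ open_ball d] r by auto
  have \<epsilon>r: "\<epsilon> \<le> r" using sub \<epsilon> by (simp add: ball_subset_ball_iff)
  have fh: "f holomorphic_on ball 0 \<epsilon>" using f sub holomorphic_on_subset by blast
  obtain g where g: "g holomorphic_on f ` ball 0 \<epsilon>" "\<And>z. z \<in> ball 0 \<epsilon> \<Longrightarrow> g (f z) = z"
    using holomorphic_has_inverse[OF fh open_ball inj] by metis
  have "open (f ` ball 0 \<epsilon>)" using open_mapping_thm3[OF fh open_ball inj] .
  moreover have z0: "0 \<in> f ` ball 0 \<epsilon>" using f0 \<epsilon> by (metis centre_in_ball image_eqI)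
  ultimately have "\<exists>\<delta>>0. ball 0 \<delta> \<subseteq> f ` ball 0 \<epsilon>" unfolding open_contains_ball by blast
  then obtain \<delta> where \<delta>: "\<delta> > 0" "ball 0 \<delta> \<subseteq> f ` ball 0 \<epsilon>" by blast
  have fg: "f (g y) = y \<and> g y \<in> ball 0 \<epsilon>" if y: "y \<in> ball 0 \<delta>" for y
  proof -
    obtain z where "z \<in> ball 0 \<epsilon>" "y = f z" using \<delta>(2) y by blast
    then show ?thesis using g(2)[of z] by simp
  qed
  show thesis
  proof (rule that[OF \<epsilon> \<epsilon>r \<delta>(1)])
    show "g holomorphic_on ball 0 \<delta>" using g(1) \<delta>(2) holomorphic_on_subset by blast
    show "g 0 = 0" using g(2)[of 0] f0 \<epsilon> by simp
    show "g y \<in> \<real>" if y: "y \<in> ball 0 \<delta>" "y \<in> \<real>" for y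
    proof -
      have gy: "g y \<in> ball 0 \<epsilon>" "cnj (g y) \<in> ball 0 \<epsilon>" using fg[OF y(1)] by simp_all
      have "f (cnj (g y)) = cnj (f (g y))"
        by (rule cnj_holomorphic_real[OF f real]) (use gy sub in auto)
      also have "\<dots> = f (g y)" using fg[OF y(1)] y(2) by (simp add: Reals_cnj_iff)
      finally have "cnj (g y) = g y" using inj gy by (simp add: inj_on_eq_iff)
      then show ?thesis by (simp add: Reals_cnj_iff)
    qed
  qed (use fg g(2) in auto)
qed

section \<open>Slopes at the origin and the leading coefficient of the displacement\<close>

text \<open>Adding \<open>\<mu>\<close> to the slope of \<open>a\<close> gives the slope of
  \<open>a'\<close> from the right. Dividing \<open>a (a' x) = x\<close> by \<open>x\<close> shows
  that the two slopes have product \<open>1\<close>, and the sign of \<open>a\<close> on the right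
  makes \<open>a1\<close> negative.\<close>

lemma inverse_branch_slope:
  fixes a a' :: "real \<Rightarrow> real"
  assumes d: "(a has_real_derivative a1) (at 0)" and a0: "a 0 = 0"
    and neg: "\<forall>\<^sub>F x in at_right 0. a x < 0"
    and inv: "\<forall>\<^sub>F x in at_right 0. a (a' x) = x" and lim: "(a' \<longlongrightarrow> 0) (at_right 0)"
    and \<mu>: "((\<lambda>x. (a' x - a x) / x) \<longlongrightarrow> \<mu>) (at_right 0)"
  shows "a1 * (a1 + \<mu>) = 1" "a1 < 0" "((\<lambda>x. a' x / x) \<longlongrightarrow> a1 + \<mu>) (at_right 0)"
proof -
  have q: "((\<lambda>x. a x / x) \<longlongrightarrow> a1) (at 0)" using d a0 by (simp add: has_field_derivative_iff)
  then have qr: "((\<lambda>x. a x / x) \<longlongrightarrow> a1) (at_right 0)"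
    by (rule filterlim_mono) (auto simp: at_le)
  have pos: "\<forall>\<^sub>F x in at_right (0::real). x > 0" by (rule eventually_at_right_less)
  show l: "((\<lambda>x. a' x / x) \<longlongrightarrow> a1 + \<mu>) (at_right 0)"
    using tendsto_add[OF qr \<mu>] by (simp add: diff_divide_distrib)
  \<comment> \<open>The difference quotient of \<open>a\<close>, continued by \<open>a1\<close> at
    \<open>0\<close>; it may then be composed with \<open>a'\<close> without excluding zeros of
    \<open>a'\<close>.\<close>
  define \<alpha> where "\<alpha> = (\<lambda>y. if y = 0 then a1 else a y / y)"
  have "isCont \<alpha> 0"
  proof -
    have "(\<alpha> \<longlongrightarrow> a1) (at 0)"
      by (rule Lim_transform_eventually[OF q]) (auto simp: \<alpha>_def eventually_at_filter)
    then show ?thesis by (simp add: isCont_def \<alpha>_def)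
  qed
  then have "((\<lambda>x. \<alpha> (a' x)) \<longlongrightarrow> a1) (at_right 0)"
    using isCont_tendsto_compose[OF _ lim, of \<alpha>] by (simp add: \<alpha>_def)
  then have *: "((\<lambda>x. \<alpha> (a' x) * (a' x / x)) \<longlongrightarrow> a1 * (a1 + \<mu>)) (at_right 0)"
    by (rule tendsto_mult[OF _ l])
  have "\<forall>\<^sub>F x in at_right 0. \<alpha> (a' x) * (a' x / x) = 1"
    using inv pos
  proof eventually_elim
    case (elim x)
    then show ?case using a0 by (cases "a' x = 0") (auto simp: \<alpha>_def)
  qed
  then have "((\<lambda>x. 1) \<longlongrightarrow> a1 * (a1 + \<mu>)) (at_right (0::real))"
    by (rule Lim_transform_eventually[OF *])
  then show 1: "a1 * (a1 + \<mu>) = 1"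
    using tendsto_unique[OF trivial_limit_at_right_real _ tendsto_const] by blast
  have "a1 \<le> 0"
  proof (rule tendsto_upperbound[OF qr])
    show "\<forall>\<^sub>F x in at_right 0. a x / x \<le> 0"
      using neg pos by eventually_elim (simp add: divide_nonpos_pos)
  qed simp
  then show "a1 < 0" using 1 by (cases "a1 = 0") auto
qed

text \<open>Write \<open>b - a\<close> as \<open>(b - b') + (b' - a') + (a' - a)\<close>. The outer
  terms are governed by \<open>c1\<close> and \<open>c2\<close>. For the middle one,
  \<open>a (b' x) - a (a' x) = a (b' x) - b (b' x)\<close>, since both inverses return
  \<open>x\<close>; the mean value theorem and slope \<open>- 1\<close> turn this into
  \<open>b' x - a' x\<close> behaving like \<open>b - a\<close> at \<open>b' x\<close>, that is,
  like \<open>d * (b' x) ^ N\<close> with \<open>b' x\<close> close to \<open>- x\<close>.\<close>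

lemma displacement_leading_coefficient:
  fixes a b a' b' ad :: "real \<Rightarrow> real"
  assumes a: "\<And>x. \<bar>x\<bar> < r \<Longrightarrow> (a has_real_derivative ad x) (at x)" and r: "0 < r" and adc: "isCont ad 0"
    and b: "(b has_real_derivative b1) (at 0)" and ab0: "a 0 = 0" "b 0 = 0"
    and neg: "\<forall>\<^sub>F x in at_right 0. a x < 0" "\<forall>\<^sub>F x in at_right 0. b x < 0"
    and inv: "\<forall>\<^sub>F x in at_right 0. a (a' x) = x" "\<forall>\<^sub>F x in at_right 0. b (b' x) = x"
    and lim: "(a' \<longlongrightarrow> 0) (at_right 0)" "(b' \<longlongrightarrow> 0) (at_right 0)"
    and c1: "((\<lambda>x. (a' x - a x) / x ^ m) \<longlongrightarrow> c1) (at_right 0)"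
    and c2: "((\<lambda>x. (b x - b' x) / x ^ m) \<longlongrightarrow> c2) (at_right 0)"
    and d: "((\<lambda>x. (b x - a x) / x ^ N) \<longlongrightarrow> d) (at 0)"
    and m: "2 \<le> m" and N: "N \<le> m"
  shows "d = (- 1) ^ N * d + (if N = m then c1 + c2 else 0)"
proof -
  have pos: "\<forall>\<^sub>F x in at_right (0::real). x > 0" by (rule eventually_at_right_less)
  \<comment> \<open>A quantity of order \<open>x ^ m\<close> is negligible against any lower power
    \<open>x ^ k\<close>; so \<open>c1\<close> and \<open>c2\<close> count only for
    \<open>N = m\<close>.\<close>
  have low: "((\<lambda>x. f x / x ^ k) \<longlongrightarrow> (if k = m then c else 0)) (at_right 0)"
    if f: "((\<lambda>x. f x / x ^ m) \<longlongrightarrow> c) (at_right 0)" and k: "k \<le> m" for f :: "real \<Rightarrow> real" and c k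
  proof -
    have "((\<lambda>x. x ^ (m - k)) \<longlongrightarrow> 0 ^ (m - k)) (at_right (0::real))"
      by (intro tendsto_intros)
    from tendsto_mult[OF f this]
    have "((\<lambda>x. f x / x ^ m * x ^ (m - k)) \<longlongrightarrow> (if k = m then c else 0)) (at_right 0)"
      using k by (cases "k = m") (simp_all add: zero_power)
    then show ?thesis
    proof (rule Lim_transform_eventually)
      show "\<forall>\<^sub>F x in at_right 0. f x / x ^ m * x ^ (m - k) = f x / x ^ k"
        using pos
      proof eventually_elim
        case (elim x)
        have "x ^ m = x ^ (m - k) * x ^ k" using k by (simp flip: power_add)
        then show ?case using elim by simp
      qed
    qed
  qed
  have slope: "s = - 1 \<and> ((\<lambda>x. f' x / x) \<longlongrightarrow> - 1) (at_right 0)"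
    if "(f has_real_derivative s) (at 0)" "f 0 = 0" "\<forall>\<^sub>F x in at_right 0. f x < 0"
      "\<forall>\<^sub>F x in at_right 0. f (f' x) = x" "(f' \<longlongrightarrow> 0) (at_right 0)"
      "((\<lambda>x. (f' x - f x) / x ^ m) \<longlongrightarrow> c) (at_right 0)" for f f' s c
  proof -
    have "((\<lambda>x. (f' x - f x) / x) \<longlongrightarrow> 0) (at_right 0)"
      using low[OF that(6), of 1] m by simp
    from inverse_branch_slope[OF that(1-5) this]
    have s: "s * s = 1" "s < 0" "((\<lambda>x. f' x / x) \<longlongrightarrow> s) (at_right 0)" by simp_all
    then have "s = - 1" using square_eq_1_iff[of s] by simp
    with s(3) show ?thesis by simp
  qed
  have adc': "(a has_real_derivative ad 0) (at 0)" using a r by simp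
  have sa: "ad 0 = - 1" using slope[OF adc' ab0(1) neg(1) inv(1) lim(1) c1] by simp
  have c2': "((\<lambda>x. (b' x - b x) / x ^ m) \<longlongrightarrow> - c2) (at_right 0)"
    using tendsto_minus[OF c2] by (simp only: minus_divide_left minus_diff_eq)
  have sb: "((\<lambda>x. b' x / x) \<longlongrightarrow> - 1) (at_right 0)"
    using slope[OF b ab0(2) neg(2) inv(2) lim(2) c2'] by simp
  \<comment> \<open>The two-sided limit \<open>d\<close> is used here on the negative side, along
    \<open>b' x\<close>; the slope \<open>- 1\<close> of \<open>b'\<close> produces
    \<open>(- 1) ^ N\<close>.\<close>
  have ratio: "((\<lambda>x. (b (b' x) - a (b' x)) / x ^ N) \<longlongrightarrow> d * (- 1) ^ N) (at_right 0)"
  proof -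
    have ne: "\<forall>\<^sub>F x in at_right 0. b' x \<noteq> 0"
      using inv(2) pos by eventually_elim (use ab0 in force)
    have "filterlim b' (at 0) (at_right 0)" using lim(2) ne by (simp add: filterlim_at)
    from tendsto_mult[OF filterlim_compose[OF d this] tendsto_power[OF sb, of N]]
    show ?thesis
    proof (rule Lim_transform_eventually)
      show "\<forall>\<^sub>F x in at_right 0. (b (b' x) - a (b' x)) / b' x ^ N * (b' x / x) ^ N = (b (b' x) - a (b'
          x)) / x ^ N"
        using ne by eventually_elim (simp add: power_divide)
    qed
  qed
  have mvt: "\<exists>\<xi>. \<bar>\<xi>\<bar> \<le> max \<bar>u\<bar> \<bar>v\<bar> \<and> a u - a v = (u - v) * ad \<xi>" if "\<bar>u\<bar> < r" "\<bar>v\<bar> < r" for u v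
  proof -
    consider "u = v" | "u < v" | "v < u" by linarith
    then show ?thesis
    proof cases
      case 1
      then show ?thesis by (intro exI[of _ u]) auto
    next
      case 2
      have "\<exists>z>u. z < v \<and> a v - a u = (v - u) * ad z"
        by (intro MVT2 2 a) (use that in linarith)
      then obtain z where "u < z" "z < v" "a v - a u = (v - u) * ad z" by blast
      then show ?thesis by (intro exI[of _ z]) (auto simp: algebra_simps)
    next
      case 3
      have "\<exists>z>v. z < u \<and> a u - a v = (u - v) * ad z"
        by (intro MVT2 3 a) (use that in linarith)
      then obtain z where "v < z" "z < u" "a u - a v = (u - v) * ad z" by blast
      then show ?thesis by (intro exI[of _ z]) auto
    qed
  qed
  \<comment> \<open>Any choice of intermediate point will do: \<open>\<xi> x\<close> is squeezed to
    \<open>0\<close>, and \<open>ad\<close> is continuous there.\<close>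
  define \<xi> where "\<xi> = (\<lambda>x. SOME \<xi>. \<bar>\<xi>\<bar> \<le> max \<bar>b' x\<bar> \<bar>a' x\<bar> \<and> a (b' x) - a (a' x) = (b' x - a' x) * ad \<xi>)"
  have ev_small: "\<forall>\<^sub>F x in at_right 0. \<bar>a' x\<bar> < r" "\<forall>\<^sub>F x in at_right 0. \<bar>b' x\<bar> < r"
    using tendstoD[OF lim(1) r] tendstoD[OF lim(2) r] by simp_all
  have \<xi>: "\<forall>\<^sub>F x in at_right 0. \<bar>\<xi> x\<bar> \<le> max \<bar>b' x\<bar> \<bar>a' x\<bar> \<and> a (b' x) - a (a' x) = (b' x - a' x) * ad (\<xi> x)"
    using ev_small
  proof eventually_elim
    case (elim x)
    show ?case unfolding \<xi>_def by (rule someI_ex, rule mvt) (use elim in auto)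
  qed
  have "((\<lambda>x. max \<bar>b' x\<bar> \<bar>a' x\<bar>) \<longlongrightarrow> max \<bar>0\<bar> \<bar>0\<bar>) (at_right 0)"
    by (intro tendsto_intros lim)
  then have \<xi>0: "(\<xi> \<longlongrightarrow> 0) (at_right 0)"
    by (intro Lim_null_comparison[of \<xi>]) (use \<xi> in \<open>auto elim: eventually_mono\<close>)
  have ad\<xi>: "((\<lambda>x. ad (\<xi> x)) \<longlongrightarrow> - 1) (at_right 0)"
    using isCont_tendsto_compose[OF adc \<xi>0] sa by simp
  have "((\<lambda>x. - ((b (b' x) - a (b' x)) / x ^ N) / ad (\<xi> x)) \<longlongrightarrow> - (d * (- 1) ^ N) / - 1) (at_right 0)"
    by (intro tendsto_divide tendsto_minus ratio ad\<xi>) simp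
  then have diff: "((\<lambda>x. (b' x - a' x) / x ^ N) \<longlongrightarrow> d * (- 1) ^ N) (at_right 0)"
  proof (rule Lim_transform_eventually[OF back_subst[of "\<lambda>l. (_ \<longlongrightarrow> l) _"]])
    have "\<forall>\<^sub>F x in at_right 0. ad (\<xi> x) < 0" using order_tendstoD(2)[OF ad\<xi>, of 0] by simp
    then show "\<forall>\<^sub>F x in at_right 0. - ((b (b' x) - a (b' x)) / x ^ N) / ad (\<xi> x) = (b' x - a' x) / x ^ N"
      using \<xi> inv pos
    proof eventually_elim
      case (elim x)
      then have "- (b (b' x) - a (b' x)) = (b' x - a' x) * ad (\<xi> x)" by simp
      then show ?case using elim(1) by (simp add: divide_simps)
    qed
  qed simp
  have "((\<lambda>x. (b x - b' x) / x ^ N + (b' x - a' x) / x ^ N + (a' x - a x) / x ^ N)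
      \<longlongrightarrow> (if N = m then c2 else 0) + d * (- 1) ^ N + (if N = m then c1 else 0)) (at_right 0)"
    by (intro tendsto_add low[OF c1 N] low[OF c2 N] diff)
  moreover have "(\<lambda>x. (b x - b' x) / x ^ N + (b' x - a' x) / x ^ N + (a' x - a x) / x ^ N)
      = (\<lambda>x. (b x - a x) / x ^ N)"
    by (simp flip: add_divide_distrib)
  moreover have "((\<lambda>x. (b x - a x) / x ^ N) \<longlongrightarrow> d) (at_right 0)"
    using d by (rule filterlim_mono) (auto simp: at_le)
  ultimately have "d = (if N = m then c2 else 0) + d * (- 1) ^ N + (if N = m then c1 else 0)"
    using tendsto_unique[OF trivial_limit_at_right_real] by metis
  then show ?thesis by (auto simp: mult.commute)
qed

text \<open>The slopes satisfy \<open>a1 * (a1 + c1) = 1\<close> and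
  \<open>b1 * (b1 - c2) = 1\<close> and are negative. The difference of the two equations is
  \<open>(a1 + b1) * (b1 - a1) = b1 * c2 + a1 * c1\<close>, which determines the sign of
  \<open>b1 - a1\<close> from those of \<open>c1\<close> and \<open>c2\<close>. The factor
  \<open>\<kappa>\<close> treats both stabilities at once.\<close>

lemma displacement_rough_sign:
  fixes a b a' b' :: "real \<Rightarrow> real"
  assumes a: "(a has_real_derivative a1) (at 0)" and b: "(b has_real_derivative b1) (at 0)"
    and ab0: "a 0 = 0" "b 0 = 0"
    and neg: "\<forall>\<^sub>F x in at_right 0. a x < 0" "\<forall>\<^sub>F x in at_right 0. b x < 0"
    and inv: "\<forall>\<^sub>F x in at_right 0. a (a' x) = x" "\<forall>\<^sub>F x in at_right 0. b (b' x) = x"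
    and lim: "(a' \<longlongrightarrow> 0) (at_right 0)" "(b' \<longlongrightarrow> 0) (at_right 0)"
    and c1: "((\<lambda>x. (a' x - a x) / x) \<longlongrightarrow> c1) (at_right 0)"
    and c2: "((\<lambda>x. (b x - b' x) / x) \<longlongrightarrow> c2) (at_right 0)"
    and \<kappa>: "\<kappa> = 1 \<or> \<kappa> = - 1" "0 \<le> \<kappa> * c1" "0 \<le> \<kappa> * c2" "0 < \<kappa> * (c1 + c2)"
  shows "0 < \<kappa> * (b1 - a1)"
proof -
  have c2': "((\<lambda>x. (b' x - b x) / x) \<longlongrightarrow> - c2) (at_right 0)"
    using tendsto_minus[OF c2] by (simp only: minus_divide_left minus_diff_eq)
  have A: "a1 * (a1 + c1) = 1" "a1 < 0"
    using inverse_branch_slope[OF a ab0(1) neg(1) inv(1) lim(1) c1] by simp_all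
  have B: "b1 * (b1 - c2) = 1" "b1 < 0"
    using inverse_branch_slope[OF b ab0(2) neg(2) inv(2) lim(2) c2'] by simp_all
  have eq: "(a1 + b1) * (b1 - a1) = b1 * c2 + a1 * c1"
    using A(1) B(1) by (simp add: algebra_simps)
  have "\<kappa> * (b1 * c2 + a1 * c1) < 0"
  proof (cases "\<kappa> * c1 = 0")
    case True
    then have "0 < \<kappa> * c2" using \<kappa>(4) distrib_left[of \<kappa> c1 c2] by linarith
    then have "b1 * (\<kappa> * c2) < 0" by (rule mult_neg_pos[OF B(2)])
    moreover have "\<kappa> * (b1 * c2 + a1 * c1) = b1 * (\<kappa> * c2) + a1 * (\<kappa> * c1)"
      by (simp add: algebra_simps)
    moreover have "a1 * (\<kappa> * c1) = 0" by (simp only: True mult_zero_right)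
    ultimately show ?thesis by linarith
  next
    case False
    then have "0 < \<kappa> * c1" using \<kappa>(2) by linarith
    then have "a1 * (\<kappa> * c1) < 0" by (rule mult_neg_pos[OF A(2)])
    moreover have "b1 * (\<kappa> * c2) \<le> 0" using B(2) \<kappa>(3) by (simp add: mult_nonpos_nonneg)
    ultimately show ?thesis by (simp add: algebra_simps)
  qed
  then have "(a1 + b1) * (\<kappa> * (b1 - a1)) < 0" using eq by (metis mult.left_commute)
  then show ?thesis using A(2) B(2) by (simp add: mult_less_0_iff)
qed


subsection \<open>Half-return map of a linear focus\<close>

lemma continuous_on_compose_curried:
  fixes f :: "'a::topological_space \<Rightarrow> 'b::topological_space \<Rightarrow> 'c::topological_space"
  assumes "continuous_on (A \<times> B) (\<lambda>x. f (fst x) (snd x))" "continuous_on S g" "continuous_on S h"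
    "\<And>s. s \<in> S \<Longrightarrow> g s \<in> A" "\<And>s. s \<in> S \<Longrightarrow> h s \<in> B"
  shows "continuous_on S (\<lambda>s. f (g s) (h s))"
  using continuous_on_compose2[OF assms(1) continuous_on_Pair[OF assms(2,3)]] assms(4,5)
  by (simp add: image_subset_iff)

lemma linear_ode_integrating_factor:
  fixes w p q :: "real \<Rightarrow> real"
  assumes w: "\<And>s. s \<in> {0..T} \<Longrightarrow> (w has_real_derivative q s * w s - p s) (at s within {0..T})"
    and q: "continuous_on {0..T} q" and s: "s \<in> {0..T}"
  shows "((\<lambda>s. w s * exp (- integral {0..s} q)) has_real_derivative - (p s * exp (- integral {0..s} q)))
    (at s within {0..T})"
  using w[OF s] integral_has_real_derivative[OF q s]
  by (auto intro!: derivative_eq_intros simp: algebra_simps)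

text \<open>Applied to the radius, whose equation is linear once the coefficient is evaluated along
  the solution: the radius keeps its sign and is bounded below in terms of its initial
  value.\<close>

lemma linear_ode_homogeneous:
  fixes w q :: "real \<Rightarrow> real"
  assumes w: "\<And>s. s \<in> {0..T} \<Longrightarrow> (w has_real_derivative q s * w s) (at s within {0..T})"
    and q: "continuous_on {0..T} q" and s: "s \<in> {0..T}"
  shows "w s = w 0 * exp (integral {0..s} q)"
proof -
  have "((\<lambda>s. w s * exp (- integral {0..s} q)) has_real_derivative 0) (at s within {0..T})"
    if "s \<in> {0..T}" for s
    using linear_ode_integrating_factor[of T w q "\<lambda>_. 0", OF _ q that] w by simp
  then have "\<exists>c. \<forall>s\<in>{0..T}. w s * exp (- integral {0..s} q) = c"
    by (intro has_field_derivative_zero_constant) auto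
  then obtain c where c: "\<And>s. s \<in> {0..T} \<Longrightarrow> w s * exp (- integral {0..s} q) = c" by blast
  have "w s * exp (- integral {0..s} q) = w 0"
    using c[OF s] c[of 0] s by simp
  then show ?thesis by (simp add: exp_minus field_simps)
qed

text \<open>With the integrating factor only the forcing term is left, and it drives the product
  strictly down from \<open>0\<close>. Positivity of \<open>p\<close> is asked on the open interval
  because the forcing in the tangent case vanishes at the end.\<close>

lemma linear_ode_forced_neg:
  fixes w p q :: "real \<Rightarrow> real"
  assumes w: "\<And>s. s \<in> {0..T} \<Longrightarrow> (w has_real_derivative q s * w s - p s) (at s within {0..T})"
    and q: "continuous_on {0..T} q" and w0: "w 0 = 0" and p: "\<And>s. 0 < s \<Longrightarrow> s < T \<Longrightarrow> 0 < p s"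
    and s: "0 < s" "s \<le> T"
  shows "w s < 0"
proof -
  let ?W = "\<lambda>s. w s * exp (- integral {0..s} q)"
  have d: "(?W has_real_derivative - (p s * exp (- integral {0..s} q))) (at s within {0..T})"
    if "s \<in> {0..T}" for s
    by (rule linear_ode_integrating_factor[OF w q that])
  have "?W s < ?W 0"
  proof (rule DERIV_neg_imp_decreasing_open[OF s(1)])
    show "\<exists>y. DERIV ?W x :> y \<and> y < 0" if "0 < x" "x < s" for x
    proof (intro exI conjI)
      show "DERIV ?W x :> - (p x * exp (- integral {0..x} q))"
        using d[of x] that s by (simp add: at_within_Icc_at)
      show "- (p x * exp (- integral {0..x} q)) < 0" using p[of x] that s by simp
    qed
    have "continuous_on {0..T} ?W"
      using d DERIV_continuous unfolding continuous_on_eq_continuous_within by blast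
    then show "continuous_on {0..s} ?W" by (rule continuous_on_subset) (use s in auto)
  qed
  then show ?thesis using w0 by (simp add: mult_less_0_iff)
qed

lemma half_return_of_curve:
  fixes c :: "real \<Rightarrow> real \<times> real"
  assumes "a < b" "c ` {a..b} \<subseteq> U"
    and "\<And>s. s \<in> {a..b} \<Longrightarrow> (c has_vector_derivative k s *\<^sub>R F (c s)) (at s within {a..b})"
    and "continuous_on {a..b} k" "\<And>s. s \<in> {a..b} \<Longrightarrow> 0 < k s"
    and "c a = (x, 0)" "c b = (y, 0)" "\<And>s. s \<in> {a<..<b} \<Longrightarrow> P (snd (c s))"
  shows "half_return P U F x y"
proof -
  obtain \<gamma> T where \<gamma>: "orbit_arc U F \<gamma> T" "\<gamma> 0 = c a" "\<gamma> T = c b" "\<gamma> ` {0<..<T} \<subseteq> c ` {a<..<b}"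
    using orbit_arc_time_change[OF assms(1-5)] by blast
  have "P (snd (\<gamma> t))" if "t \<in> {0<..<T}" for t
    using \<gamma>(4) that assms(8) by (metis (no_types, lifting) image_iff subsetD)
  then show ?thesis unfolding half_return_def using \<gamma>(1-3) assms(6,7) by metis
qed

text \<open>This form is the angular velocity, on the unit circle, of the linear field with matrix
  rows \<open>a, b\<close> and \<open>c, d\<close>. Its discriminant is that of the characteristic
  polynomial; completing the square shows it definite with the sign of \<open>c\<close>.\<close>

lemma focus_quadratic_form_pos:
  fixes a b c d :: real
  assumes "(a - d)\<^sup>2 + 4 * b * c < 0" "0 < c"
  shows "0 < c * (cos t)\<^sup>2 + (d - a) * cos t * sin t - b * (sin t)\<^sup>2"
proof -
  let ?u = "cos t" and ?v = "sin t"
  have eq: "4 * c * (c * ?u\<^sup>2 + (d - a) * ?u * ?v - b * ?v\<^sup>2)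
      = (2 * c * ?u + (d - a) * ?v)\<^sup>2 + - ((a - d)\<^sup>2 + 4 * b * c) * ?v\<^sup>2"
    by (simp add: power2_eq_square algebra_simps)
  have "0 < (2 * c * ?u + (d - a) * ?v)\<^sup>2 + - ((a - d)\<^sup>2 + 4 * b * c) * ?v\<^sup>2"
  proof (cases "?v = 0")
    case True
    then have "?u \<noteq> 0" using sin_cos_squared_add[of t] by auto
    then show ?thesis using True assms(2) by simp
  next
    case False
    then have "0 < - ((a - d)\<^sup>2 + 4 * b * c) * ?v\<^sup>2" using assms(1) by (intro mult_pos_pos) auto
    then show ?thesis by (simp add: add_nonneg_pos)
  qed
  then have "0 < 4 * c * (c * ?u\<^sup>2 + (d - a) * ?u * ?v - b * ?v\<^sup>2)" using eq by simp
  then show ?thesis using assms(2) by (simp add: zero_less_mult_iff)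
qed

lemma holomorphic_on_compose_image:
  assumes "f holomorphic_on A" "\<And>x. x \<in> S \<Longrightarrow> g x \<in> A" "g holomorphic_on S"
  shows "(\<lambda>x. f (g x)) holomorphic_on S"
  using holomorphic_on_compose_gen[OF assms(3,1)] assms(2) by (auto simp: o_def)

text \<open>In polar coordinates \<open>r' = r * P t r\<close> and \<open>t' = Q t r\<close>, so that \<open>dr / dt = r * P t r / Q t r\<close>;
  the sign of \<open>Q t 0\<close> is the orientation of the focus.\<close>

lemma focus_half_map:
  fixes cx cy :: "nat \<Rightarrow> nat \<Rightarrow> real"
  assumes cx: "bidisc_summable cx \<rho>" and cy: "bidisc_summable cy \<rho>"
    and zero: "cx 0 0 = 0" "cy 0 0 = 0"
    and disc: "(cx 1 0 - cy 0 1)\<^sup>2 + 4 * cx 0 1 * cy 1 0 < 0" and pos: "0 < cy 1 0"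
    and F: "\<And>x y. \<bar>x\<bar> \<le> \<rho> \<Longrightarrow> \<bar>y\<bar> \<le> \<rho> \<Longrightarrow> (x, y) \<in> U \<and>
      F (x, y) = (Re (double_series cx (of_real x) (of_real y)), Re (double_series cy (of_real x)
          (of_real y)))"
  obtains A \<epsilon> where "0 < \<epsilon>" "A holomorphic_on ball 0 \<epsilon>" "A 0 = 0" "deriv A 0 \<noteq> 0"
    "\<And>z. z \<in> ball 0 \<epsilon> \<Longrightarrow> z \<in> \<real> \<Longrightarrow> A z \<in> \<real>"
    "\<And>x. 0 < x \<Longrightarrow> x < \<epsilon> \<Longrightarrow> Re (A (of_real x)) < 0 \<and> half_return (\<lambda>v. v > 0) U F x (Re (A (of_real x)))"
    "\<And>x. - \<epsilon> < x \<Longrightarrow> x < 0 \<Longrightarrow> 0 < Re (A (of_real x)) \<and> half_return (\<lambda>v. v < 0) U F x (Re (A (of_real x)))"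
proof -
  have \<rho>: "0 < \<rho>" using cx by (simp add: bidisc_summable_def)
  define X1 where "X1 = double_series (\<lambda>i j. cx (Suc i) j)"
  define X2 where "X2 = double_series (\<lambda>i j. if i = 0 then cx 0 (Suc j) else 0)"
  define Y1 where "Y1 = double_series (\<lambda>i j. cy (Suc i) j)"
  define Y2 where "Y2 = double_series (\<lambda>i j. if i = 0 then cy 0 (Suc j) else 0)"
  have hb: "holomorphic_bidisc \<rho> X1" "holomorphic_bidisc \<rho> X2" "holomorphic_bidisc \<rho> Y1"
      "holomorphic_bidisc \<rho> Y2"
    unfolding X1_def X2_def Y1_def Y2_def
    by (rule holomorphic_bidisc_double_series bidisc_summable_shift cx cy)+
  have X: "double_series cx z w = z * X1 z w + w * X2 z w" and Y: "double_series cy z w = z * Y1 z w + w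
      * Y2 z w"
    if "norm z \<le> \<rho>" "norm w \<le> \<rho>" for z w
    using double_series_shift[OF cx that] double_series_shift[OF cy that] zero
    by (simp_all add: X1_def X2_def Y1_def Y2_def)
  have at0: "X1 0 0 = of_real (cx 1 0)" "X2 0 0 = of_real (cx 0 1)" "Y1 0 0 = of_real (cy 1 0)" "Y2 0 0
      = of_real (cy 0 1)"
    unfolding X1_def X2_def Y1_def Y2_def
    using double_series_0[OF bidisc_summable_shift(1)[OF cx]] double_series_0[OF
        bidisc_summable_shift(2)[OF cx]]
      double_series_0[OF bidisc_summable_shift(1)[OF cy]] double_series_0[OF bidisc_summable_shift(2)[OF
          cy]]
    by simp_all
  define C where "C = (\<lambda>t::real. complex_of_real (cos t))"
  define D where "D = (\<lambda>t::real. complex_of_real (sin t))"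
  have CD: "norm (C t * z) \<le> norm z" "norm (D t * z) \<le> norm z" for t z
    using mult_right_mono[OF abs_cos_le_one norm_ge_zero] mult_right_mono[OF abs_sin_le_one norm_ge_zero]
    by (simp_all add: C_def D_def norm_mult)
  \<comment> \<open>\<open>u\<close> and \<open>v\<close> are the two components of the field
    divided by the radius \<open>z\<close>, along the direction of angle \<open>t\<close>. The
    splitting of the series makes them regular at \<open>z = 0\<close>.\<close>
  define u where "u = (\<lambda>t z. C t * X1 (C t * z) (D t * z) + D t * X2 (C t * z) (D t * z))"
  define v where "v = (\<lambda>t z. C t * Y1 (C t * z) (D t * z) + D t * Y2 (C t * z) (D t * z))"
  define P where "P = (\<lambda>t z. C t * u t z + D t * v t z)"
  define Q where "Q = (\<lambda>t z. C t * v t z - D t * u t z)"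
  have Cc: "continuous_on S (\<lambda>x. C (fst x))" "continuous_on S (\<lambda>x. D (fst x))"
      for S :: "(real \<times> complex) set"
    unfolding C_def D_def by (intro continuous_intros)+
  have fc: "continuous_on (UNIV \<times> cball 0 \<rho>) (\<lambda>x. f (C (fst x) * snd x) (D (fst x) * snd x))"
    if "holomorphic_bidisc \<rho> f" for f
    by (rule holomorphic_bidisc_continuous[OF that])
      (use CD order_trans in \<open>auto intro!: continuous_intros Cc, (blast intro: order_trans CD)+\<close>)
  have uvc: "continuous_on (UNIV \<times> cball 0 \<rho>) (\<lambda>x. u (fst x) (snd x))"
    "continuous_on (UNIV \<times> cball 0 \<rho>) (\<lambda>x. v (fst x) (snd x))"
    unfolding u_def v_def by (intro continuous_intros Cc fc[OF hb(1)] fc[OF hb(2)] fc[OF hb(3)] fc[OF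
        hb(4)])+
  have PQc: "continuous_on (UNIV \<times> cball 0 \<rho>) (\<lambda>x. P (fst x) (snd x))"
    "continuous_on (UNIV \<times> cball 0 \<rho>) (\<lambda>x. Q (fst x) (snd x))"
    unfolding P_def Q_def by (intro continuous_intros Cc uvc)+
  have fh: "(\<lambda>l. f (C t * z l) (D t * z l)) holomorphic_on S"
    if "holomorphic_bidisc \<rho> f" "open S" "z holomorphic_on S" "\<And>x. x \<in> S \<Longrightarrow> norm (z x) \<le> \<rho>" for f t z S
    by (rule holomorphic_bidisc_compose[OF that(1,2)])
      (use that CD order_trans in \<open>(auto intro!: holomorphic_intros, (blast intro: order_trans CD)+)\<close>)
  have PQh: "(\<lambda>l. P t (z l)) holomorphic_on S" "(\<lambda>l. Q t (z l)) holomorphic_on S"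
    if "open S" "z holomorphic_on S" "\<And>x. x \<in> S \<Longrightarrow> norm (z x) \<le> \<rho>" for t z S
    unfolding P_def Q_def u_def v_def by (intro holomorphic_intros fh[OF hb(1)] fh[OF hb(2)] fh[OF
        hb(3)] fh[OF hb(4)] that; simp)+
  have fr: "f (C t * z) (D t * z) \<in> \<real>" if "holomorphic_bidisc \<rho> f" "norm z \<le> \<rho>" "z \<in> \<real>" for f t z
    by (rule holomorphic_bidisc_real[OF that(1)])
      (use that CD order_trans in \<open>auto simp: C_def D_def, (blast intro: order_trans CD)+\<close>)
  have CDr: "C t \<in> \<real>" "D t \<in> \<real>" for t by (simp_all add: C_def D_def)
  have uvr: "u t z \<in> \<real>" "v t z \<in> \<real>" if "norm z \<le> \<rho>" "z \<in> \<real>" for t z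
    unfolding u_def v_def using that by (intro Reals_add Reals_mult CDr fr[OF hb(1)] fr[OF hb(2)] fr[OF
        hb(3)] fr[OF hb(4)]; simp)+
  have PQr: "P t z \<in> \<real>" "Q t z \<in> \<real>" if "norm z \<le> \<rho>" "z \<in> \<real>" for t z
    unfolding P_def Q_def using that by (intro Reals_add Reals_diff Reals_mult CDr uvr; simp)+
  have Q0: "0 < Re (Q t 0)" for t
    using focus_quadratic_form_pos[OF disc pos, of t]
    by (simp add: Q_def u_def v_def at0 C_def D_def power2_eq_square algebra_simps)
  let ?I = "{0..pi}"
  obtain q0 where q0: "0 < q0" "\<And>t. t \<in> ?I \<Longrightarrow> q0 \<le> Re (Q t 0)"
  proof -
    have "continuous_on ?I (\<lambda>t. Re (Q t 0))"
      using \<rho> by (intro continuous_on_Re continuous_on_compose_curried[OF PQc(2)] continuous_intros) auto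
    then have "\<exists>t0\<in>?I. \<forall>t\<in>?I. Re (Q t0 0) \<le> Re (Q t 0)"
      by (intro continuous_attains_inf) auto
    then obtain t0 where "\<forall>t\<in>?I. Re (Q t0 0) \<le> Re (Q t 0)" by blast
    then show thesis using that[of "Re (Q t0 0)"] Q0 by blast
  qed
  \<comment> \<open>Uniform continuity keeps the angular velocity above \<open>q0 / 2\<close> for
    all angles at once, so the polar equation may be divided by \<open>Q\<close>.\<close>
  obtain \<rho>1 where \<rho>1: "0 < \<rho>1" "\<rho>1 \<le> \<rho>" "\<And>t z. t \<in> ?I \<Longrightarrow> norm z \<le> \<rho>1 \<Longrightarrow> q0 / 2 < Re (Q t z)"
  proof -
    have "uniformly_continuous_on (?I \<times> cball 0 \<rho>) (\<lambda>x. Q (fst x) (snd x))"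
      by (intro compact_uniformly_continuous continuous_on_subset[OF PQc(2)] compact_Times) auto
    then obtain \<delta> where \<delta>: "0 < \<delta>" "\<And>x y. x \<in> ?I \<times> cball 0 \<rho> \<Longrightarrow> y \<in> ?I \<times> cball 0 \<rho> \<Longrightarrow> dist y x < \<delta> \<Longrightarrow>
        dist (Q (fst y) (snd y)) (Q (fst x) (snd x)) < q0 / 2"
      unfolding uniformly_continuous_on_def using q0(1) by (metis half_gt_zero)
    have "q0 / 2 < Re (Q t z)" if "t \<in> ?I" "norm z \<le> min \<rho> (\<delta> / 2)" for t z
    proof -
      have "dist (t, z) (t, 0) < \<delta>" using that \<delta>(1) by (simp add: dist_Pair_Pair)
      then have "dist (Q t z) (Q t 0) < q0 / 2" using \<delta>(2)[of "(t, 0)" "(t, z)"] that \<rho> by simp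
      then have "\<bar>Re (Q t z) - Re (Q t 0)\<bar> < q0 / 2"
        using abs_Re_le_cmod[of "Q t z - Q t 0"] by (simp add: dist_norm)
      then show ?thesis using q0(2)[OF that(1)] by linarith
    qed
    then show thesis using that[of "min \<rho> (\<delta> / 2)"] \<rho> \<delta>(1) by auto
  qed
  have Qnz: "Q t z \<noteq> 0" if "t \<in> ?I" "norm z \<le> \<rho>1" for t z
    using \<rho>1(3)[OF that] q0(1) by auto
  define S where "S = (\<lambda>t z. P t z / Q t z)"
  have Sc: "continuous_on (?I \<times> cball 0 \<rho>1) (\<lambda>x. S (fst x) (snd x))"
    unfolding S_def
    by (intro continuous_on_divide continuous_on_subset[OF PQc(1)] continuous_on_subset[OF PQc(2)])
      (use Qnz \<rho>1(2) in auto)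
  obtain B where B: "0 < B" "\<And>t z. t \<in> ?I \<Longrightarrow> norm z \<le> \<rho>1 \<Longrightarrow> norm (S t z) \<le> B"
  proof -
    have "bounded ((\<lambda>x. S (fst x) (snd x)) ` (?I \<times> cball 0 \<rho>1))"
      by (intro compact_imp_bounded compact_continuous_image Sc compact_Times) auto
    then obtain B where "0 < B" "\<forall>x\<in>(\<lambda>x. S (fst x) (snd x)) ` (?I \<times> cball 0 \<rho>1). norm x \<le> B"
      using bounded_pos by blast
    then show thesis using that[of B] by force
  qed
  have Sh: "(\<lambda>l. S t (z l)) holomorphic_on W"
    if "t \<in> ?I" "open W" "z holomorphic_on W" "\<And>x. x \<in> W \<Longrightarrow> norm (z x) \<le> \<rho>1" for t z W
    unfolding S_def using that \<rho>1(2) Qnz by (intro holomorphic_on_divide PQh) (auto intro: order_trans)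
  have Sr: "S t z \<in> \<real>" if "norm z \<le> \<rho>1" "z \<in> \<real>" for t z
    unfolding S_def using that \<rho>1(2) by (intro Reals_divide PQr) auto
  define R where "R = \<rho>1 / 2"
  \<comment> \<open>Cauchy's estimate for \<open>z * S t z\<close>, bounded by
    \<open>\<rho>1 * B\<close> on \<open>ball 0 \<rho>1\<close>, gives
    \<open>4 * (\<rho>1 * B) / \<rho>1\<close> on the half radius \<open>R\<close>.\<close>
  define L where "L = 4 * B"
  \<comment> \<open>At \<open>norm l = \<epsilon>\<close> the smallness condition of the Picard
    lemma with \<open>T = pi\<close> becomes an equality. The initial value is \<open>l\<close>
    itself, and \<open>K = 0\<close> because the zero radius solves the equation.\<close>
  define \<epsilon> where "\<epsilon> = R / (1 + 2 * pi * L * exp (2 * L * pi))"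
  have den: "0 < 1 + 2 * pi * L * exp (2 * L * pi)"
    using B(1) by (simp add: L_def add_pos_pos)
  have \<epsilon>: "0 < \<epsilon>" using \<rho>1(1) den by (simp add: \<epsilon>_def R_def)
  have RL: "0 < R" "0 \<le> L" using \<rho>1(1) B(1) by (simp_all add: R_def L_def)
  obtain z where z0: "\<And>l. l \<in> ball 0 \<epsilon> \<Longrightarrow> z 0 l = l"
    and zR: "\<And>t l. t \<in> ?I \<Longrightarrow> l \<in> ball 0 \<epsilon> \<Longrightarrow> z t l \<in> ball 0 R"
    and zd: "\<And>t l. t \<in> ?I \<Longrightarrow> l \<in> ball 0 \<epsilon>
      \<Longrightarrow> ((\<lambda>t. z t l) has_vector_derivative z t l * S t (z t l)) (at t within ?I)"
    and zh: "\<And>t. t \<in> ?I \<Longrightarrow> z t holomorphic_on ball 0 \<epsilon>"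
    and zr: "\<And>t l. t \<in> ?I \<Longrightarrow> l \<in> ball 0 \<epsilon> \<Longrightarrow> l \<in> \<real> \<Longrightarrow> z t l \<in> \<real>"
  proof (rule picard_holomorphic[where T = pi and L = L and R = R and \<epsilon> = \<epsilon> and K = 0 and
        G = "\<lambda>t z l. z * S t z" and ?z0.0 = "\<lambda>l. l"])
    have "continuous_on (?I \<times> ball 0 R \<times> ball (0::complex) \<epsilon>) (\<lambda>x. S (fst x) (fst (snd x)))"
      using \<rho>1(1) by (intro continuous_on_compose_curried[OF Sc] continuous_intros) (auto simp: R_def)
    then show "continuous_on (?I \<times> ball 0 R \<times> ball (0::complex) \<epsilon>) (\<lambda>(t, z, l). z * S t z)"
      unfolding case_prod_unfold by (intro continuous_intros)
    show "(\<lambda>l. z l * S t (z l)) holomorphic_on ball 0 \<epsilon>"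
      if "t \<in> ?I" "z holomorphic_on ball 0 \<epsilon>" "z ` ball 0 \<epsilon> \<subseteq> ball 0 R" for t z
      using that \<rho>1(1) by (intro holomorphic_intros Sh) (force simp: R_def)+
    show "norm (z * S t z - w * S t w) \<le> L * norm (z - w)"
      if t: "t \<in> ?I" and zw: "z \<in> ball 0 R" "w \<in> ball 0 R" for t z w
    proof -
      have "norm (z * S t z - w * S t w) \<le> 4 * (\<rho>1 * B) / \<rho>1 * norm (z - w)"
      proof (rule holomorphic_bounded_lipschitz[where f = "\<lambda>z. z * S t z" and r = \<rho>1])
        show "(\<lambda>z. z * S t z) holomorphic_on ball 0 \<rho>1"
          using t by (intro holomorphic_intros Sh) auto
        show "norm (z * S t z) \<le> \<rho>1 * B" if "z \<in> ball 0 \<rho>1" for z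
          unfolding norm_mult using that B t \<rho>1(1) by (intro mult_mono) auto
      qed (use zw \<rho>1(1) in \<open>auto simp: R_def\<close>)
      then show ?thesis using \<rho>1(1) by (simp add: L_def)
    qed
    show "norm l + 2 * (pi * (0 + L * norm l) * exp (2 * L * pi)) < R" if "l \<in> ball 0 \<epsilon>" for l :: complex
    proof -
      have "norm l * (1 + 2 * pi * L * exp (2 * L * pi)) < \<epsilon> * (1 + 2 * pi * L * exp (2 * L * pi))"
        using that den by (intro mult_strict_right_mono) auto
      also have "\<dots> = R" using den by (simp add: \<epsilon>_def)
      finally show ?thesis by (simp add: algebra_simps)
    qed
    show "z * S t z \<in> \<real>" if "z \<in> ball 0 R" "z \<in> \<real>" for t z
      using that \<rho>1(1) by (intro Reals_mult Sr) (auto simp: R_def)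
  qed (use RL in auto)
  define r where "r = (\<lambda>x t. Re (z t (of_real x)))"
  have zr': "z t (of_real x) = of_real (r x t)" and r\<rho>1: "\<bar>r x t\<bar> < R"
    if "t \<in> ?I" "\<bar>x\<bar> < \<epsilon>" for t x
  proof -
    show eq: "z t (of_real x) = of_real (r x t)" using zr[of t "of_real x"] that by (simp add: r_def)
    show "\<bar>r x t\<bar> < R" using zR[of t "of_real x"] that by (simp add: eq)
  qed
  define \<sigma> where "\<sigma> = (\<lambda>x t. Re (S t (of_real (r x t))))"
  have S\<sigma>: "S t (of_real (r x t)) = of_real (\<sigma> x t)" if "t \<in> ?I" "\<bar>x\<bar> < \<epsilon>" for t x
    using Sr[of "of_real (r x t)" t] r\<rho>1[OF that] RL(1) by (simp add: \<sigma>_def R_def)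
  have rd: "(r x has_real_derivative \<sigma> x t * r x t) (at t within ?I)" if "t \<in> ?I" "\<bar>x\<bar> < \<epsilon>" for t x
  proof -
    have "(r x has_vector_derivative Re (z t (of_real x) * S t (z t (of_real x)))) (at t within ?I)"
      unfolding r_def by (rule bounded_linear.has_vector_derivative[OF bounded_linear_Re zd])
          (use that in auto)
    moreover have "Re (z t (of_real x) * S t (z t (of_real x))) = \<sigma> x t * r x t"
      unfolding zr'[OF that] S\<sigma>[OF that] by simp
    ultimately show ?thesis by (simp add: has_real_derivative_iff_has_vector_derivative)
  qed
  have rc: "continuous_on ?I (r x)" if "\<bar>x\<bar> < \<epsilon>" for x
    using rd[OF _ that] DERIV_continuous unfolding continuous_on_eq_continuous_within by blast
  have \<sigma>c: "continuous_on ?I (\<sigma> x)" if "\<bar>x\<bar> < \<epsilon>" for x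
  proof -
    have "continuous_on ?I (\<lambda>t. S t (of_real (r x t)))"
    proof (intro continuous_on_compose_curried[OF Sc] continuous_intros rc[OF that])
      show "complex_of_real (r x t) \<in> cball 0 \<rho>1" if "t \<in> ?I" for t
        using r\<rho>1[OF that \<open>\<bar>x\<bar> < \<epsilon>\<close>] RL(1) by (simp add: R_def)
    qed
    then show ?thesis unfolding \<sigma>_def by (intro continuous_intros)
  qed
  have r0: "r x 0 = x" if "\<bar>x\<bar> < \<epsilon>" for x using z0[of "of_real x"] that by (simp add: r_def)
  have rexp: "r x t = x * exp (integral {0..t} (\<sigma> x))" if "t \<in> ?I" "\<bar>x\<bar> < \<epsilon>" for t x
    using linear_ode_homogeneous[OF rd[OF _ that(2)] \<sigma>c[OF that(2)] that(1)] r0[OF that(2)] by simp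
  \<comment> \<open>The minus sign is \<open>cos pi\<close>: after half a turn the radius
    \<open>z pi l\<close> lies on the opposite ray.\<close>
  define A where "A = (\<lambda>l. - z pi l)"
  have Ar: "A (of_real x) = of_real (- r x pi)" if "\<bar>x\<bar> < \<epsilon>" for x
    using zr'[of pi x] that by (simp add: A_def)
  have A0: "A 0 = 0" using Ar[of 0] rexp[of pi 0] \<epsilon> by simp
  have Ah: "A holomorphic_on ball 0 \<epsilon>" unfolding A_def using zh[of pi] by (intro holomorphic_intros) simp
  \<comment> \<open>The logarithmic derivative of the radius is bounded by \<open>B\<close>, so half
    a turn shrinks it at most by this factor; that excludes a zero derivative of
    \<open>A\<close>.\<close>
  have Abig: "exp (- (B * pi)) \<le> norm (A (of_real x) / of_real x)" if "0 < x" "x < \<epsilon>" for x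
  proof -
    have x: "\<bar>x\<bar> < \<epsilon>" using that by simp
    have "norm (integral ?I (\<sigma> x)) \<le> integral ?I (\<lambda>_. B)"
    proof (rule integral_norm_bound_integral)
      show "\<sigma> x integrable_on ?I" using \<sigma>c[OF x] integrable_continuous_interval by blast
      show "(\<lambda>_. B) integrable_on ?I" by (rule integrable_const_ivl)
      show "norm (\<sigma> x t) \<le> B" if "t \<in> ?I" for t
        using B(2)[of t "of_real (r x t)"] S\<sigma>[OF that x] r\<rho>1[OF that x] that RL(1) by (simp add: R_def)
    qed
    then have "- (B * pi) \<le> integral ?I (\<sigma> x)" by (simp add: mult.commute)
    then show ?thesis using Ar[OF x] rexp[OF _ x, of pi] that by (simp add: norm_mult norm_divide)
  qed
  have dA: "deriv A 0 \<noteq> 0"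
  proof
    assume "deriv A 0 = 0"
    then have "(A has_field_derivative 0) (at 0)" using holomorphic_derivI[OF Ah open_ball, of 0] \<epsilon> by simp
    then have l: "((\<lambda>z. A z / z) \<longlongrightarrow> 0) (at 0)" using A0 by (simp add: has_field_derivative_iff)
    have "filterlim complex_of_real (at 0) (at_right 0)"
      by (auto simp: filterlim_at eventually_at_filter intro!: tendsto_eq_intros)
    from tendsto_norm[OF filterlim_compose[OF l this]]
    have "((\<lambda>x. norm (A (of_real x) / of_real x)) \<longlongrightarrow> 0) (at_right 0)" by simp
    then have "\<forall>\<^sub>F x in at_right 0. norm (A (of_real x) / of_real x) < exp (- (B * pi))"
      using order_tendstoD(2) exp_gt_zero by blast
    moreover have "\<forall>\<^sub>F x in at_right 0. exp (- (B * pi)) \<le> norm (A (of_real x) / of_real x)"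
      using eventually_at_right_less[of 0] eventually_at_right_real[OF \<epsilon>]
      by eventually_elim (rule Abig, auto)
    ultimately have "\<forall>\<^sub>F x in at_right (0::real). False" by eventually_elim linarith
    then show False by (simp add: eventually_False)
  qed
  \<comment> \<open>For \<open>x < 0\<close> the radius is negative, so the same angles from
    \<open>0\<close> to \<open>pi\<close> sweep the lower half-plane. The predicate
    \<open>Pr\<close> covers both signs of \<open>x\<close>.\<close>
  have curve: "half_return Pr U F x (Re (A (of_real x)))"
    if x: "\<bar>x\<bar> < \<epsilon>" and Pr: "\<And>t. t \<in> {0<..<pi} \<Longrightarrow> Pr (r x t * sin t)" for x Pr
  proof -
    define c where "c = (\<lambda>t. (r x t * cos t, r x t * sin t))"
    define k where "k = (\<lambda>t. 1 / Re (Q t (of_real (r x t))))"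
    have n: "\<bar>r x t\<bar> \<le> \<rho>1" "\<bar>r x t\<bar> \<le> \<rho>" if "t \<in> ?I" for t
      using r\<rho>1[OF that x] RL(1) \<rho>1(2) by (auto simp: R_def)
    have cn: "\<bar>r x t * cos t\<bar> \<le> \<rho>" "\<bar>r x t * sin t\<bar> \<le> \<rho>" if "t \<in> ?I" for t
      using n(2)[OF that] CD[of t "of_real (r x t)"]
      by (simp_all add: C_def D_def norm_mult mult.commute flip: abs_mult)
    show ?thesis
    proof (rule half_return_of_curve[of 0 pi c U k F])
      show "c ` {0..pi} \<subseteq> U" using F cn by (auto simp: c_def)
      show kpos: "0 < k t" if "t \<in> ?I" for t
        using \<rho>1(3)[OF that, of "of_real (r x t)"] n[OF that] q0(1) by (simp add: k_def)
      have "continuous_on ?I (\<lambda>t. Q t (of_real (r x t)))"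
        using n(2) by (intro continuous_on_compose_curried[OF PQc(2)] continuous_intros rc[OF x]) auto
      then show "continuous_on ?I k"
        unfolding k_def using kpos[unfolded k_def]
        by (intro continuous_intros ballI) (metis less_irrefl zero_less_divide_1_iff)+
      fix t assume t: "t \<in> ?I"
      define \<rho>t where "\<rho>t = complex_of_real (r x t)"
      have nr: "norm \<rho>t \<le> \<rho>" "\<rho>t \<in> \<real>" using n(2)[OF t] by (simp_all add: \<rho>t_def)
      define U' where "U' = Re (u t \<rho>t)"
      define V' where "V' = Re (v t \<rho>t)"
      have uv: "u t \<rho>t = of_real U'" "v t \<rho>t = of_real V'"
          using uvr[OF nr, of t] by (simp_all add: U'_def V'_def)
      define q where "q = cos t * V' - sin t * U'"
      have Qq: "Q t \<rho>t = of_real q" by (simp add: Q_def uv C_def D_def q_def)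
      have q: "q \<noteq> 0" using Qnz[OF t, of \<rho>t] n(1)[OF t] Qq by (simp add: \<rho>t_def)
      have kq: "k t = 1 / q" using Qq by (simp add: k_def \<rho>t_def)
      have \<sigma>q: "\<sigma> x t = (cos t * U' + sin t * V') / q"
        using Qq by (simp add: \<sigma>_def S_def P_def uv C_def D_def flip: \<rho>t_def of_real_mult of_real_add
            of_real_divide)
      have "double_series cx (of_real (r x t * cos t)) (of_real (r x t * sin t)) = \<rho>t * u t \<rho>t"
        "double_series cy (of_real (r x t * cos t)) (of_real (r x t * sin t)) = \<rho>t * v t \<rho>t"
        using X[of "of_real (r x t * cos t)" "of_real (r x t * sin t)"]
          Y[of "of_real (r x t * cos t)" "of_real (r x t * sin t)"] cn[OF t]
        by (simp_all only: norm_of_real) (simp_all add: u_def v_def C_def D_def \<rho>t_def algebra_simps)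
      then have Fc: "F (c t) = (r x t * U', r x t * V')"
        using F[OF cn[OF t]] by (simp add: c_def U'_def V'_def \<rho>t_def)
      have cs: "cos t * cos t + sin t * sin t = 1"
        using sin_cos_squared_add2[of t] by (simp add: power2_eq_square)
      \<comment> \<open>Rotation by the angle recovers the Cartesian components from the radial and
        angular ones.\<close>
      have rot: "(C * u + S * v) * C - S * (C * v - S * u) = u * (C * C + S * S)"
        "(C * u + S * v) * S + C * (C * v - S * u) = v * (C * C + S * S)" for C S u v :: real
        by (simp_all add: algebra_simps)
      have "(cos t * U' + sin t * V') * cos t - sin t * q = U' * (cos t * cos t + sin t * sin t)"
        unfolding q_def by (rule rot)
      then have h1: "(cos t * U' + sin t * V') * cos t - sin t * q = U'" by (simp only: cs mult_1_right)
      have "(cos t * U' + sin t * V') * sin t + cos t * q = V' * (cos t * cos t + sin t * sin t)"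
        unfolding q_def by (rule rot)
      then have h2: "(cos t * U' + sin t * V') * sin t + cos t * q = V'" by (simp only: cs mult_1_right)
      have "\<sigma> x t * r x t * cos t - r x t * sin t
          = 1 / q * (r x t * ((cos t * U' + sin t * V') * cos t - sin t * q))"
        using q unfolding \<sigma>q by (simp add: field_simps)
      then have e1: "\<sigma> x t * r x t * cos t - r x t * sin t = k t * (r x t * U')" by (simp add: h1 kq)
      have "\<sigma> x t * r x t * sin t + r x t * cos t
          = 1 / q * (r x t * ((cos t * U' + sin t * V') * sin t + cos t * q))"
        using q unfolding \<sigma>q by (simp add: field_simps)
      then have e2: "\<sigma> x t * r x t * sin t + r x t * cos t = k t * (r x t * V')" by (simp add: h2 kq)
      have "((\<lambda>t. r x t * cos t) has_real_derivative k t * (r x t * U')) (at t within ?I)"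
        using rd[OF t x] unfolding e1[symmetric] by (auto intro!: derivative_eq_intros)
      moreover have "((\<lambda>t. r x t * sin t) has_real_derivative k t * (r x t * V')) (at t within ?I)"
        using rd[OF t x] unfolding e2[symmetric] by (auto intro!: derivative_eq_intros)
      ultimately show "(c has_vector_derivative k t *\<^sub>R F (c t)) (at t within ?I)"
        unfolding c_def[abs_def] Fc[unfolded c_def] has_real_derivative_iff_has_vector_derivative
        by (simp add: has_vector_derivative_Pair)
    next
      show "c 0 = (x, 0)" using r0[OF x] by (simp add: c_def)
      show "c pi = (Re (A (of_real x)), 0)" using Ar[OF x] by (simp add: c_def)
      show "Pr (snd (c t))" if "t \<in> {0<..<pi}" for t using Pr[OF that] by (simp add: c_def)
    qed simp
  qed
  show thesis
  proof (rule that[OF \<epsilon> Ah A0 dA])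
    show "A z \<in> \<real>" if "z \<in> ball 0 \<epsilon>" "z \<in> \<real>" for z
      using zr[of pi z] that by (simp add: A_def)
    show "Re (A (of_real x)) < 0 \<and> half_return (\<lambda>v. v > 0) U F x (Re (A (of_real x)))"
        if "0 < x" "x < \<epsilon>" for x
    proof
      have x: "\<bar>x\<bar> < \<epsilon>" using that by simp
      have rp: "0 < r x t" if "t \<in> ?I" for t using rexp[OF that x] \<open>0 < x\<close> by simp
      show "Re (A (of_real x)) < 0" using rp[of pi] Ar[OF x] by simp
      show "half_return (\<lambda>v. v > 0) U F x (Re (A (of_real x)))"
        by (rule curve[OF x]) (use rp sin_gt_zero in simp)
    qed
    show "0 < Re (A (of_real x)) \<and> half_return (\<lambda>v. v < 0) U F x (Re (A (of_real x)))"
        if "- \<epsilon> < x" "x < 0" for x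
    proof
      have x: "\<bar>x\<bar> < \<epsilon>" using that by simp
      have rp: "r x t < 0" if "t \<in> ?I" for t using rexp[OF that x] \<open>x < 0\<close> by (simp add: mult_neg_pos)
      show "0 < Re (A (of_real x))" using rp[of pi] Ar[OF x] by simp
      show "half_return (\<lambda>v. v < 0) U F x (Re (A (of_real x)))"
        by (rule curve[OF x]) (use rp sin_gt_zero in \<open>simp add: mult_neg_pos\<close>)
    qed
  qed
qed


subsection \<open>Half-return involution of a tangent point\<close>

text \<open>In contrast to the earlier splitting, every monomial containing \<open>w\<close> goes
  into the second series; what remains is the restriction to the \<open>x\<close>-axis, where the
  tangency is prescribed.\<close>

lemma double_series_split_snd:
  assumes c: "bidisc_summable c \<rho>"
  shows "bidisc_summable (\<lambda>i j. c i (Suc j)) \<rho>"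
    and "\<And>z w. norm z \<le> \<rho> \<Longrightarrow> norm w \<le> \<rho> \<Longrightarrow>
      double_series c z w = double_series c z 0 + w * double_series (\<lambda>i j. c i (Suc j)) z w"
proof -
  let ?g = "\<lambda>(i, j). \<bar>c i j\<bar> * \<rho> ^ i * \<rho> ^ j"
  let ?h = "\<lambda>(i :: nat, j). (i, Suc j)"
  have \<rho>: "0 < \<rho>" and g: "?g summable_on UNIV" using c by (auto simp: bidisc_summable_def)
  have inj: "inj ?h" by (auto simp: inj_on_def)
  have "?g summable_on range ?h" using summable_on_subset_banach[OF g] by auto
  then have "(?g \<circ> ?h) summable_on UNIV" using summable_on_reindex[OF inj] by blast
  from summable_on_cmult_left[OF this, of "inverse \<rho>"]
  have "(\<lambda>(i, j). \<bar>c i (Suc j)\<bar> * \<rho> ^ i * \<rho> ^ j) summable_on UNIV"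
    by (rule back_subst[of "\<lambda>f. f summable_on UNIV"]) (use \<rho> in \<open>auto simp: fun_eq_iff\<close>)
  then show "bidisc_summable (\<lambda>i j. c i (Suc j)) \<rho>" using \<rho> by (simp add: bidisc_summable_def)
  fix z w :: complex assume zw: "norm z \<le> \<rho>" "norm w \<le> \<rho>"
  let ?f = "\<lambda>w (i, j). of_real (c i j) * z ^ i * w ^ j"
  have s: "?f w summable_on A" for A
    using summable_on_subset_banach[of "?f w" UNIV A] double_series_has_sum[OF c zw] summable_on_def by auto
  have U: "UNIV = (UNIV \<times> {0}) \<union> range ?h"
  proof -
    have "x \<in> (UNIV \<times> {0}) \<union> range ?h" for x :: "nat \<times> nat"
      by (cases x; cases "snd x") (auto simp: image_iff)
    then show ?thesis by (rule UNIV_eq_I)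
  qed
  have "double_series c z w = infsum (?f w) (UNIV \<times> {0} \<union> range ?h)"
    unfolding double_series_def using U by simp
  also have "\<dots> = infsum (?f w) (UNIV \<times> {0}) + infsum (?f w) (range ?h)"
    by (rule infsum_Un_disjoint) (auto intro: s)
  also have "infsum (?f w) (UNIV \<times> {0}) = infsum (?f 0) UNIV"
    by (rule infsum_cong_neutral) (auto simp: power_0_left split: if_splits)
  also have "infsum (?f w) (range ?h) = infsum (?f w \<circ> ?h) UNIV" by (rule infsum_reindex[OF inj])
  also have "\<dots> = (\<Sum>\<^sub>\<infinity>x. w * (\<lambda>(i, j). of_real (c i (Suc j)) * z ^ i * w ^ j) x)"
    by (rule infsum_cong) auto
  also have "\<dots> = w * double_series (\<lambda>i j. c i (Suc j)) z w"
    unfolding double_series_def by (rule infsum_cmult_right')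
  finally show "double_series c z w = double_series c z 0 + w * double_series (\<lambda>i j. c i (Suc j)) z w"
    by (simp add: double_series_def)
qed

lemma holomorphic_bidisc_positive_near_0:
  assumes f: "holomorphic_bidisc \<rho> f" and \<rho>: "0 < \<rho>" and pos: "0 < Re (f 0 0)"
  obtains \<rho>' where "0 < \<rho>'" "\<rho>' \<le> \<rho>" "\<And>z w. norm z \<le> \<rho>' \<Longrightarrow> norm w \<le> \<rho>' \<Longrightarrow> 0 < Re (f z w)"
proof -
  obtain L where L: "0 < L" "\<And>z w z' w'. norm z \<le> \<rho> / 2 \<Longrightarrow> norm w \<le> \<rho> / 2 \<Longrightarrow> norm z' \<le> \<rho> / 2 \<Longrightarrow> norm w' \<le> \<rho> / 2
      \<Longrightarrow> norm (f z w - f z' w') \<le> L * (norm (z - z') + norm (w - w'))"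
    using holomorphic_bidisc_lipschitz[OF f \<rho>] by blast
  \<comment> \<open>Two Lipschitz contributions of at most a quarter of \<open>Re (f 0 0)\<close>
    each leave half of it.\<close>
  define \<rho>' where "\<rho>' = min (\<rho> / 2) (Re (f 0 0) / (4 * L))"
  have b: "0 < \<rho>'" "\<rho>' \<le> \<rho> / 2" "L * \<rho>' \<le> Re (f 0 0) / 4"
  proof -
    show "0 < \<rho>'" "\<rho>' \<le> \<rho> / 2" using \<rho> L(1) pos by (auto simp: \<rho>'_def)
    have "L * \<rho>' \<le> L * (Re (f 0 0) / (4 * L))" using L(1) by (intro mult_left_mono) (auto simp: \<rho>'_def)
    then show "L * \<rho>' \<le> Re (f 0 0) / 4" using L(1) by simp
  qed
  show thesis
  proof (rule that[OF b(1)])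
    show "\<rho>' \<le> \<rho>" using b \<rho> by simp
    fix z w :: complex assume zw: "norm z \<le> \<rho>'" "norm w \<le> \<rho>'"
    then have "norm (f z w - f 0 0) \<le> L * (norm z + norm w)"
      using L(2)[of z w 0 0] b(2) \<rho> by simp
    also have "\<dots> \<le> L * (\<rho>' + \<rho>')" using zw L(1) by (intro mult_left_mono) auto
    also have "\<dots> \<le> Re (f 0 0) / 2" using b(3) by (simp add: distrib_left)
    finally show "0 < Re (f z w)"
      using abs_Re_le_cmod[of "f z w - f 0 0"] pos by simp
  qed
qed

text \<open>The orbit through \<open>(x, 0)\<close> is the graph of \<open>y x s = x ^ Suc n * W x (1 - s / x)\<close>. The rescaled
  height \<open>W\<close> solves an equation that stays regular at \<open>x = 0\<close>, so \<open>y x 0\<close> vanishes at \<open>x = 0\<close> to order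
  exactly \<open>Suc n\<close>.\<close>

lemma tangent_graph:
  fixes cx cy :: "nat \<Rightarrow> nat \<Rightarrow> real"
  assumes cx: "bidisc_summable cx \<rho>" and cy: "bidisc_summable cy \<rho>"
    and zero: "\<And>k. k < n \<Longrightarrow> (deriv ^^ k) (\<lambda>z. double_series cy z 0) 0 = 0"
    and posY: "0 < Re ((deriv ^^ n) (\<lambda>z. double_series cy z 0) 0)" and posX: "0 < cx 0 0"
    and even: "even (Suc n)"
  obtains \<epsilon> \<kappa> y where "0 < \<epsilon>" "\<kappa> holomorphic_on ball 0 \<epsilon>"
    "\<And>z. z \<in> ball 0 \<epsilon> \<Longrightarrow> z \<in> \<real> \<Longrightarrow> \<kappa> z \<in> \<real>" "\<And>x. \<bar>x\<bar> < \<epsilon> \<Longrightarrow> 0 < Re (\<kappa> (of_real x))"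
    "\<And>x s. x \<noteq> 0 \<Longrightarrow> \<bar>x\<bar> < \<epsilon> \<Longrightarrow> s \<in> {min 0 x..max 0 x} \<Longrightarrow>
      \<bar>s\<bar> \<le> \<rho> \<and> \<bar>y x s\<bar> \<le> \<rho> \<and> 0 < Re (double_series cx (of_real s) (of_real (y x s))) \<and>
      (y x has_real_derivative Re (double_series cy (of_real s) (of_real (y x s)))
        / Re (double_series cx (of_real s) (of_real (y x s)))) (at s within {min 0 x..max 0 x})"
    "\<And>x. x \<noteq> 0 \<Longrightarrow> \<bar>x\<bar> < \<epsilon> \<Longrightarrow> y x x = 0"
    "\<And>x. x \<noteq> 0 \<Longrightarrow> \<bar>x\<bar> < \<epsilon> \<Longrightarrow> y x 0 = - (x ^ Suc n * Re (\<kappa> (of_real x)))"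
    "\<And>x s. x \<noteq> 0 \<Longrightarrow> \<bar>x\<bar> < \<epsilon> \<Longrightarrow> s \<in> {min 0 x..max 0 x} \<Longrightarrow> s \<noteq> x \<Longrightarrow> y x s < 0"
proof -
  have \<rho>: "0 < \<rho>" using cx by (simp add: bidisc_summable_def)
  let ?X = "double_series cx" and ?Y = "double_series cy"
  have hX: "holomorphic_bidisc \<rho> ?X" and hY: "holomorphic_bidisc \<rho> ?Y"
    by (rule holomorphic_bidisc_double_series cx cy)+
  define H where "H = double_series (\<lambda>i j. cy i (Suc j))"
  have hH: "holomorphic_bidisc \<rho> H"
    unfolding H_def by (rule holomorphic_bidisc_double_series double_series_split_snd cy)+
  have g: "(\<lambda>z. ?Y z 0) holomorphic_on ball 0 \<rho>"
    by (rule holomorphic_bidisc_compose[OF hY]) (use \<rho> in auto)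
  have gr: "?Y z 0 \<in> \<real>" if "z \<in> ball 0 \<rho>" "z \<in> \<real>" for z
    by (rule holomorphic_bidisc_real[OF hY]) (use that \<rho> in auto)
  obtain e where e: "e holomorphic_on ball 0 \<rho>" "\<And>z. z \<in> ball 0 \<rho> \<Longrightarrow> ?Y z 0 = z ^ n * e z"
    "e 0 = (deriv ^^ n) (\<lambda>z. ?Y z 0) 0 / fact n" "\<And>z. z \<in> ball 0 \<rho> \<Longrightarrow> z \<in> \<real> \<Longrightarrow> e z \<in> \<real>"
    using holomorphic_factor_power[OF g \<rho> zero gr] by blast
  have e0: "0 < Re (e 0)"
  proof -
    have "e 0 = (deriv ^^ n) (\<lambda>z. ?Y z 0) 0 / of_real (fact n)" using e(3) by simp
    then show ?thesis using posY by (simp only: Re_divide_of_real) simp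
  qed
  obtain \<rho>1 where \<rho>1: "0 < \<rho>1" "\<rho>1 \<le> \<rho>" and Xpos: "\<And>z w. norm z \<le> \<rho>1 \<Longrightarrow> norm w \<le> \<rho>1 \<Longrightarrow> 0 < Re (?X z w)"
    using holomorphic_bidisc_positive_near_0[OF hX \<rho>] posX double_series_0[OF cx] by auto
  define \<rho>2 where "\<rho>2 = \<rho>1 / 2"
  have \<rho>2: "0 < \<rho>2" "\<rho>2 < \<rho>" "\<rho>2 \<le> \<rho>1" using \<rho>1 by (auto simp: \<rho>2_def)
  have Xnz: "?X z w \<noteq> 0" if "norm z \<le> \<rho>2" "norm w \<le> \<rho>2" for z w
    using Xpos[of z w] that \<rho>2 by auto
  \<comment> \<open>Along the graph the slope is \<open>s ^ n * E s y + y * J s y\<close>: the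
    values of \<open>?Y\<close> on the axis equal \<open>z ^ n * e z\<close>, and the rest has the
    factor \<open>w\<close>.\<close>
  define E where "E = (\<lambda>z w. e z / ?X z w)"
  define J where "J = (\<lambda>z w. H z w / ?X z w)"
  have hX2: "holomorphic_bidisc \<rho>2 ?X" using holomorphic_bidisc_mono[OF hX] \<rho>2 by simp
  have hE: "holomorphic_bidisc \<rho>2 E"
    unfolding E_def by (intro holomorphic_bidisc_divide hX2 holomorphic_bidisc_one_variable[OF e(1)
        \<rho>2(2) e(4)] Xnz)
  have hJ: "holomorphic_bidisc \<rho>2 J"
    unfolding J_def using \<rho>2 by (intro holomorphic_bidisc_divide hX2 holomorphic_bidisc_mono[OF hH] Xnz)
        auto
  have "E 0 0 = of_real (Re (e 0) / cx 0 0)"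
    using e(4)[of 0] \<rho> by (simp add: E_def double_series_0[OF cx])
  then have E0: "0 < Re (E 0 0)" using e0 posX by simp
  obtain \<rho>3 where \<rho>3: "0 < \<rho>3" "\<rho>3 \<le> \<rho>2" and Epos: "\<And>z w. norm z \<le> \<rho>3 \<Longrightarrow> norm w \<le> \<rho>3 \<Longrightarrow> 0 < Re (E z w)"
    using holomorphic_bidisc_positive_near_0[OF hE \<rho>2(1) E0] by blast
  obtain K1 where K1: "0 < K1" "\<And>z w. norm z \<le> \<rho>2 \<Longrightarrow> norm w \<le> \<rho>2 \<Longrightarrow> norm (E z w) \<le> K1"
    using holomorphic_bidisc_bounded[OF hE] by blast
  obtain K2 where K2: "0 < K2" "\<And>z w. norm z \<le> \<rho>2 \<Longrightarrow> norm w \<le> \<rho>2 \<Longrightarrow> norm (J z w) \<le> K2"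
    using holomorphic_bidisc_bounded[OF hJ] by blast
  obtain L1 where L1: "0 < L1" "\<And>z w z' w'. norm z \<le> \<rho>2 / 2 \<Longrightarrow> norm w \<le> \<rho>2 / 2 \<Longrightarrow> norm z' \<le> \<rho>2 / 2
      \<Longrightarrow> norm w' \<le> \<rho>2 / 2 \<Longrightarrow> norm (E z w - E z' w') \<le> L1 * (norm (z - z') + norm (w - w'))"
    using holomorphic_bidisc_lipschitz[OF hE \<rho>2(1)] by blast
  obtain L2 where L2: "0 < L2" "\<And>z w z' w'. norm z \<le> \<rho>2 / 2 \<Longrightarrow> norm w \<le> \<rho>2 / 2 \<Longrightarrow> norm z' \<le> \<rho>2 / 2
      \<Longrightarrow> norm w' \<le> \<rho>2 / 2 \<Longrightarrow> norm (J z w - J z' w') \<le> L2 * (norm (z - z') + norm (w - w'))"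
    using holomorphic_bidisc_lipschitz[OF hJ \<rho>2(1)] by blast
  \<comment> \<open>With \<open>T = 1\<close>, \<open>L = 1 / 4\<close> and zero initial value, the
    smallness condition of the Picard lemma reads \<open>2 * (K1 * exp (1 / 2)) < R\<close>; it
    holds since \<open>exp (1 / 2) \<le> 2\<close>.\<close>
  define R where "R = 5 * K1 + 1"
  \<comment> \<open>\<open>norm l * N\<close> bounds the Lipschitz constant of \<open>G\<close> in
    its second argument: \<open>L1\<close> from \<open>E\<close>, \<open>K2\<close> from the
    explicit factor \<open>w\<close>, and \<open>R * L2\<close> from \<open>J\<close>.\<close>
  define N where "N = L1 + K2 + R * L2"
  have R: "1 \<le> R" "0 < R" using K1 by (auto simp: R_def)
  have N: "0 < N" using L1(1) K2(1) L2(1) R by (auto simp: N_def intro!: add_pos_pos)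
  define \<rho>4 where "\<rho>4 = min \<rho>3 (\<rho>2 / 2)"
  have \<rho>4: "0 < \<rho>4" "\<rho>4 \<le> \<rho>3" "\<rho>4 \<le> \<rho>2 / 2" using \<rho>3 \<rho>2 by (auto simp: \<rho>4_def)
  \<comment> \<open>The three bounds make powers of \<open>l\<close> at most \<open>norm l\<close>,
    keep \<open>?q l w\<close> within \<open>\<rho>4\<close>, and bring \<open>norm l * N\<close>
    below the \<open>1 / 4\<close> used as Lipschitz constant.\<close>
  define \<epsilon> where "\<epsilon> = min (min 1 (\<rho>4 / R)) (1 / (4 * N))"
  have \<epsilon>: "0 < \<epsilon>" "\<epsilon> \<le> 1" "\<epsilon> * R \<le> \<rho>4" "\<epsilon> * N \<le> 1 / 4"
  proof -
    show "0 < \<epsilon>" "\<epsilon> \<le> 1" using \<rho>4 R N by (auto simp: \<epsilon>_def)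
    have "\<epsilon> * R \<le> \<rho>4 / R * R" using R by (intro mult_right_mono) (auto simp: \<epsilon>_def)
    then show "\<epsilon> * R \<le> \<rho>4" using R by simp
    have "\<epsilon> * N \<le> 1 / (4 * N) * N" using N by (intro mult_right_mono) (auto simp: \<epsilon>_def)
    then show "\<epsilon> * N \<le> 1 / 4" using N by simp
  qed
  have \<epsilon>\<rho>: "\<epsilon> \<le> \<rho>4" using mult_left_mono[OF R(1) less_imp_le[OF \<epsilon>(1)]] \<epsilon>(3) by simp
  let ?I = "{0..1::real}"
  let ?p = "\<lambda>s l. l * of_real (1 - s) :: complex" and ?q = "\<lambda>l w. l ^ Suc n * w :: complex"
  have pb: "norm (?p s l) \<le> \<rho>4" if "s \<in> ?I" "l \<in> ball 0 \<epsilon>" for s l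
  proof -
    have "norm (?p s l) \<le> norm l * 1"
      unfolding norm_mult using that by (intro mult_left_mono) (auto simp del: of_real_diff)
    then show ?thesis using that \<epsilon>\<rho> by simp
  qed
  have lpow: "norm (l ^ Suc n) \<le> norm l" if "l \<in> ball 0 \<epsilon>" for l :: complex
    using that \<epsilon>(2) by (auto simp: norm_mult norm_power intro!: mult_left_le power_le_one)
  have qb: "norm (?q l w) \<le> \<rho>4" if "l \<in> ball 0 \<epsilon>" "w \<in> ball 0 R" for l w
  proof -
    have "norm (?q l w) \<le> norm l * norm w"
      unfolding norm_mult[of _ w] using lpow[OF that(1)] by (intro mult_right_mono) auto
    also have "\<dots> \<le> \<epsilon> * R" using that \<epsilon>(1) by (intro mult_mono) auto
    finally show ?thesis using \<epsilon>(3) by simp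
  qed
  \<comment> \<open>Obtained by substituting the abscissa \<open>l * (1 - s)\<close> and the height
    \<open>l ^ Suc n * w\<close> into the slope equation. The forcing supplies \<open>l ^ n\<close>
    and the chain rule \<open>- l\<close>, which cancel \<open>l ^ Suc n\<close>; no division by
    \<open>l\<close> remains.\<close>
  define G where "G = (\<lambda>s w l. - (of_real ((1 - s) ^ n) * E (?p s l) (?q l w) + l * w * J (?p s l) (?q l
      w)))"
  have le2: "x \<le> \<rho>2" "x \<le> \<rho>2 / 2" if "x \<le> \<rho>4" for x using that \<rho>4 \<rho>2 by auto
  obtain w where w0: "\<And>l. l \<in> ball 0 \<epsilon> \<Longrightarrow> w 0 l = 0"
    and wR: "\<And>t l. t \<in> ?I \<Longrightarrow> l \<in> ball 0 \<epsilon> \<Longrightarrow> w t l \<in> ball 0 R"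
    and wd: "\<And>t l. t \<in> ?I \<Longrightarrow> l \<in> ball 0 \<epsilon>
      \<Longrightarrow> ((\<lambda>t. w t l) has_vector_derivative G t (w t l) l) (at t within ?I)"
    and wh: "\<And>t. t \<in> ?I \<Longrightarrow> w t holomorphic_on ball 0 \<epsilon>"
    and wr: "\<And>t l. t \<in> ?I \<Longrightarrow> l \<in> ball 0 \<epsilon> \<Longrightarrow> l \<in> \<real> \<Longrightarrow> w t l \<in> \<real>"
  proof (rule picard_holomorphic[where T = 1 and L = "1 / 4" and R = R and \<epsilon> = \<epsilon> and K = K1 and
        G = G and ?z0.0 = "\<lambda>l. 0"])
    have c: "continuous_on (?I \<times> ball 0 R \<times> ball 0 \<epsilon>) (\<lambda>x. f (?p (fst x) (snd (snd x))) (?q (snd (snd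
        x)) (fst (snd x))))"
      if "holomorphic_bidisc \<rho>2 f" for f
      by (rule holomorphic_bidisc_continuous[OF that]) (use pb qb le2 in \<open>auto intro!: continuous_intros\<close>)
    show "continuous_on (?I \<times> ball 0 R \<times> ball 0 \<epsilon>) (\<lambda>(t, z, l). G t z l)"
      unfolding case_prod_unfold G_def by (intro continuous_intros c[OF hE] c[OF hJ])
    have h: "(\<lambda>l. f (?p t l) (?q l (z l))) holomorphic_on ball 0 \<epsilon>"
      if "holomorphic_bidisc \<rho>2 f" "t \<in> ?I" "z holomorphic_on ball 0 \<epsilon>" "z ` ball 0 \<epsilon> \<subseteq> ball 0 R" for f t z
      by (rule holomorphic_bidisc_compose[OF that(1)])
        (use pb qb le2 that in \<open>auto intro!: holomorphic_intros simp: image_subset_iff\<close>)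
    show "(\<lambda>l. G t (z l) l) holomorphic_on ball 0 \<epsilon>"
      if "t \<in> ?I" "z holomorphic_on ball 0 \<epsilon>" "z ` ball 0 \<epsilon> \<subseteq> ball 0 R" for t z
      unfolding G_def using that by (intro holomorphic_intros h[OF hE] h[OF hJ])
    show "norm (G t z l - G t v l) \<le> 1 / 4 * norm (z - v)"
      if t: "t \<in> ?I" and zv: "z \<in> ball 0 R" "v \<in> ball 0 R" and l: "l \<in> ball 0 \<epsilon>" for t z v l
    proof -
      let ?d = "norm l * norm (z - v)"
      have qq: "norm (?q l z - ?q l v) \<le> ?d"
      proof -
        have "?q l z - ?q l v = l ^ Suc n * (z - v)" by (simp only: right_diff_distrib)
        then show ?thesis using mult_right_mono[OF lpow[OF l], of "norm (z - v)"]
            by (simp only: norm_mult norm_ge_zero)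
      qed
      have E: "norm (E (?p t l) (?q l z) - E (?p t l) (?q l v)) \<le> L1 * ?d"
        by (rule order_trans[OF _ mult_left_mono[OF qq less_imp_le[OF L1(1)]]])
          (use L1(2)[of "?p t l" "?q l z" "?p t l" "?q l v"] le2(2)[OF pb[OF t l]] le2(2)[OF qb[OF l zv(1)]]
            le2(2)[OF qb[OF l zv(2)]] in simp)
      have Jd: "norm (J (?p t l) (?q l z) - J (?p t l) (?q l v)) \<le> L2 * ?d"
        by (rule order_trans[OF _ mult_left_mono[OF qq less_imp_le[OF L2(1)]]])
          (use L2(2)[of "?p t l" "?q l z" "?p t l" "?q l v"] le2(2)[OF pb[OF t l]] le2(2)[OF qb[OF l zv(1)]]
            le2(2)[OF qb[OF l zv(2)]] in simp)
      have Jb: "norm (J (?p t l) (?q l z)) \<le> K2"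
        using K2(2) le2(1)[OF pb[OF t l]] le2(1)[OF qb[OF l zv(1)]] by blast
      define a where "a = complex_of_real ((1 - t) ^ n)"
      have a: "norm a \<le> 1" using t by (auto simp: a_def norm_power simp del: of_real_diff of_real_power
          intro!: power_le_one)
      have eq: "G t v l - G t z l = a * (E (?p t l) (?q l z) - E (?p t l) (?q l v))
          + l * ((z - v) * J (?p t l) (?q l z)) + l * (v * (J (?p t l) (?q l z) - J (?p t l) (?q l v)))"
        unfolding G_def a_def by (simp add: algebra_simps)
      have 1: "norm (a * (E (?p t l) (?q l z) - E (?p t l) (?q l v))) \<le> 1 * (L1 * ?d)"
        unfolding norm_mult[of a] using a E L1(1) by (intro mult_mono) auto
      have 2: "norm (l * ((z - v) * J (?p t l) (?q l z))) \<le> norm l * (norm (z - v) * K2)"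
        unfolding norm_mult using Jb by (intro mult_left_mono) auto
      have 3: "norm (l * (v * (J (?p t l) (?q l z) - J (?p t l) (?q l v)))) \<le> 1 * (R * (L2 * ?d))"
        unfolding norm_mult[of l] norm_mult[of v] using zv l \<epsilon>(2) Jd R L2(1) by (intro mult_mono) auto
      have "norm (G t z l - G t v l) = norm (G t v l - G t z l)" by (rule norm_minus_commute)
      also have "\<dots> \<le> 1 * (L1 * ?d) + norm l * (norm (z - v) * K2) + 1 * (R * (L2 * ?d))"
        unfolding eq by (intro norm_triangle_le add_mono 1 2 3)
      also have "\<dots> = norm l * N * norm (z - v)" by (simp add: N_def algebra_simps)
      also have "\<dots> \<le> (\<epsilon> * N) * norm (z - v)" using l N by (intro mult_right_mono) auto
      also have "\<dots> \<le> 1 / 4 * norm (z - v)" using \<epsilon>(4) by (intro mult_right_mono) auto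
      finally show ?thesis .
    qed
    show "norm (G t 0 l) \<le> K1" if t: "t \<in> ?I" and l: "l \<in> ball 0 \<epsilon>" for t l
    proof -
      have "norm (G t 0 l) = norm (complex_of_real ((1 - t) ^ n)) * norm (E (?p t l) 0)"
        by (simp only: G_def mult_zero_right mult_zero_left add_0_right norm_minus_cancel norm_mult)
      also have "\<dots> \<le> 1 * K1"
        using K1 le2(1)[OF pb[OF t l]] \<rho>2(1) t
        by (intro mult_mono) (auto simp: norm_power simp del: of_real_diff of_real_power intro!:
            power_le_one)
      finally show ?thesis by simp
    qed
    show "norm (0::complex) + 2 * (1 * (K1 + 1 / 4 * norm (0::complex)) * exp (2 * (1 / 4) * 1)) < R"
    proof -
      have "K1 * exp (1 / 2) \<le> K1 * 2" using K1(1) exp_half_le2 by (intro mult_left_mono) auto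
      then have "2 * (K1 * exp (1 / 2)) < 5 * K1 + 1" using K1(1) by linarith
      then show ?thesis by (simp add: R_def)
    qed
    show "G t z l \<in> \<real>"
      if "t \<in> ?I" "z \<in> ball 0 R" "l \<in> ball 0 \<epsilon>" "z \<in> \<real>" "l \<in> \<real>" for t z l
      unfolding G_def using that le2(1)[OF pb[of t l]] le2(1)[OF qb[of l z]]
      by (intro Reals_minus Reals_add Reals_mult Reals_of_real Reals_power
          holomorphic_bidisc_real[OF hE] holomorphic_bidisc_real[OF hJ]) 
  qed (use R in auto)
  define W where "W = (\<lambda>x t. Re (w t (of_real x)))"
  have ww: "w t (of_real x) = of_real (W x t)" if "t \<in> ?I" "\<bar>x\<bar> < \<epsilon>" for t x
    using wr[of t "of_real x"] that by (simp add: W_def)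
  define a where "a = (\<lambda>x t::real. x * (1 - t))"
  define b where "b = (\<lambda>x t. x ^ Suc n * W x t)"
  have pa: "?p t (of_real x) = of_real (a x t)" for x t by (simp add: a_def)
  have qb': "?q (of_real x) (w t (of_real x)) = of_real (b x t)" if "t \<in> ?I" "\<bar>x\<bar> < \<epsilon>" for t x
    using ww[OF that] by (simp add: b_def)
  have ab: "\<bar>a x t\<bar> \<le> \<rho>4" "\<bar>b x t\<bar> \<le> \<rho>4" if "t \<in> ?I" "\<bar>x\<bar> < \<epsilon>" for t x
    using pb[of t "of_real x"] qb[of "of_real x" "w t (of_real x)"] wR[of t "of_real x"] that
    unfolding pa qb'[OF that] by auto
  define \<eta> where "\<eta> = (\<lambda>x t. Re (E (of_real (a x t)) (of_real (b x t))))"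
  define \<theta> where "\<theta> = (\<lambda>x t. Re (J (of_real (a x t)) (of_real (b x t))))"
  have EJ: "E (of_real (a x t)) (of_real (b x t)) = of_real (\<eta> x t)" 
    "J (of_real (a x t)) (of_real (b x t)) = of_real (\<theta> x t)" if "t \<in> ?I" "\<bar>x\<bar> < \<epsilon>" for t x
    using holomorphic_bidisc_real[OF hE, of "of_real (a x t)" "of_real (b x t)"]
      holomorphic_bidisc_real[OF hJ, of "of_real (a x t)" "of_real (b x t)"] ab[OF that] le2(1)
    by (simp_all add: \<eta>_def \<theta>_def)
  have Wd: "(W x has_real_derivative - (x * \<theta> x t) * W x t - (1 - t) ^ n * \<eta> x t) (at t within ?I)"
    if "t \<in> ?I" "\<bar>x\<bar> < \<epsilon>" for t x
  proof -
    have "(W x has_vector_derivative Re (G t (w t (of_real x)) (of_real x))) (at t within ?I)"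
      unfolding W_def by (rule bounded_linear.has_vector_derivative[OF bounded_linear_Re wd])
          (use that in auto)
    moreover have "G t (w t (of_real x)) (of_real x)
        = of_real (- ((1 - t) ^ n * \<eta> x t + x * W x t * \<theta> x t))"
      unfolding G_def pa unfolding qb'[OF that] EJ[OF that] unfolding ww[OF that] by simp
    ultimately show ?thesis
      by (simp add: has_real_derivative_iff_has_vector_derivative algebra_simps)
  qed
  have Wc: "continuous_on ?I (W x)" if "\<bar>x\<bar> < \<epsilon>" for x
    using Wd[OF _ that] DERIV_continuous unfolding continuous_on_eq_continuous_within by blast
  have \<theta>c: "continuous_on ?I (\<theta> x)" if "\<bar>x\<bar> < \<epsilon>" for x
    unfolding \<theta>_def
  proof (intro continuous_on_Re holomorphic_bidisc_continuous[OF hJ])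
    show "continuous_on ?I (\<lambda>t. complex_of_real (a x t))" unfolding a_def by (intro continuous_intros)
    show "continuous_on ?I (\<lambda>t. complex_of_real (b x t))" unfolding b_def
        by (intro continuous_intros Wc that)
  qed (use ab[OF _ that] le2(1) in auto)
  have \<eta>pos: "0 < \<eta> x t" if "t \<in> ?I" "\<bar>x\<bar> < \<epsilon>" for t x
    unfolding \<eta>_def using ab[OF that] \<rho>4(2) by (intro Epos) auto
  \<comment> \<open>The equation of \<open>W\<close> is linear along the solution, with negative
    forcing before time \<open>1\<close>. This gives both the negative height and the positivity of
    \<open>\<kappa>\<close>.\<close>
  have Wneg: "W x t < 0" if "0 < t" "t \<le> 1" "\<bar>x\<bar> < \<epsilon>" for t x
  proof (rule linear_ode_forced_neg[of 1 "W x" "\<lambda>t. - (x * \<theta> x t)" "\<lambda>t. (1 - t) ^ n * \<eta> x t"])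
    show "continuous_on ?I (\<lambda>t. - (x * \<theta> x t))" by (intro continuous_intros \<theta>c that)
    show "W x 0 = 0" using w0[of "of_real x"] that by (simp add: W_def)
    show "0 < (1 - s) ^ n * \<eta> x s" if "0 < s" "s < 1" for s
      using \<eta>pos[of s x] that \<open>\<bar>x\<bar> < \<epsilon>\<close> by simp
  qed (use that Wd in auto)
  \<comment> \<open>At time \<open>1\<close> the abscissa is \<open>0\<close>:
    \<open>\<kappa>\<close> is the depth at which the orbit crosses the \<open>y\<close>-axis,
    divided by \<open>l ^ Suc n\<close>.\<close>
  define \<kappa> where "\<kappa> = (\<lambda>l. - w 1 l)"
  define y where "y = (\<lambda>x s. x ^ Suc n * W x (1 - s / x))"
  have seg: "1 - s / x \<in> ?I" if "x \<noteq> 0" "s \<in> {min 0 x..max 0 x}" for x s :: real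
    using that by (auto simp: min_def max_def divide_simps split: if_splits)
  have ax: "a x (1 - s / x) = s" if "x \<noteq> 0" for x s using that by (simp add: a_def)
  have byx: "b x (1 - s / x) = y x s" for x s by (simp add: b_def y_def)
  show thesis
  proof (rule that[OF \<epsilon>(1), of \<kappa> y])
    show "\<kappa> holomorphic_on ball 0 \<epsilon>" unfolding \<kappa>_def using wh[of 1] by (intro holomorphic_intros) simp
    show "\<kappa> z \<in> \<real>" if "z \<in> ball 0 \<epsilon>" "z \<in> \<real>" for z using wr[of 1 z] that by (simp add: \<kappa>_def)
    show "0 < Re (\<kappa> (of_real x))" if "\<bar>x\<bar> < \<epsilon>" for x
      using Wneg[of 1 x] that by (simp add: \<kappa>_def W_def)
    show "y x x = 0" if "x \<noteq> 0" "\<bar>x\<bar> < \<epsilon>" for x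
      using w0[of "of_real x"] that by (simp add: y_def W_def)
    show "y x 0 = - (x ^ Suc n * Re (\<kappa> (of_real x)))" if "x \<noteq> 0" "\<bar>x\<bar> < \<epsilon>" for x
      by (simp add: y_def \<kappa>_def W_def)
    show "y x s < 0" if "x \<noteq> 0" "\<bar>x\<bar> < \<epsilon>" "s \<in> {min 0 x..max 0 x}" "s \<noteq> x" for x s
    proof -
      have "1 - s / x \<noteq> 0" using that by (simp add: field_simps)
      then have "0 < 1 - s / x" "1 - s / x \<le> 1"
        using seg[OF that(1,3)] by (metis atLeastAtMost_iff order_le_less)+
      then have "W x (1 - s / x) < 0" using that(2) by (rule Wneg)
      moreover have "0 < x ^ Suc n" using even that(1) zero_less_power_eq[of x "Suc n"] by blast
      ultimately show ?thesis unfolding y_def by (simp only: mult_pos_neg)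
    qed
    fix x s :: real assume x: "x \<noteq> 0" "\<bar>x\<bar> < \<epsilon>" and s: "s \<in> {min 0 x..max 0 x}"
    let ?t = "1 - s / x" and ?S = "{min 0 x..max 0 x}"
    note t = seg[OF x(1) s]
    have sy: "\<bar>s\<bar> \<le> \<rho>4" "\<bar>y x s\<bar> \<le> \<rho>4" using ab[OF t x(2)] unfolding ax[OF x(1)] byx by auto
    have sy2: "\<bar>s\<bar> \<le> \<rho>2" "\<bar>y x s\<bar> \<le> \<rho>2" "\<bar>s\<bar> < \<rho>" "\<bar>y x s\<bar> \<le> \<rho>"
      using sy le2(1)[OF sy(1)] le2(1)[OF sy(2)] \<rho>2(2) by linarith+
    let ?Xs = "?X (of_real s) (of_real (y x s))" and ?Ys = "?Y (of_real s) (of_real (y x s))"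
    have Xp: "0 < Re ?Xs" using Xpos[of "of_real s" "of_real (y x s)"] sy2 \<rho>2(3) by simp
    have Xr: "?Xs = of_real (Re ?Xs)"
      using holomorphic_bidisc_real[OF hX2, of "of_real s" "of_real (y x s)"] sy2 by simp
    have "?Ys = of_real s ^ n * e (of_real s) + of_real (y x s) * H (of_real s) (of_real (y x s))"
      using double_series_split_snd(2)[OF cy, of "of_real s" "of_real (y x s)"] sy2 e(2)[of "of_real s"]
      by (simp add: H_def)
    then have "?Ys / ?Xs = of_real s ^ n * E (of_real s) (of_real (y x s)) + of_real (y x s) * J
        (of_real s) (of_real (y x s))"
      by (simp add: E_def J_def add_divide_distrib)
    also have "\<dots> = of_real (s ^ n * \<eta> x ?t + y x s * \<theta> x ?t)"
      using EJ[OF t x(2)] unfolding ax[OF x(1)] byx by simp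
    finally have YX: "?Ys / ?Xs = of_real (s ^ n * \<eta> x ?t + y x s * \<theta> x ?t)" .
    have "Re (?Ys / of_real (Re ?Xs)) = Re ?Ys / Re ?Xs" by (rule Re_divide_of_real)
    then have slope: "Re ?Ys / Re ?Xs = s ^ n * \<eta> x ?t + y x s * \<theta> x ?t"
      using YX Xr by (metis Re_complex_of_real)
    have d1: "((\<lambda>s. 1 - s / x) has_real_derivative - (1 / x)) (at s within ?S)"
      using x(1) by (auto intro!: derivative_eq_intros)
    have d2: "(W x has_real_derivative - (x * \<theta> x ?t) * W x ?t - (1 - ?t) ^ n * \<eta> x ?t) (at ?t within
        (\<lambda>s. 1 - s / x) ` ?S)"
      by (rule has_field_derivative_subset[OF Wd[OF t x(2)]]) (use seg[OF x(1)] in auto)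
    have "((\<lambda>s. W x (1 - s / x)) has_real_derivative
        (- (x * \<theta> x ?t) * W x ?t - (1 - ?t) ^ n * \<eta> x ?t) * - (1 / x)) (at s within ?S)"
      using DERIV_image_chain[OF d2 d1] unfolding o_def .
    then have "(y x has_real_derivative x ^ Suc n * ((- (x * \<theta> x ?t) * W x ?t - (1 - ?t) ^ n * \<eta> x ?t) *
        - (1 / x))) (at s within ?S)"
      unfolding y_def by (rule DERIV_cmult)
    moreover have "x ^ Suc n * ((- (x * \<theta> x ?t) * W x ?t - (1 - ?t) ^ n * \<eta> x ?t) * - (1 / x))
        = s ^ n * \<eta> x ?t + y x s * \<theta> x ?t"
      using x(1) by (simp add: y_def field_simps power_divide)
    ultimately have "(y x has_real_derivative Re ?Ys / Re ?Xs) (at s within ?S)" using slope by simp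
    then show "\<bar>s\<bar> \<le> \<rho> \<and> \<bar>y x s\<bar> \<le> \<rho> \<and> 0 < Re ?Xs \<and> (y x has_real_derivative Re ?Ys / Re ?Xs) (at s
        within ?S)"
      using sy2 Xp by simp
  qed
qed

section \<open>From the graph to the involution\<close>

text \<open>At a point outside one of the two intervals the corresponding filter is trivial, so its
  limit imposes no condition; at \<open>m\<close> both one-sided limits are available.\<close>

lemma has_real_derivative_glue:
  fixes f :: "real \<Rightarrow> real"
  assumes "a \<le> m" "m \<le> b"
    and left: "s \<le> m \<Longrightarrow> (f has_real_derivative D) (at s within {a..m})"
    and right: "m \<le> s \<Longrightarrow> (f has_real_derivative D) (at s within {m..b})"
  shows "(f has_real_derivative D) (at s within {a..b})"
proof -
  have un: "{a..b} = {a..m} \<union> {m..b}" using assms(1,2) by auto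
  have l: "((\<lambda>y. (f y - f s) / (y - s)) \<longlongrightarrow> D) (at s within {a..m})"
  proof (cases "s \<le> m")
    case True
    then show ?thesis using left by (simp add: has_field_derivative_iff)
  next
    case False
    then have "s \<notin> closure ({a..m} - {s})" using closure_mono[of "{a..m} - {s}" "{a..m}"] by auto
    then have "at s within {a..m} = bot" by (simp add: at_within_eq_bot_iff)
    then show ?thesis by simp
  qed
  have r: "((\<lambda>y. (f y - f s) / (y - s)) \<longlongrightarrow> D) (at s within {m..b})"
  proof (cases "m \<le> s")
    case True
    then show ?thesis using right by (simp add: has_field_derivative_iff)
  next
    case False
    then have "s \<notin> closure ({m..b} - {s})" using closure_mono[of "{m..b} - {s}" "{m..b}"] by auto
    then have "at s within {m..b} = bot" by (simp add: at_within_eq_bot_iff)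
    then show ?thesis by simp
  qed
  have "((\<lambda>y. (f y - f s) / (y - s)) \<longlongrightarrow> D) (at s within {a..b})"
    unfolding un at_within_union using l r by (rule filterlim_sup)
  then show ?thesis by (simp add: has_field_derivative_iff)
qed

text \<open>Near \<open>0\<close> the values lie in the right half-plane, where the principal
  logarithm is holomorphic and is real at positive real values.\<close>

lemma holomorphic_positive_root:
  assumes k: "\<kappa> holomorphic_on ball 0 \<epsilon>" and \<epsilon>: "0 < \<epsilon>" and l: "0 < l"
    and real: "\<And>z. z \<in> ball 0 \<epsilon> \<Longrightarrow> z \<in> \<real> \<Longrightarrow> \<kappa> z \<in> \<real>" and pos: "0 < Re (\<kappa> 0)"
  obtains r \<rho> where "0 < r" "r \<le> \<epsilon>" "\<rho> holomorphic_on ball 0 r" "\<And>z. z \<in> ball 0 r \<Longrightarrow> \<rho> z ^ l = \<kappa> z"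
    "\<And>z. z \<in> ball 0 r \<Longrightarrow> z \<in> \<real> \<Longrightarrow> \<rho> z \<in> \<real> \<and> 0 < Re (\<rho> z)"
proof -
  have "continuous_on (ball 0 \<epsilon>) (\<lambda>z. Re (\<kappa> z))"
    by (intro continuous_on_Re holomorphic_on_imp_continuous_on k)
  then have "open {z \<in> ball 0 \<epsilon>. Re (\<kappa> z) \<in> {0<..}}"
    using continuous_open_preimage[of "ball 0 \<epsilon>" "\<lambda>z. Re (\<kappa> z)" "{0<..}"] by (simp add: vimage_def Int_def)
  moreover have "0 \<in> {z \<in> ball 0 \<epsilon>. Re (\<kappa> z) \<in> {0<..}}" using pos \<epsilon> by simp
  ultimately have "\<exists>r>0. ball 0 r \<subseteq> {z \<in> ball 0 \<epsilon>. Re (\<kappa> z) \<in> {0<..}}"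
    unfolding open_contains_ball by blast
  then obtain r where r: "0 < r" "ball 0 r \<subseteq> {z \<in> ball 0 \<epsilon>. Re (\<kappa> z) \<in> {0<..}}" by blast
  then have sub: "ball 0 r \<subseteq> ball (0::complex) \<epsilon>" and kp: "\<And>z. z \<in> ball 0 r \<Longrightarrow> 0 < Re (\<kappa> z)" by auto
  define \<rho> where "\<rho> = (\<lambda>z. exp (Ln (\<kappa> z) / of_nat l))"
  show thesis
  proof (rule that[OF r(1), of \<rho>])
    show "r \<le> \<epsilon>" using sub r(1) by (simp add: ball_subset_ball_iff)
    show "\<rho> holomorphic_on ball 0 r"
      unfolding \<rho>_def using l kp
      by (intro holomorphic_intros holomorphic_on_subset[OF k sub]) (force simp: complex_nonpos_Reals_iff)+
    fix z :: complex assume z: "z \<in> ball 0 r"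
    have "\<kappa> z \<noteq> 0" using kp[OF z] by auto
    then show "\<rho> z ^ l = \<kappa> z" using l by (simp add: \<rho>_def flip: exp_of_nat_mult)
    assume "z \<in> \<real>"
    then obtain x where x: "\<kappa> z = of_real x" using real z sub by (meson Reals_cases subsetD)
    then have "0 < x" using kp[OF z] by simp
    then have "\<rho> z = of_real (exp (ln x / real l))"
      by (simp add: \<rho>_def x Ln_of_real flip: exp_of_real)
    then show "\<rho> z \<in> \<real> \<and> 0 < Re (\<rho> z)" by simp
  qed
qed

text \<open>The graph pieces over \<open>{t..0}\<close> and \<open>{0..x}\<close>, with
  \<open>t\<close> the value of \<open>\<tau>\<close> at \<open>x\<close>, are joined into one
  orbit. They meet because both crossing heights are minus the power \<open>Suc n\<close> of
  \<open>\<xi>\<close>, an even exponent, and \<open>\<xi>\<close> takes opposite values at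
  \<open>t\<close> and \<open>x\<close>.\<close>

lemma tangent_half_map:
  fixes cx cy :: "nat \<Rightarrow> nat \<Rightarrow> real"
  assumes cx: "bidisc_summable cx \<rho>" and cy: "bidisc_summable cy \<rho>"
    and zero: "\<And>k. k < n \<Longrightarrow> (deriv ^^ k) (\<lambda>z. double_series cy z 0) 0 = 0"
    and posY: "0 < Re ((deriv ^^ n) (\<lambda>z. double_series cy z 0) 0)" and posX: "0 < cx 0 0"
    and even: "even (Suc n)"
    and F: "\<And>x y. \<bar>x\<bar> \<le> \<rho> \<Longrightarrow> \<bar>y\<bar> \<le> \<rho> \<Longrightarrow> (x, y) \<in> U \<and>
      F (x, y) = (Re (double_series cx (of_real x) (of_real y)), Re (double_series cy (of_real x)
          (of_real y)))"
  obtains \<tau> \<epsilon> where "0 < \<epsilon>" "\<tau> holomorphic_on ball 0 \<epsilon>" "\<tau> 0 = 0"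
    "\<And>z. z \<in> ball 0 \<epsilon> \<Longrightarrow> z \<in> \<real> \<Longrightarrow> \<tau> z \<in> \<real>"
    "\<And>x. 0 < x \<Longrightarrow> x < \<epsilon> \<Longrightarrow> Re (\<tau> (of_real x)) < 0 \<and> half_return (\<lambda>v. v < 0) U F (Re (\<tau> (of_real x))) x
      \<and> \<tau> (\<tau> (of_real x)) = of_real x"
proof -
  obtain \<epsilon>0 \<kappa> y where \<epsilon>0: "0 < \<epsilon>0" and \<kappa>: "\<kappa> holomorphic_on ball 0 \<epsilon>0"
    "\<And>z. z \<in> ball 0 \<epsilon>0 \<Longrightarrow> z \<in> \<real> \<Longrightarrow> \<kappa> z \<in> \<real>" "\<And>x. \<bar>x\<bar> < \<epsilon>0 \<Longrightarrow> 0 < Re (\<kappa> (of_real x))"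
    and yd: "\<And>x s. x \<noteq> 0 \<Longrightarrow> \<bar>x\<bar> < \<epsilon>0 \<Longrightarrow> s \<in> {min 0 x..max 0 x} \<Longrightarrow>
      \<bar>s\<bar> \<le> \<rho> \<and> \<bar>y x s\<bar> \<le> \<rho> \<and> 0 < Re (double_series cx (of_real s) (of_real (y x s))) \<and>
      (y x has_real_derivative Re (double_series cy (of_real s) (of_real (y x s)))
        / Re (double_series cx (of_real s) (of_real (y x s)))) (at s within {min 0 x..max 0 x})"
    and yx: "\<And>x. x \<noteq> 0 \<Longrightarrow> \<bar>x\<bar> < \<epsilon>0 \<Longrightarrow> y x x = 0"
    and y0: "\<And>x. x \<noteq> 0 \<Longrightarrow> \<bar>x\<bar> < \<epsilon>0 \<Longrightarrow> y x 0 = - (x ^ Suc n * Re (\<kappa> (of_real x)))"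
    and yneg: "\<And>x s. x \<noteq> 0 \<Longrightarrow> \<bar>x\<bar> < \<epsilon>0 \<Longrightarrow> s \<in> {min 0 x..max 0 x} \<Longrightarrow> s \<noteq> x \<Longrightarrow> y x s < 0"
    by (rule tangent_graph[OF cx cy zero posY posX even]) (assumption | rule that | simp only:)+
  have k0: "0 < Re (\<kappa> 0)" using \<kappa>(3)[of 0] \<epsilon>0 by simp
  obtain r \<rho>t where r: "0 < r" "r \<le> \<epsilon>0" and rt: "\<rho>t holomorphic_on ball 0 r"
    "\<And>z. z \<in> ball 0 r \<Longrightarrow> \<rho>t z ^ Suc n = \<kappa> z"
    "\<And>z. z \<in> ball 0 r \<Longrightarrow> z \<in> \<real> \<Longrightarrow> \<rho>t z \<in> \<real> \<and> 0 < Re (\<rho>t z)"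
    using holomorphic_positive_root[OF \<kappa>(1) \<epsilon>0 zero_less_Suc \<kappa>(2) k0, of n] by blast
  \<comment> \<open>Chosen so that \<open>\<xi> z ^ Suc n = z ^ Suc n * \<kappa> z\<close>; the
    derivative at \<open>0\<close> is \<open>\<rho>t 0\<close>, which is positive, so
    \<open>\<xi>\<close> is a chart.\<close>
  define \<xi> where "\<xi> = (\<lambda>z. z * \<rho>t z)"
  have \<xi>h: "\<xi> holomorphic_on ball 0 r" unfolding \<xi>_def by (intro holomorphic_intros rt(1))
  have \<xi>0: "\<xi> 0 = 0" by (simp add: \<xi>_def)
  have \<xi>r: "\<xi> z \<in> \<real>" if "z \<in> ball 0 r" "z \<in> \<real>" for z
    unfolding \<xi>_def using rt(3)[OF that] that(2) by (intro Reals_mult) auto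
  have d\<xi>: "deriv \<xi> 0 \<noteq> 0"
  proof -
    have "(\<rho>t has_field_derivative deriv \<rho>t 0) (at 0)"
        using holomorphic_derivI[OF rt(1) open_ball, of 0] r by simp
    then have "(\<xi> has_field_derivative \<rho>t 0) (at 0)"
      unfolding \<xi>_def by (auto intro!: derivative_eq_intros)
    then show ?thesis using rt(3)[of 0] r(1) by (auto dest!: DERIV_imp_deriv)
  qed
  obtain g \<epsilon>1 \<delta> where g: "0 < \<epsilon>1" "\<epsilon>1 \<le> r" "0 < \<delta>" "g holomorphic_on ball 0 \<delta>" "g 0 = 0"
    "\<And>y. y \<in> ball 0 \<delta> \<Longrightarrow> g y \<in> ball 0 \<epsilon>1" "\<And>y. y \<in> ball 0 \<delta> \<Longrightarrow> \<xi> (g y) = y"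
    "\<And>z. z \<in> ball 0 \<epsilon>1 \<Longrightarrow> g (\<xi> z) = z" "\<And>y. y \<in> ball 0 \<delta> \<Longrightarrow> y \<in> \<real> \<Longrightarrow> g y \<in> \<real>"
    by (rule holomorphic_real_local_inverse[OF \<xi>h r(1) \<xi>0 d\<xi> \<xi>r]) (assumption | rule that | simp only:)+
  have "continuous_on (ball 0 r) \<xi>" using \<xi>h holomorphic_on_imp_continuous_on by blast
  \<comment> \<open>The radius is shrunk until \<open>- \<xi> z\<close> stays in the domain of the
    inverse chart \<open>g\<close>.\<close>
  then have "\<exists>d>0. \<forall>z\<in>ball 0 r. dist z 0 < d \<longrightarrow> dist (\<xi> z) (\<xi> 0) < \<delta>"
    unfolding continuous_on_iff using r(1) g(3) centre_in_ball by blast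
  then obtain d where d: "0 < d" "\<And>z. z \<in> ball 0 r \<Longrightarrow> norm z < d \<Longrightarrow> norm (\<xi> z) < \<delta>"
    using \<xi>0 by auto
  define \<epsilon> where "\<epsilon> = min d \<epsilon>1"
  have \<epsilon>: "0 < \<epsilon>" "\<epsilon> \<le> \<epsilon>1" "\<epsilon> \<le> r" "\<epsilon> \<le> \<epsilon>0" using d g r by (auto simp: \<epsilon>_def)
  have \<xi>b: "- \<xi> z \<in> ball 0 \<delta>" if "z \<in> ball 0 \<epsilon>" for z
  proof -
    have "z \<in> ball 0 r" "norm z < d" using that \<epsilon>(3) by (auto simp: \<epsilon>_def)
    then show ?thesis using d(2) by simp
  qed
  define \<tau> where "\<tau> = (\<lambda>z. g (- \<xi> z))"
  have \<tau>r: "\<tau> z \<in> \<real>" if "z \<in> ball 0 \<epsilon>" "z \<in> \<real>" for z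
    unfolding \<tau>_def using that \<epsilon> \<xi>b by (intro g(9) Reals_minus \<xi>r) auto
  show thesis
  proof (rule that[OF \<epsilon>(1), of \<tau>])
    show "\<tau> holomorphic_on ball 0 \<epsilon>"
      unfolding \<tau>_def
      by (rule holomorphic_on_compose_image[OF g(4)])
        (use \<xi>b \<epsilon> in \<open>auto intro!: holomorphic_intros holomorphic_on_subset[OF \<xi>h]\<close>)
    show "\<tau> 0 = 0" by (simp add: \<tau>_def \<xi>0 g(5))
    show "\<tau> z \<in> \<real>" if "z \<in> ball 0 \<epsilon>" "z \<in> \<real>" for z using \<tau>r that .
    fix x :: real assume x: "0 < x" "x < \<epsilon>"
    then have xb: "of_real x \<in> ball (0::complex) \<epsilon>" by simp
    define t where "t = Re (\<tau> (of_real x))"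
    have \<tau>t: "\<tau> (of_real x) = of_real t" using \<tau>r[OF xb] by (simp add: t_def)
    have tb: "of_real t \<in> ball (0::complex) \<epsilon>1" using g(6)[OF \<xi>b[OF xb]] by (simp add: \<tau>_def flip: \<tau>t)
    then have tr: "\<bar>t\<bar> < r" "\<bar>t\<bar> < \<epsilon>0" using g(2) r(2) by auto
    have xr: "\<bar>x\<bar> < r" "\<bar>x\<bar> < \<epsilon>0" using x \<epsilon> by auto
    have \<xi>t: "\<xi> (of_real t) = - \<xi> (of_real x)" using g(7)[OF \<xi>b[OF xb]] by (simp add: \<tau>_def flip: \<tau>t)
    define P where "P = (\<lambda>x. Re (\<rho>t (of_real x)))"
    have P: "\<rho>t (of_real x) = of_real (P x)" "0 < P x" if "\<bar>x\<bar> < r" for x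
      using rt(3)[of "of_real x"] that by (simp_all add: P_def)
    have "complex_of_real (t * P t) = of_real (- (x * P x))"
      using \<xi>t P(1)[OF tr(1)] P(1)[OF xr(1)] by (simp add: \<xi>_def)
    then have tP: "t * P t = - (x * P x)" by (simp only: of_real_eq_iff)
    have t0: "t < 0"
    proof (rule ccontr)
      assume "\<not> t < 0"
      then have "0 \<le> t * P t" using P(2)[OF tr(1)] by simp
      moreover have "0 < x * P x" using P(2)[OF xr(1)] x by simp
      ultimately show False using tP by simp
    qed
    have kP: "x ^ Suc n * Re (\<kappa> (of_real x)) = (x * P x) ^ Suc n" if "\<bar>x\<bar> < r" for x
    proof -
      have "\<kappa> (of_real x) = of_real (P x ^ Suc n)" using rt(2)[of "of_real x"] that P(1)[OF that] by simp
      then show ?thesis by (simp add: power_mult_distrib)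
    qed
    have eq0: "y t 0 = y x 0"
    proof -
      have "(t * P t) ^ Suc n = (x * P x) ^ Suc n" using even unfolding tP by (rule power_minus_even)
      then have "t ^ Suc n * Re (\<kappa> (of_real t)) = x ^ Suc n * Re (\<kappa> (of_real x))"
        unfolding kP[OF tr(1)] kP[OF xr(1)] .
      moreover have "t \<noteq> 0" "x \<noteq> 0" using t0 x by simp_all
      ultimately show ?thesis using y0[of t, OF _ tr(2)] y0[of x, OF _ xr(2)] by (simp only: simp_thms)
    qed
    \<comment> \<open>By \<open>eq0\<close> the two graphs agree at \<open>0\<close>, so
      \<open>Yg\<close> coincides with each of them on its closed interval.\<close>
    define Yg where "Yg = (\<lambda>s. if s \<le> 0 then y t s else y x s)"
    have Yl: "Yg s = y t s" if "s \<in> {t..0}" for s using that by (simp add: Yg_def)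
    have Yr: "Yg s = y x s" if "s \<in> {0..x}" for s using that eq0 by (auto simp: Yg_def)
    have ivl: "{min 0 t..max 0 t} = {t..0}" "{min 0 x..max 0 x} = {0..x}" using t0 x by auto
    note ydl = yd[of t, unfolded ivl] and ydr = yd[of x, unfolded ivl]
    let ?X = "\<lambda>s. Re (double_series cx (of_real s) (of_real (Yg s)))"
    let ?Y = "\<lambda>s. Re (double_series cy (of_real s) (of_real (Yg s)))"
    have b: "\<bar>s\<bar> \<le> \<rho> \<and> \<bar>Yg s\<bar> \<le> \<rho> \<and> 0 < ?X s" if "s \<in> {t..x}" for s
    proof (cases "s \<le> 0")
      case True
      then show ?thesis using ydl[of s] that t0 tr Yl[of s] by simp
    next
      case False
      then show ?thesis using ydr[of s] that x xr Yr[of s] by simp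
    qed
    have Yd: "(Yg has_real_derivative ?Y s / ?X s) (at s within {t..x})" if s: "s \<in> {t..x}" for s
    proof (rule has_real_derivative_glue[of t 0 x])
      show "t \<le> 0" "0 \<le> x" using t0 x by auto
      show "(Yg has_real_derivative ?Y s / ?X s) (at s within {t..0})" if "s \<le> 0"
        using has_field_derivative_transform_within[of "y t" "?Y s / ?X s" s "{t..0}" 1 Yg] ydl[of s] Yl
            s that t0 tr
        by simp
      show "(Yg has_real_derivative ?Y s / ?X s) (at s within {0..x})" if "0 \<le> s"
        using has_field_derivative_transform_within[of "y x" "?Y s / ?X s" s "{0..x}" 1 Yg] ydr[of s] Yr
            s that x xr
        by simp
    qed
    have Yc: "continuous_on {t..x} Yg"
      using Yd DERIV_continuous unfolding continuous_on_eq_continuous_within by blast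
    \<comment> \<open>Parametrised by the abscissa, the curve needs time \<open>1 / ?X s\<close> per
      unit, and positive horizontal velocity carries it from \<open>t\<close> to \<open>x\<close>.
      Thus \<open>\<tau>\<close> sends the end of the half-return to its start.\<close>
    have "half_return (\<lambda>v. v < 0) U F t x"
    proof (rule half_return_of_curve[of t x "\<lambda>s. (s, Yg s)" U "\<lambda>s. 1 / ?X s" F])
      show "t < x" using t0 x by simp
      show "(\<lambda>s. (s, Yg s)) ` {t..x} \<subseteq> U" using F b by auto
      show "((\<lambda>s. (s, Yg s)) has_vector_derivative (1 / ?X s) *\<^sub>R F (s, Yg s)) (at s within {t..x})"
        if "s \<in> {t..x}" for s
      proof -
        have "F (s, Yg s) = (?X s, ?Y s)" using F b[OF that] by simp
        then have "(1 / ?X s) *\<^sub>R F (s, Yg s) = (1, ?Y s / ?X s)" using b[OF that] by simp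
        moreover have "((\<lambda>s. (s, Yg s)) has_vector_derivative (1, ?Y s / ?X s)) (at s within {t..x})"
          using Yd[OF that] by (intro has_vector_derivative_Pair has_vector_derivative_id)
            (simp add: has_real_derivative_iff_has_vector_derivative)
        ultimately show ?thesis by simp
      qed
      have Xc: "continuous_on {t..x} ?X"
        by (intro continuous_on_Re holomorphic_bidisc_continuous[OF holomorphic_bidisc_double_series[OF
            cx]])
          (use b Yc in \<open>auto intro!: continuous_intros\<close>)
      show "continuous_on {t..x} (\<lambda>s. 1 / ?X s)"
      proof (intro continuous_on_divide continuous_on_const Xc ballI)
        show "?X s \<noteq> 0" if "s \<in> {t..x}" for s using b[OF that] by simp
      qed
      show "0 < 1 / ?X s" if "s \<in> {t..x}" for s using b[OF that] by simp
      show "(t, Yg t) = (t, 0)" using yx[of t] t0 tr by (simp add: Yg_def)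
      show "(x, Yg x) = (x, 0)" using yx[of x] x xr by (simp add: Yg_def)
      show "snd (s, Yg s) < 0" if "s \<in> {t<..<x}" for s
        using yneg[of t s] yneg[of x s] that t0 x tr xr unfolding ivl by (auto simp: Yg_def)
    qed
    moreover have "\<tau> (of_real t) = of_real x"
      using \<xi>t g(8)[of "of_real x"] xb \<epsilon>(2) by (simp add: \<tau>_def)
    ultimately show "Re (\<tau> (of_real x)) < 0 \<and> half_return (\<lambda>v. v < 0) U F (Re (\<tau> (of_real x))) x
      \<and> \<tau> (\<tau> (of_real x)) = of_real x" using t0 \<tau>t by simp
  qed
qed


subsection \<open>Expansion of the vector field at the origin\<close>

lemma bidisc_summable_mono:
  assumes "bidisc_summable c \<rho>" "0 < \<rho>'" "\<rho>' \<le> \<rho>"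
  shows "bidisc_summable c \<rho>'"
proof -
  have "(\<lambda>(i, j). \<bar>c i j\<bar> * \<rho> ^ i * \<rho> ^ j) summable_on UNIV"
      using assms(1) by (simp add: bidisc_summable_def)
  then have "(\<lambda>(i, j). \<bar>c i j\<bar> * \<rho>' ^ i * \<rho>' ^ j) summable_on UNIV"
    by (rule summable_on_comparison_test) (use assms(2,3) in \<open>auto intro!: mult_mono power_mono\<close>)
  then show ?thesis using assms(2) by (simp add: bidisc_summable_def)
qed

text \<open>Unordered summability of reals is absolute, so convergence at one corner, inside the
  given square, already controls the coefficients on a complex bidisc.\<close>

lemma real_analytic_on_expansion:
  assumes "real_analytic_on f U" "(a, b) \<in> U"
  obtains c \<rho> where "bidisc_summable c \<rho>"
    "\<And>h k. \<bar>h\<bar> \<le> \<rho> \<Longrightarrow> \<bar>k\<bar> \<le> \<rho> \<Longrightarrow>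
      complex_of_real (f (a + h, b + k)) = double_series c (of_real h) (of_real k)"
proof -
  obtain c r where r: "r > 0" and s: "\<And>h k. \<bar>h\<bar> < r \<Longrightarrow> \<bar>k\<bar> < r \<Longrightarrow>
      ((\<lambda>(i, j). c i j * h ^ i * k ^ j) has_sum f (a + h, b + k)) UNIV"
    using assms unfolding real_analytic_on_def by blast
  define \<rho> where "\<rho> = r / 2"
  have \<rho>: "0 < \<rho>" "\<rho> < r" using r by (auto simp: \<rho>_def)
  have "(\<lambda>(i, j). c i j * \<rho> ^ i * \<rho> ^ j) summable_on UNIV"
    using s[of \<rho> \<rho>] \<rho> summable_on_def by auto
  then have "(\<lambda>x. norm ((\<lambda>(i, j). c i j * \<rho> ^ i * \<rho> ^ j) x)) summable_on UNIV"
    by (rule iffD1[OF summable_on_iff_abs_summable_on_real])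
  then have c: "bidisc_summable c \<rho>"
    using \<rho>(1) by (simp add: bidisc_summable_def case_prod_unfold abs_mult power_abs)
  show thesis
  proof (rule that[OF c])
    fix h k assume hk: "\<bar>h\<bar> \<le> \<rho>" "\<bar>k\<bar> \<le> \<rho>"
    have "((\<lambda>(i, j). c i j * h ^ i * k ^ j) has_sum f (a + h, b + k)) UNIV"
      using hk \<rho>(2) by (intro s) auto
    from has_sum_bounded_linear[OF bounded_linear_of_real this]
    have "((\<lambda>(i, j). of_real (c i j) * complex_of_real h ^ i * of_real k ^ j) has_sum of_real (f (a + h,
        b + k))) UNIV"
      by (simp add: o_def case_prod_unfold)
    moreover have "((\<lambda>(i, j). of_real (c i j) * of_real h ^ i * of_real k ^ j) has_sum
        double_series c (of_real h) (of_real k)) UNIV"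
      by (rule double_series_has_sum[OF c]) (use hk in auto)
    ultimately show "complex_of_real (f (a + h, b + k)) = double_series c (of_real h) (of_real k)"
      by (rule has_sum_unique)
  qed
qed

text \<open>Each coordinate difference is at most the norm of the difference; hence the doubled
  constant of the complexified series.\<close>

lemma real_analytic_on_lipschitz:
  assumes "real_analytic_on f U" "p \<in> U"
  obtains r L where "0 < r" "0 < L" "\<And>q q'. q \<in> ball p r \<Longrightarrow> q' \<in> ball p r \<Longrightarrow> \<bar>f q - f q'\<bar> \<le> L * norm (q - q')"
proof -
  obtain a b where p: "p = (a, b)" by (cases p)
  obtain c \<rho> where c: "bidisc_summable c \<rho>" and f: "\<And>h k. \<bar>h\<bar> \<le> \<rho> \<Longrightarrow> \<bar>k\<bar> \<le> \<rho> \<Longrightarrow>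
      complex_of_real (f (a + h, b + k)) = double_series c (of_real h) (of_real k)"
    using real_analytic_on_expansion[OF assms[unfolded p]] by blast
  have \<rho>: "0 < \<rho>" using c by (simp add: bidisc_summable_def)
  obtain L where L: "0 < L" "\<And>z w z' w'. norm z \<le> \<rho> / 2 \<Longrightarrow> norm w \<le> \<rho> / 2 \<Longrightarrow> norm z' \<le> \<rho> / 2 \<Longrightarrow> norm w' \<le> \<rho> / 2
      \<Longrightarrow> norm (double_series c z w - double_series c z' w') \<le> L * (norm (z - z') + norm (w - w'))"
    using holomorphic_bidisc_lipschitz[OF holomorphic_bidisc_double_series[OF c] \<rho>] by blast
  show thesis
  proof (rule that[of "\<rho> / 2" "2 * L"])
    fix q q' assume q: "q \<in> ball p (\<rho> / 2)" "q' \<in> ball p (\<rho> / 2)"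
    have b: "\<bar>fst x - a\<bar> \<le> \<rho> / 2" "\<bar>snd x - b\<bar> \<le> \<rho> / 2" if "x \<in> ball p (\<rho> / 2)" for x
      using that dist_fst_le[of p x] dist_snd_le[of p x] by (auto simp: p dist_real_def abs_minus_commute)
    have e: "complex_of_real (f x) = double_series c (of_real (fst x - a)) (of_real (snd x - b))"
      if "x \<in> ball p (\<rho> / 2)" for x
      using f[of "fst x - a" "snd x - b"] b[OF that] \<rho> by simp
    have "\<bar>f q - f q'\<bar> = norm (complex_of_real (f q) - of_real (f q'))"
      by (metis norm_of_real of_real_diff)
    also have "\<dots> \<le> L * (norm (complex_of_real (fst q - a) - of_real (fst q' - a))
        + norm (complex_of_real (snd q - b) - of_real (snd q' - b)))"
      unfolding e[OF q(1)] e[OF q(2)] by (rule L(2))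
          (use b[OF q(1)] b[OF q(2)] in \<open>simp_all del: of_real_diff\<close>)
    also have "norm (complex_of_real (fst q - a) - of_real (fst q' - a)) = \<bar>fst (q - q')\<bar>"
      by (simp flip: of_real_diff)
    also have "norm (complex_of_real (snd q - b) - of_real (snd q' - b)) = \<bar>snd (q - q')\<bar>"
      by (simp flip: of_real_diff)
    also have "L * (\<bar>fst (q - q')\<bar> + \<bar>snd (q - q')\<bar>) \<le> L * (norm (q - q') + norm (q - q'))"
      using L(1) dist_fst_le[of q q'] dist_snd_le[of q q']
      by (intro mult_left_mono add_mono) (auto simp: dist_norm)
    finally show "\<bar>f q - f q'\<bar> \<le> 2 * L * norm (q - q')" by simp
  qed (use \<rho> L(1) in auto)
qed

lemma locally_lipschitz_vector_field:
  assumes X: "real_analytic_on X U" and Y: "real_analytic_on Y U"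
  shows "locally_lipschitz U (vector_field X Y)"
  unfolding locally_lipschitz_def
proof
  fix p assume p: "p \<in> U"
  obtain r1 L1 where 1: "0 < r1" "0 < L1" "\<And>q q'. q \<in> ball p r1 \<Longrightarrow> q' \<in> ball p r1 \<Longrightarrow> \<bar>X q - X q'\<bar> \<le> L1 *
      norm (q - q')"
    using real_analytic_on_lipschitz[OF X p] by blast
  obtain r2 L2 where 2: "0 < r2" "0 < L2" "\<And>q q'. q \<in> ball p r2 \<Longrightarrow> q' \<in> ball p r2 \<Longrightarrow> \<bar>Y q - Y q'\<bar> \<le> L2 *
      norm (q - q')"
    using real_analytic_on_lipschitz[OF Y p] by blast
  have "norm (vector_field X Y q - vector_field X Y q') \<le> (L1 + L2) * norm (q - q')"
    if "q \<in> ball p (min r1 r2)" "q' \<in> ball p (min r1 r2)" for q q'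
    using norm_Pair_le[of "X q - X q'" "Y q - Y q'"] 1(3)[of q q'] 2(3)[of q q'] that
    by (simp add: vector_field_def distrib_right)
  then show "\<exists>r>0. \<exists>L. \<forall>q\<in>ball p r. \<forall>q'\<in>ball p r. norm (vector_field X Y q - vector_field X Y q') \<le> L *
      norm (q - q')"
    using 1(1) 2(1) by (intro exI[of _ "min r1 r2"] conjI exI[of _ "L1 + L2"]) auto
qed

lemma analytic_field_expansion:
  assumes U: "open U" "(0, 0) \<in> U" and X: "real_analytic_on X U" and Y: "real_analytic_on Y U"
  obtains cx cy \<rho> where "bidisc_summable cx \<rho>" "bidisc_summable cy \<rho>"
    "\<And>x y. \<bar>x\<bar> \<le> \<rho> \<Longrightarrow> \<bar>y\<bar> \<le> \<rho> \<Longrightarrow> (x, y) \<in> U"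
    "\<And>x y. \<bar>x\<bar> \<le> \<rho> \<Longrightarrow> \<bar>y\<bar> \<le> \<rho> \<Longrightarrow> complex_of_real (X (x, y)) = double_series cx (of_real x) (of_real y)"
    "\<And>x y. \<bar>x\<bar> \<le> \<rho> \<Longrightarrow> \<bar>y\<bar> \<le> \<rho> \<Longrightarrow> complex_of_real (Y (x, y)) = double_series cy (of_real x) (of_real y)"
proof -
  obtain cx \<rho>x where x: "bidisc_summable cx \<rho>x" "\<And>h k. \<bar>h\<bar> \<le> \<rho>x \<Longrightarrow> \<bar>k\<bar> \<le> \<rho>x \<Longrightarrow>
      complex_of_real (X (0 + h, 0 + k)) = double_series cx (of_real h) (of_real k)"
    using real_analytic_on_expansion[OF X U(2)] by blast
  obtain cy \<rho>y where y: "bidisc_summable cy \<rho>y" "\<And>h k. \<bar>h\<bar> \<le> \<rho>y \<Longrightarrow> \<bar>k\<bar> \<le> \<rho>y \<Longrightarrow>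
      complex_of_real (Y (0 + h, 0 + k)) = double_series cy (of_real h) (of_real k)"
    using real_analytic_on_expansion[OF Y U(2)] by blast
  have "\<exists>e>0. ball (0, 0) e \<subseteq> U" using U unfolding open_contains_ball by blast
  then obtain e where e: "0 < e" "ball (0, 0) e \<subseteq> U" by blast
  \<comment> \<open>The norm of a point of the square is at most the sum of its coordinates in
    absolute value; a third of \<open>e\<close> keeps this sum below \<open>e\<close>.\<close>
  define \<rho> where "\<rho> = min (min \<rho>x \<rho>y) (e / 3)"
  have \<rho>: "0 < \<rho>" "\<rho> \<le> \<rho>x" "\<rho> \<le> \<rho>y" "\<rho> \<le> e / 3"
    using x(1) y(1) e(1) by (auto simp: \<rho>_def bidisc_summable_def)
  show thesis
  proof (rule that[of cx \<rho> cy])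
    show "bidisc_summable cx \<rho>" "bidisc_summable cy \<rho>"
      using bidisc_summable_mono[OF x(1)] bidisc_summable_mono[OF y(1)] \<rho> by auto
    fix h k :: real assume hk: "\<bar>h\<bar> \<le> \<rho>" "\<bar>k\<bar> \<le> \<rho>"
    have "norm (h, k) \<le> \<bar>h\<bar> + \<bar>k\<bar>" using norm_Pair_le[of h k] by simp
    moreover have "norm (- h, - k) = norm (h, k)" by (simp add: norm_Pair)
    ultimately have "(h, k) \<in> ball (0, 0) e" using hk \<rho>(4) e(1) by (simp add: dist_norm)
    then show "(h, k) \<in> U" using e(2) by blast
    show "complex_of_real (X (h, k)) = double_series cx (of_real h) (of_real k)"
      using x(2)[of h k] hk \<rho> by simp
    show "complex_of_real (Y (h, k)) = double_series cy (of_real h) (of_real k)"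
      using y(2)[of h k] hk \<rho> by simp
  qed
qed

section \<open>Derivatives on the axes and the eigenvalue condition\<close>

lemma has_real_derivative_Re:
  assumes "(f has_field_derivative D) (at (complex_of_real x))"
  shows "((\<lambda>x. Re (f (of_real x))) has_real_derivative Re D) (at x)"
  using bounded_linear.has_vector_derivative[OF bounded_linear_Re has_vector_derivative_real_field[OF
      assms]]
  by (simp add: has_real_derivative_iff_has_vector_derivative)

text \<open>The induction runs on the whole interval, since the next derivative needs the previous
  identity in a neighbourhood and not only at one point.\<close>

lemma real_higher_deriv:
  assumes g: "g holomorphic_on ball 0 \<rho>" and f: "\<And>x. \<bar>x\<bar> < \<rho> \<Longrightarrow> f x = Re (g (of_real x))"
    and x: "\<bar>x\<bar> < \<rho>"
  shows "(deriv ^^ k) f x = Re ((deriv ^^ k) g (of_real x))"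
  using x
proof (induction k arbitrary: x)
  case 0
  then show ?case using f by simp
next
  case (Suc k)
  have "((deriv ^^ k) g has_field_derivative deriv ((deriv ^^ k) g) (of_real x)) (at (of_real x))"
    using Suc.prems by (intro holomorphic_derivI[OF holomorphic_higher_deriv[OF g open_ball] open_ball])
        simp
  from has_real_derivative_Re[OF this]
  have "((deriv ^^ k) f has_real_derivative Re (deriv ((deriv ^^ k) g) (of_real x))) (at x)"
    by (rule has_field_derivative_transform_within_open[where S = "ball 0 \<rho>"])
      (use Suc in auto)
  then show ?case by (simp add: DERIV_imp_deriv)
qed

lemma double_series_deriv_fst:
  assumes c: "bidisc_summable c \<rho>"
  shows "((\<lambda>z. double_series c z 0) has_field_derivative of_real (c 1 0)) (at 0)"
proof -
  let ?h = "double_series (\<lambda>i j. c (Suc i) j)"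
  have \<rho>: "0 < \<rho>" using c by (simp add: bidisc_summable_def)
  have "(\<lambda>z. ?h z 0) holomorphic_on ball 0 \<rho>"
    by (rule holomorphic_bidisc_compose[OF holomorphic_bidisc_double_series[OF
        bidisc_summable_shift(1)[OF c]]])
      (use \<rho> in auto)
  from holomorphic_derivI[OF this open_ball, of 0]
  have "((\<lambda>z. of_real (c 0 0) + z * ?h z 0) has_field_derivative ?h 0 0) (at 0)"
    using \<rho> by (auto intro!: derivative_eq_intros)
  then have "((\<lambda>z. double_series c z 0) has_field_derivative ?h 0 0) (at 0)"
  proof (rule has_field_derivative_transform_within_open[where S = "ball 0 \<rho>"])
    show "of_real (c 0 0) + z * ?h z 0 = double_series c z 0" if "z \<in> ball 0 \<rho>" for z
      using double_series_shift[OF c, of z 0] that \<rho> by simp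
  qed (use \<rho> in auto)
  then show ?thesis using double_series_0[OF bidisc_summable_shift(1)[OF c]] by simp
qed

lemma double_series_deriv_snd:
  assumes c: "bidisc_summable c \<rho>"
  shows "((\<lambda>w. double_series c 0 w) has_field_derivative of_real (c 0 1)) (at 0)"
proof -
  let ?h = "double_series (\<lambda>i j. c i (Suc j))"
  have \<rho>: "0 < \<rho>" using c by (simp add: bidisc_summable_def)
  note c' = double_series_split_snd(1)[OF c]
  have "(\<lambda>w. ?h 0 w) holomorphic_on ball 0 \<rho>"
    by (rule holomorphic_bidisc_compose[OF holomorphic_bidisc_double_series[OF c']]) (use \<rho> in auto)
  from holomorphic_derivI[OF this open_ball, of 0]
  have "((\<lambda>w. double_series c 0 0 + w * ?h 0 w) has_field_derivative ?h 0 0) (at 0)"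
    using \<rho> by (auto intro!: derivative_eq_intros)
  then have "((\<lambda>w. double_series c 0 w) has_field_derivative ?h 0 0) (at 0)"
  proof (rule has_field_derivative_transform_within_open[where S = "ball 0 \<rho>"])
    show "double_series c 0 0 + w * ?h 0 w = double_series c 0 w" if "w \<in> ball 0 \<rho>" for w
      by (rule double_series_split_snd(2)[OF c, symmetric]) (use that \<rho> in auto)
  qed (use \<rho> in auto)
  then show ?thesis using double_series_0[OF c'] by simp
qed

lemma deriv_double_series_axes:
  assumes c: "bidisc_summable c \<rho>"
    and f: "\<And>x y. \<bar>x\<bar> \<le> \<rho> \<Longrightarrow> \<bar>y\<bar> \<le> \<rho> \<Longrightarrow> complex_of_real (f (x, y)) = double_series c (of_real x) (of_real y)"
  shows "deriv (\<lambda>x. f (x, 0)) 0 = c 1 0" "deriv (\<lambda>y. f (0, y)) 0 = c 0 1" "f (0, 0) = c 0 0"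
proof -
  have \<rho>: "0 < \<rho>" using c by (simp add: bidisc_summable_def)
  have f': "f (x, y) = Re (double_series c (of_real x) (of_real y))" if "\<bar>x\<bar> \<le> \<rho>" "\<bar>y\<bar> \<le> \<rho>" for x y
    using f[OF that] by (metis Re_complex_of_real)
  have "((\<lambda>x. Re (double_series c (of_real x) 0)) has_real_derivative c 1 0) (at 0)"
    using has_real_derivative_Re[of "\<lambda>z. double_series c z 0" "of_real (c 1 0)" 0]
        double_series_deriv_fst[OF c]
    by simp
  then have "((\<lambda>x. f (x, 0)) has_real_derivative c 1 0) (at 0)"
    by (rule has_field_derivative_transform_within_open[where S = "ball 0 \<rho>"]) (use \<rho> f' in auto)
  then show "deriv (\<lambda>x. f (x, 0)) 0 = c 1 0" by (rule DERIV_imp_deriv)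
  have "((\<lambda>y. Re (double_series c 0 (of_real y))) has_real_derivative c 0 1) (at 0)"
    using has_real_derivative_Re[of "\<lambda>z. double_series c 0 z" "of_real (c 0 1)" 0]
        double_series_deriv_snd[OF c]
    by simp
  then have "((\<lambda>y. f (0, y)) has_real_derivative c 0 1) (at 0)"
    by (rule has_field_derivative_transform_within_open[where S = "ball 0 \<rho>"]) (use \<rho> f' in auto)
  then show "deriv (\<lambda>y. f (0, y)) 0 = c 0 1" by (rule DERIV_imp_deriv)
  show "f (0, 0) = c 0 0" using f'[of 0 0] \<rho> double_series_0[OF c] by simp
qed

text \<open>The two rows of the eigenvector equation are combined so that each component of the
  eigenvector appears as a common factor; one of the components is nonzero.\<close>

lemma eigenvalue_2x2:
  fixes a b c d :: real
  assumes "eigenvalue (map_mat complex_of_real (mat_of_rows_list 2 [[a, b], [c, d]])) z"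
  shows "(z - of_real a) * (z - of_real d) = of_real (b * c)"
proof -
  let ?A = "map_mat complex_of_real (mat_of_rows_list 2 [[a, b], [c, d]])"
  have dim: "dim_row ?A = 2" by (simp add: mat_of_rows_list_def)
  obtain v where "eigenvector ?A v z" using assms unfolding eigenvalue_def by blast
  then have v: "v \<in> carrier_vec 2" "v \<noteq> 0\<^sub>v 2" "?A *\<^sub>v v = z \<cdot>\<^sub>v v"
    unfolding eigenvector_def dim by blast+
  have dv: "dim_vec v = 2" using v(1) by auto
  have "vec_index (?A *\<^sub>v v) 0 = of_real a * vec_index v 0 + of_real b * vec_index v 1"
    "vec_index (?A *\<^sub>v v) 1 = of_real c * vec_index v 0 + of_real d * vec_index v 1"
    using dv by (simp_all add: mat_of_rows_list_def scalar_prod_def row_def numeral_2_eq_2)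
  then have 1: "of_real a * vec_index v 0 + of_real b * vec_index v 1 = z * vec_index v 0"
    and 2: "of_real c * vec_index v 0 + of_real d * vec_index v 1 = z * vec_index v 1"
    using v(3) dv by auto
  have nz: "vec_index v 0 \<noteq> 0 \<or> vec_index v 1 \<noteq> 0"
  proof (rule ccontr)
    assume "\<not> ?thesis"
    then have "v = 0\<^sub>v 2" using dv by (intro eq_vecI) (auto simp: less_2_cases_iff)
    then show False using v(2) by simp
  qed
  have e1: "(z - of_real a) * vec_index v 0 = of_real b * vec_index v 1"
      using 1 by (simp add: algebra_simps)
  have e2: "(z - of_real d) * vec_index v 1 = of_real c * vec_index v 0"
      using 2 by (simp add: algebra_simps)
  have "((z - of_real a) * (z - of_real d)) * vec_index v 0 = (z - of_real d) * ((z - of_real a) *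
      vec_index v 0)" by simp
  also have "\<dots> = of_real b * ((z - of_real d) * vec_index v 1)" unfolding e1 by simp
  also have "\<dots> = of_real (b * c) * vec_index v 0" unfolding e2 by simp
  finally have f1: "((z - of_real a) * (z - of_real d)) * vec_index v 0 = of_real (b * c) * vec_index v 0" .
  have "((z - of_real a) * (z - of_real d)) * vec_index v 1 = (z - of_real a) * ((z - of_real d) *
      vec_index v 1)" by simp
  also have "\<dots> = of_real c * ((z - of_real a) * vec_index v 0)" unfolding e2 by simp
  also have "\<dots> = of_real (b * c) * vec_index v 1" unfolding e1 by simp
  finally show ?thesis using f1 nz by auto
qed

text \<open>Since \<open>\<beta> \<noteq> 0\<close>, the imaginary part of the characteristic
  equation forces \<open>\<alpha> = (a + d) / 2\<close>; by the real part the discriminant is then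
  \<open>- 4 * (\<beta> * \<beta>)\<close>.\<close>

lemma linear_focus_discriminant:
  assumes "linear_focus X Y"
    and J: "deriv (\<lambda>x. X (x, 0)) 0 = a" "deriv (\<lambda>y. X (0, y)) 0 = b"
      "deriv (\<lambda>x. Y (x, 0)) 0 = c" "deriv (\<lambda>y. Y (0, y)) 0 = d"
  shows "(a - d)\<^sup>2 + 4 * b * c < 0"
proof -
  obtain \<alpha> \<beta> where \<beta>: "\<beta> \<noteq> 0" and ev: "eigenvalue (map_mat complex_of_real (jacobian_at_origin X Y))
      (Complex \<alpha> \<beta>)"
    using assms(1) unfolding linear_focus_def by blast
  have "(Complex \<alpha> \<beta> - of_real a) * (Complex \<alpha> \<beta> - of_real d) = of_real (b * c)"
    using ev unfolding jacobian_at_origin_def J by (rule eigenvalue_2x2)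
  then have re: "(\<alpha> - a) * (\<alpha> - d) - \<beta> * \<beta> = b * c" and im: "(\<alpha> - a) * \<beta> + \<beta> * (\<alpha> - d) = 0"
    by (auto simp: complex_eq_iff)
  have "\<beta> * (2 * \<alpha> - a - d) = 0" using im by (simp add: algebra_simps)
  then have "\<alpha> = (a + d) / 2" using \<beta> by simp
  have "4 * b * c = 4 * ((\<alpha> - a) * (\<alpha> - d) - \<beta> * \<beta>)" using re by simp
  also have "\<dots> = - (a - d)\<^sup>2 - 4 * (\<beta> * \<beta>)"
    unfolding \<open>\<alpha> = (a + d) / 2\<close> by (simp add: power2_eq_square field_simps)
  finally have "(a - d)\<^sup>2 + 4 * b * c = - 4 * (\<beta> * \<beta>)" by simp
  moreover have "0 < \<beta> * \<beta>" using \<beta> not_real_square_gt_zero by blast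
  ultimately show ?thesis by linarith
qed


subsection \<open>Displacement function and Lyapunov constants\<close>

text \<open>The height starts at \<open>0\<close> and then has the sign of \<open>\<kappa>\<close>,
  so its initial derivative cannot have the opposite one. \<open>\<kappa>\<close> is
  \<open>1\<close> for upper and \<open>- 1\<close> for lower half-returns. This is how the
  direction of rotation becomes a condition on the field.\<close>

lemma half_return_initial_slope:
  assumes "half_return (\<lambda>v. 0 < \<kappa> * v) U (vector_field X Y) x y"
  shows "0 \<le> \<kappa> * Y (x, 0)"
proof -
  obtain \<gamma> T where \<gamma>: "orbit_arc U (vector_field X Y) \<gamma> T" "\<gamma> 0 = (x, 0)" "\<forall>t\<in>{0<..<T}. 0 < \<kappa> * snd (\<gamma> t)"
    using assms unfolding half_return_def by blast
  have T: "0 < T" and d: "\<forall>t\<in>{0..T}. (\<gamma> has_vector_derivative vector_field X Y (\<gamma> t)) (at t within {0..T})"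
    using \<gamma>(1) by (simp_all add: orbit_arc_def)
  have "(\<gamma> has_vector_derivative vector_field X Y (\<gamma> 0)) (at 0 within {0..T})"
    by (rule bspec[OF d]) (use T in simp)
  then have "((\<lambda>t. snd (\<gamma> t)) has_vector_derivative Y (x, 0)) (at 0 within {0..T})"
    using bounded_linear.has_vector_derivative[OF bounded_linear_snd] \<gamma>(2)
        by (fastforce simp: vector_field_def)
  then have "((\<lambda>t. \<kappa> * (snd (\<gamma> t) / t)) \<longlongrightarrow> \<kappa> * Y (x, 0)) (at_right 0)"
    using T \<gamma>(2) by (intro tendsto_mult tendsto_const)
      (simp add: has_field_derivative_iff at_within_Icc_at_right flip:
          has_real_derivative_iff_has_vector_derivative)
  moreover have "\<forall>\<^sub>F t in at_right 0. 0 \<le> \<kappa> * (snd (\<gamma> t) / t)"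
  proof (rule eventually_at_rightI[OF _ T])
    fix t assume t: "t \<in> {0<..<T}"
    then have "0 < \<kappa> * snd (\<gamma> t)" using \<gamma>(3) by blast
    then have "0 \<le> (\<kappa> * snd (\<gamma> t)) / t" using t by (intro divide_nonneg_pos) auto
    then show "0 \<le> \<kappa> * (snd (\<gamma> t) / t)" by simp
  qed
  ultimately show ?thesis by (rule tendsto_lowerbound) simp
qed

text \<open>Dividing by \<open>x ^ n\<close> leaves a continuous factor whose sign passes to the
  limit. From the left an odd power reverses the sign; so the second alternative asks for
  nonpositive values.\<close>

lemma leading_derivative_nonneg:
  assumes g: "g holomorphic_on ball 0 \<rho>" and \<rho>: "0 < \<rho>"
    and zero: "\<And>k. k < n \<Longrightarrow> (deriv ^^ k) g 0 = 0"
    and real: "\<And>z. z \<in> ball 0 \<rho> \<Longrightarrow> z \<in> \<real> \<Longrightarrow> g z \<in> \<real>"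
    and sign: "(\<exists>r>0. \<forall>x\<in>{0<..<r}. 0 \<le> Re (g (of_real x))) \<or>
      odd n \<and> (\<exists>r>0. \<forall>x\<in>{- r<..<0}. Re (g (of_real x)) \<le> 0)"
  shows "0 \<le> Re ((deriv ^^ n) g 0)"
proof -
  obtain e where e: "e holomorphic_on ball 0 \<rho>" "\<And>z. z \<in> ball 0 \<rho> \<Longrightarrow> g z = z ^ n * e z"
    "e 0 = (deriv ^^ n) g 0 / fact n"
    using holomorphic_factor_power[OF g \<rho> zero real] by blast
  define \<phi> where "\<phi> = (\<lambda>x. Re (e (of_real x)))"
  have gp: "Re (g (of_real x)) = x ^ n * \<phi> x" if "\<bar>x\<bar> < \<rho>" for x
    using e(2)[of "of_real x"] that by (simp add: \<phi>_def flip: of_real_power)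
  have "isCont \<phi> 0"
    unfolding \<phi>_def
    by (rule DERIV_isCont[OF has_real_derivative_Re[OF holomorphic_derivI[OF e(1) open_ball]]])
        (use \<rho> in simp)
  then have l: "(\<phi> \<longlongrightarrow> \<phi> 0) (at 0)" by (simp add: isCont_def)
  have "0 \<le> \<phi> 0"
    using sign
  proof
    assume "\<exists>r>0. \<forall>x\<in>{0<..<r}. 0 \<le> Re (g (of_real x))"
    then obtain r where r: "r > 0" "\<And>x. x \<in> {0<..<r} \<Longrightarrow> 0 \<le> Re (g (of_real x))" by blast
    have "\<forall>\<^sub>F x in at_right 0. 0 \<le> \<phi> x"
    proof (rule eventually_at_rightI[of 0 "min r \<rho>"])
      fix x assume x: "x \<in> {0<..<min r \<rho>}"
      then have "0 \<le> x ^ n * \<phi> x" using r(2)[of x] gp[of x] by simp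
      moreover have "0 < x ^ n" using x by simp
      ultimately show "0 \<le> \<phi> x" by (simp add: zero_le_mult_iff)
    qed (use r \<rho> in simp)
    moreover have "(\<phi> \<longlongrightarrow> \<phi> 0) (at_right 0)" using l by (rule filterlim_mono) (auto simp: at_le)
    ultimately show ?thesis by (intro tendsto_lowerbound[of \<phi>]) auto
  next
    assume *: "odd n \<and> (\<exists>r>0. \<forall>x\<in>{- r<..<0}. Re (g (of_real x)) \<le> 0)"
    then obtain r where r: "r > 0" "\<And>x. x \<in> {- r<..<0} \<Longrightarrow> Re (g (of_real x)) \<le> 0" by blast
    have "\<forall>\<^sub>F x in at_left 0. 0 \<le> \<phi> x"
    proof (rule eventually_at_leftI[of "- min r \<rho>"])
      fix x assume x: "x \<in> {- min r \<rho><..<0}"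
      then have "- r < x" "- x < \<rho>" "x < 0" by (auto simp: min_def split: if_splits)
      then have "x ^ n * \<phi> x \<le> 0" using r(2)[of x] gp[of x] by simp
      moreover have "x ^ n < 0" using x * by (simp add: power_less_zero_eq)
      ultimately show "0 \<le> \<phi> x" by (simp add: mult_le_0_iff)
    qed (use r \<rho> in simp)
    moreover have "(\<phi> \<longlongrightarrow> \<phi> 0) (at_left 0)" using l by (rule filterlim_mono) (auto simp: at_le)
    ultimately show ?thesis by (intro tendsto_lowerbound[of \<phi>]) auto
  qed
  moreover have "Re ((deriv ^^ n) g 0) = fact n * \<phi> 0"
  proof -
    have "(deriv ^^ n) g 0 = of_real (fact n) * e 0" using e(3) by simp
    then show ?thesis by (simp add: \<phi>_def)
  qed
  ultimately show ?thesis by simp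
qed

section \<open>Analytic half-return branches of the two subsystems\<close>

text \<open>The common form of the half-maps and their inverses: one germ valid on both sides of
  \<open>0\<close>, with reality on the axis so that real parts lose nothing.\<close>

definition analytic_branch :: "real \<Rightarrow> (complex \<Rightarrow> complex) \<Rightarrow> bool" where
  "analytic_branch \<epsilon> f \<longleftrightarrow> 0 < \<epsilon> \<and> f holomorphic_on ball 0 \<epsilon> \<and> f 0 = 0 \<and>
    (\<forall>z\<in>ball 0 \<epsilon>. z \<in> \<real> \<longrightarrow> f z \<in> \<real>)"

lemma analytic_branch_mono:
  assumes "analytic_branch \<epsilon> f" "0 < \<epsilon>'" "\<epsilon>' \<le> \<epsilon>"
  shows "analytic_branch \<epsilon>' f"
proof -
  have "ball 0 \<epsilon>' \<subseteq> ball (0::complex) \<epsilon>" using assms(3) by auto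
  then show ?thesis
    using assms unfolding analytic_branch_def by (auto intro: holomorphic_on_subset)
qed

lemma analytic_branch_real:
  assumes "analytic_branch \<epsilon> f" "\<bar>x\<bar> < \<epsilon>"
  shows "f (of_real x) = of_real (Re (f (of_real x)))"
  using assms unfolding analytic_branch_def by simp

lemma analytic_branch_deriv:
  assumes "analytic_branch \<epsilon> f" "\<bar>x\<bar> < \<epsilon>"
  shows "((\<lambda>x. Re (f (of_real x))) has_real_derivative Re (deriv f (of_real x))) (at x)"
  by (rule has_real_derivative_Re[OF holomorphic_derivI[OF _ open_ball[of 0 \<epsilon>]]])
    (use assms in \<open>auto simp: analytic_branch_def\<close>)

lemma analytic_branch_tendsto:
  assumes "analytic_branch \<epsilon> f"
  shows "((\<lambda>x. Re (f (of_real x))) \<longlongrightarrow> 0) (at_right 0)"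
proof -
  have "isCont (\<lambda>x. Re (f (of_real x))) 0"
    by (rule DERIV_isCont[OF analytic_branch_deriv[OF assms]])
        (use assms in \<open>simp add: analytic_branch_def\<close>)
  then have "((\<lambda>x. Re (f (of_real x))) \<longlongrightarrow> 0) (at 0)"
    using assms by (simp add: isCont_def analytic_branch_def)
  then show ?thesis by (rule filterlim_mono) (auto simp: at_le)
qed

text \<open>The eigenvalue condition makes the angular velocity definite but leaves its sign open;
  half-returns on one side decide it. The disjunction serves the upper subsystem, known for
  \<open>x > 0\<close>, and the lower one, known for \<open>x < 0\<close>. \<open>B\<close> is the
  local inverse of the half-map \<open>A\<close>.\<close>

lemma focus_branches:
  assumes U: "open U" "(0, 0) \<in> U" and X: "real_analytic_on X U" and Y: "real_analytic_on Y U"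
    and foc: "linear_focus X Y"
    and ccw: "(\<exists>r>0. \<forall>x\<in>{0<..<r}. \<exists>y. upper_half_return U (vector_field X Y) x y) \<or>
      (\<exists>r>0. \<forall>x\<in>{- r<..<0}. \<exists>y. lower_half_return U (vector_field X Y) x y)"
  obtains A B \<epsilon> where "analytic_branch \<epsilon> A" "analytic_branch \<epsilon> B"
    "\<And>x. 0 < x \<Longrightarrow> x < \<epsilon> \<Longrightarrow> upper_half_return U (vector_field X Y) x (Re (A (of_real x)))"
    "\<And>x. 0 < x \<Longrightarrow> x < \<epsilon> \<Longrightarrow> lower_half_return U (vector_field X Y) (Re (B (of_real x))) x"
    "\<And>x. 0 < x \<Longrightarrow> x < \<epsilon> \<Longrightarrow> A (B (of_real x)) = of_real x"
    "\<And>x. 0 < x \<Longrightarrow> x < \<epsilon> \<Longrightarrow> B (A (of_real x)) = of_real x"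
proof -
  let ?F = "vector_field X Y"
  obtain cx cy \<rho> where c: "bidisc_summable cx \<rho>" "bidisc_summable cy \<rho>"
    and box: "\<And>x y. \<bar>x\<bar> \<le> \<rho> \<Longrightarrow> \<bar>y\<bar> \<le> \<rho> \<Longrightarrow> (x, y) \<in> U"
    and Xc: "\<And>x y. \<bar>x\<bar> \<le> \<rho> \<Longrightarrow> \<bar>y\<bar> \<le> \<rho> \<Longrightarrow> complex_of_real (X (x, y)) = double_series cx (of_real x)
        (of_real y)"
    and Yc: "\<And>x y. \<bar>x\<bar> \<le> \<rho> \<Longrightarrow> \<bar>y\<bar> \<le> \<rho> \<Longrightarrow> complex_of_real (Y (x, y)) = double_series cy (of_real x)
        (of_real y)"
    by (rule analytic_field_expansion[OF U X Y]) (assumption | rule that | simp only:)+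
  have \<rho>: "0 < \<rho>" using c by (simp add: bidisc_summable_def)
  note dX = deriv_double_series_axes[OF c(1), of X, OF Xc] and dY = deriv_double_series_axes[OF c(2), of
      Y, OF Yc]
  have zero: "cx 0 0 = 0" "cy 0 0 = 0"
    using foc dX(3) dY(3) by (simp_all add: linear_focus_def)
  have disc: "(cx 1 0 - cy 0 1)\<^sup>2 + 4 * cx 0 1 * cy 1 0 < 0"
    by (rule linear_focus_discriminant[OF foc dX(1,2) dY(1,2)])
  have F: "(x, y) \<in> U \<and> ?F (x, y) = (Re (double_series cx (of_real x) (of_real y)), Re (double_series cy
      (of_real x) (of_real y)))"
    if "\<bar>x\<bar> \<le> \<rho>" "\<bar>y\<bar> \<le> \<rho>" for x y
    using box[OF that] Xc[OF that, symmetric] Yc[OF that, symmetric] by (simp add: vector_field_def)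
  have pos: "0 < cy 1 0"
  proof -
    let ?g = "\<lambda>z. double_series cy z 0"
    have hb: "holomorphic_bidisc \<rho> (double_series cy)" by (rule holomorphic_bidisc_double_series[OF c(2)])
    have gY: "Re (?g (of_real x)) = Y (x, 0)" if "\<bar>x\<bar> \<le> \<rho>" for x
      using Yc[of x 0] that \<rho> by (metis Re_complex_of_real abs_zero less_imp_le of_real_0)
    have "0 \<le> Re ((deriv ^^ 1) ?g 0)"
    proof (rule leading_derivative_nonneg)
      show "?g holomorphic_on ball 0 \<rho>" by (rule holomorphic_bidisc_compose[OF hb]) (use \<rho> in auto)
      show "(deriv ^^ k) ?g 0 = 0" if "k < 1" for k
        using that double_series_0[OF c(2)] zero by simp
      show "?g z \<in> \<real>" if "z \<in> ball 0 \<rho>" "z \<in> \<real>" for z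
        by (rule holomorphic_bidisc_real[OF hb]) (use that \<rho> in auto)
      show "(\<exists>r>0. \<forall>x\<in>{0<..<r}. 0 \<le> Re (?g (of_real x))) \<or>
          odd 1 \<and> (\<exists>r>0. \<forall>x\<in>{- r<..<0}. Re (?g (of_real x)) \<le> 0)"
        using ccw
      proof
        assume "\<exists>r>0. \<forall>x\<in>{0<..<r}. \<exists>y. upper_half_return U ?F x y"
        then obtain r where r: "r > 0" "\<And>x. x \<in> {0<..<r} \<Longrightarrow> \<exists>y. upper_half_return U ?F x y" by blast
        have "0 \<le> Re (?g (of_real x))" if "x \<in> {0<..<min r \<rho>}" for x
          using r(2)[of x] that half_return_initial_slope[of 1 U X Y x] gY[of x]
          by (auto simp: upper_half_return_iff)
        then show ?thesis using r(1) \<rho> by (intro disjI1 exI[of _ "min r \<rho>"]) auto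
      next
        assume "\<exists>r>0. \<forall>x\<in>{- r<..<0}. \<exists>y. lower_half_return U ?F x y"
        then obtain r where r: "r > 0" "\<And>x. x \<in> {- r<..<0} \<Longrightarrow> \<exists>y. lower_half_return U ?F x y" by blast
        have "Re (?g (of_real x)) \<le> 0" if x: "x \<in> {- min r \<rho><..<0}" for x
        proof -
          have "- r < x" "- x < \<rho>" "x < 0" using x by (auto simp: min_def split: if_splits)
          then show ?thesis
            using r(2)[of x] half_return_initial_slope[of "- 1" U X Y x] gY[of x]
            by (auto simp: lower_half_return_iff)
        qed
        then show ?thesis using r(1) \<rho> by (intro disjI2 conjI exI[of _ "min r \<rho>"]) auto
      qed
    qed (rule \<rho>)
    then have "0 \<le> cy 1 0" using DERIV_imp_deriv[OF double_series_deriv_fst[OF c(2)]] by simp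
    \<comment> \<open>If this coefficient were zero, the discriminant would be a square.\<close>
    moreover have "cy 1 0 \<noteq> 0" using disc by (auto simp: not_less)
    ultimately show ?thesis by simp
  qed
  obtain A \<epsilon>0 where \<epsilon>0: "0 < \<epsilon>0" and A: "A holomorphic_on ball 0 \<epsilon>0" "A 0 = 0" "deriv A 0 \<noteq> 0"
    "\<And>z. z \<in> ball 0 \<epsilon>0 \<Longrightarrow> z \<in> \<real> \<Longrightarrow> A z \<in> \<real>"
    and up: "\<And>x. 0 < x \<Longrightarrow> x < \<epsilon>0 \<Longrightarrow> Re (A (of_real x)) < 0 \<and> half_return (\<lambda>v. v > 0) U ?F x (Re (A
        (of_real x)))"
    and lo: "\<And>x. - \<epsilon>0 < x \<Longrightarrow> x < 0 \<Longrightarrow> 0 < Re (A (of_real x)) \<and> half_return (\<lambda>v. v < 0) U ?F x (Re (A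
        (of_real x)))"
    by (rule focus_half_map[OF c zero disc pos F]) (assumption | rule that | simp only:)+
  obtain B \<epsilon>1 \<delta> where B: "0 < \<epsilon>1" "\<epsilon>1 \<le> \<epsilon>0" "0 < \<delta>" "B holomorphic_on ball 0 \<delta>" "B 0 = 0"
    "\<And>y. y \<in> ball 0 \<delta> \<Longrightarrow> B y \<in> ball 0 \<epsilon>1" "\<And>y. y \<in> ball 0 \<delta> \<Longrightarrow> A (B y) = y"
    "\<And>z. z \<in> ball 0 \<epsilon>1 \<Longrightarrow> B (A z) = z" "\<And>y. y \<in> ball 0 \<delta> \<Longrightarrow> y \<in> \<real> \<Longrightarrow> B y \<in> \<real>"
    by (rule holomorphic_real_local_inverse[OF A(1) \<epsilon>0 A(2,3,4)]) (assumption | rule that | simp only:)+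
  define \<epsilon> where "\<epsilon> = min \<epsilon>1 \<delta>"
  have \<epsilon>: "0 < \<epsilon>" "\<epsilon> \<le> \<epsilon>1" "\<epsilon> \<le> \<delta>" "\<epsilon> \<le> \<epsilon>0" using B(1-3) by (auto simp: \<epsilon>_def)
  have aA: "analytic_branch \<epsilon>0 A" using \<epsilon>0 A by (simp add: analytic_branch_def)
  have aB: "analytic_branch \<delta> B" using B by (simp add: analytic_branch_def)
  show thesis
  proof (rule that[of \<epsilon> A B])
    show "analytic_branch \<epsilon> A" "analytic_branch \<epsilon> B"
      using analytic_branch_mono[OF aA] analytic_branch_mono[OF aB] \<epsilon> by auto
    fix x assume x: "0 < x" "x < \<epsilon>"
    show "upper_half_return U ?F x (Re (A (of_real x)))"
      using up[of x] x \<epsilon> by (simp add: upper_half_return_iff)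
    have xb: "of_real x \<in> ball (0::complex) \<delta>" "of_real x \<in> ball (0::complex) \<epsilon>1" using x \<epsilon> by auto
    show AB: "A (B (of_real x)) = of_real x" using B(7)[OF xb(1)] .
    show "B (A (of_real x)) = of_real x" using B(8)[OF xb(2)] .
    define t where "t = Re (B (of_real x))"
    have Bt: "B (of_real x) = of_real t" using B(9)[OF xb(1)] by (simp add: t_def)
    have tb: "\<bar>t\<bar> < \<epsilon>0" using B(6)[OF xb(1)] B(2) by (simp add: Bt)
    have At: "Re (A (of_real t)) = x" using AB by (simp add: Bt)
    \<comment> \<open>\<open>A\<close> fixes \<open>0\<close> and maps small positive points to
      negative ones, so a positive value can only come from a negative point.\<close>
    have "t < 0"
    proof (rule ccontr)
      assume "\<not> t < 0"
      then consider "t = 0" | "0 < t" by linarith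
      then show False
        by cases (use At A(2) x up[of t] tb in auto)
    qed
    then show "lower_half_return U ?F (Re (B (of_real x))) x"
      using lo[of t] tb At x by (simp add: lower_half_return_iff Bt)
  qed
qed

lemma tangent_branch:
  assumes U: "open U" "(0, 0) \<in> U" and X: "real_analytic_on X U" and Y: "real_analytic_on Y U"
    and tan: "invisible_tangent_lower X Y l"
    and ccw: "\<exists>r>0. \<forall>x\<in>{- r<..<0}. \<exists>y. lower_half_return U (vector_field X Y) x y"
  obtains \<tau> \<epsilon> where "analytic_branch \<epsilon> \<tau>"
    "\<And>x. 0 < x \<Longrightarrow> x < \<epsilon> \<Longrightarrow> lower_half_return U (vector_field X Y) (Re (\<tau> (of_real x))) x"
    "\<And>x. 0 < x \<Longrightarrow> x < \<epsilon> \<Longrightarrow> \<tau> (\<tau> (of_real x)) = of_real x"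
proof -
  let ?F = "vector_field X Y"
  obtain cx cy \<rho> where c: "bidisc_summable cx \<rho>" "bidisc_summable cy \<rho>"
    and box: "\<And>x y. \<bar>x\<bar> \<le> \<rho> \<Longrightarrow> \<bar>y\<bar> \<le> \<rho> \<Longrightarrow> (x, y) \<in> U"
    and Xc: "\<And>x y. \<bar>x\<bar> \<le> \<rho> \<Longrightarrow> \<bar>y\<bar> \<le> \<rho> \<Longrightarrow> complex_of_real (X (x, y)) = double_series cx (of_real x)
        (of_real y)"
    and Yc: "\<And>x y. \<bar>x\<bar> \<le> \<rho> \<Longrightarrow> \<bar>y\<bar> \<le> \<rho> \<Longrightarrow> complex_of_real (Y (x, y)) = double_series cy (of_real x)
        (of_real y)"
    by (rule analytic_field_expansion[OF U X Y]) (assumption | rule that | simp only:)+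
  have \<rho>: "0 < \<rho>" using c by (simp add: bidisc_summable_def)
  have F: "(x, y) \<in> U \<and> ?F (x, y) = (Re (double_series cx (of_real x) (of_real y)), Re (double_series cy
      (of_real x) (of_real y)))"
    if "\<bar>x\<bar> \<le> \<rho>" "\<bar>y\<bar> \<le> \<rho>" for x y
    using box[OF that] Xc[OF that, symmetric] Yc[OF that, symmetric] by (simp add: vector_field_def)
  let ?g = "\<lambda>z. double_series cy z 0"
  have hb: "holomorphic_bidisc \<rho> (double_series cy)" by (rule holomorphic_bidisc_double_series[OF c(2)])
  have gh: "?g holomorphic_on ball 0 \<rho>" by (rule holomorphic_bidisc_compose[OF hb]) (use \<rho> in auto)
  have gr: "?g z \<in> \<real>" if "z \<in> ball 0 \<rho>" "z \<in> \<real>" for z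
    by (rule holomorphic_bidisc_real[OF hb]) (use that \<rho> in auto)
  have gY: "Y (x, 0) = Re (?g (of_real x))" if "\<bar>x\<bar> < \<rho>" for x
    using Yc[of x 0] that \<rho> by (metis Re_complex_of_real abs_zero less_imp_le of_real_0)
  \<comment> \<open>Transfers the tangency conditions, stated for real derivatives, to the
    complexified restriction to the axis.\<close>
  have dg: "(deriv ^^ k) ?g 0 = of_real ((deriv ^^ k) (\<lambda>x. Y (x, 0)) 0)" for k
  proof -
    have "(deriv ^^ k) ?g 0 \<in> \<real>" using higher_deriv_in_Reals[OF gh gr, of 0 k] \<rho> by simp
    moreover have "(deriv ^^ k) (\<lambda>x. Y (x, 0)) 0 = Re ((deriv ^^ k) ?g 0)"
      using real_higher_deriv[OF gh gY, of 0 k] \<rho> by simp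
    ultimately show ?thesis by simp
  qed
  define n where "n = 2 * l - 1"
  have l: "1 \<le> l" and Yz: "\<And>k. k \<le> 2 * l - 2 \<Longrightarrow> (deriv ^^ k) (\<lambda>x. Y (x, 0)) 0 = 0"
    and XY: "0 < X (0, 0) * (deriv ^^ n) (\<lambda>x. Y (x, 0)) 0"
    using tan by (auto simp: invisible_tangent_lower_def n_def)
  have zero: "(deriv ^^ k) ?g 0 = 0" if "k < n" for k
    using Yz[of k] that l by (simp add: dg n_def)
  have odd: "odd n" "even (Suc n)" using l by (auto simp: n_def)
  have X0: "X (0, 0) = cx 0 0" by (rule deriv_double_series_axes(3)[OF c(1), of X, OF Xc])
  have nn: "0 \<le> Re ((deriv ^^ n) ?g 0)"
  proof (rule leading_derivative_nonneg[OF gh \<rho> zero gr])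
    obtain r where r: "r > 0" "\<And>x. x \<in> {- r<..<0} \<Longrightarrow> \<exists>y. lower_half_return U ?F x y" using ccw by blast
    have "Re (?g (of_real x)) \<le> 0" if x: "x \<in> {- min r \<rho><..<0}" for x
    proof -
      have "- r < x" "- x < \<rho>" "x < 0" using x by (auto simp: min_def split: if_splits)
      then show ?thesis
        using r(2)[of x] half_return_initial_slope[of "- 1" U X Y x] gY[of x]
        by (auto simp: lower_half_return_iff)
    qed
    then show "(\<exists>r>0. \<forall>x\<in>{0<..<r}. 0 \<le> Re (?g (of_real x))) \<or>
        odd n \<and> (\<exists>r>0. \<forall>x\<in>{- r<..<0}. Re (?g (of_real x)) \<le> 0)"
      using r(1) \<rho> odd by (intro disjI2 conjI exI[of _ "min r \<rho>"]) auto
  qed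
  \<comment> \<open>Invisibility only makes the product of the two factors positive;
    counterclockwise rotation makes the derivative nonnegative, so both are positive.\<close>
  have posY: "0 < Re ((deriv ^^ n) ?g 0)" and posX: "0 < cx 0 0"
    using nn XY unfolding dg X0 by (auto simp: zero_less_mult_iff)
  obtain \<tau> \<epsilon> where \<tau>: "0 < \<epsilon>" "\<tau> holomorphic_on ball 0 \<epsilon>" "\<tau> 0 = 0"
    "\<And>z. z \<in> ball 0 \<epsilon> \<Longrightarrow> z \<in> \<real> \<Longrightarrow> \<tau> z \<in> \<real>"
    and h: "\<And>x. 0 < x \<Longrightarrow> x < \<epsilon> \<Longrightarrow> Re (\<tau> (of_real x)) < 0 \<and> half_return (\<lambda>v. v < 0) U ?F (Re (\<tau> (of_real x))) x
      \<and> \<tau> (\<tau> (of_real x)) = of_real x"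
    by (rule tangent_half_map[OF c zero posY posX odd(2) F]) (assumption | rule that | simp only:)+
  show thesis
  proof (rule that[of \<epsilon> \<tau>])
    show "analytic_branch \<epsilon> \<tau>" using \<tau> by (simp add: analytic_branch_def)
    show "lower_half_return U ?F (Re (\<tau> (of_real x))) x" "\<tau> (\<tau> (of_real x)) = of_real x"
      if "0 < x" "x < \<epsilon>" for x using h[OF that] that by (auto simp: lower_half_return_iff)
  qed
qed

section \<open>Lyapunov constants as Taylor coefficients\<close>

text \<open>Uniqueness of end points evaluates \<open>THE\<close>, and uniqueness of starting points
  evaluates \<open>inv_into\<close>. The values \<open>p 0\<close> and \<open>q 0\<close> are
  unconstrained, hence the separate case \<open>x = 0\<close>.\<close>

lemma displacement_eq:
  assumes lip: "locally_lipschitz U F\<^sub>p" "locally_lipschitz U F\<^sub>m"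
    and up: "\<And>x. 0 < x \<Longrightarrow> x < \<epsilon> \<Longrightarrow> upper_half_return U F\<^sub>p x (p x)"
    and lo: "\<And>x. 0 < x \<Longrightarrow> x < \<epsilon> \<Longrightarrow> lower_half_return U F\<^sub>m (q x) x"
    and x: "0 \<le> x" "x < \<epsilon>"
  shows "x \<in> dom_upper U F\<^sub>p" "x \<in> lower_map U F\<^sub>m ` dom_lower U F\<^sub>m"
    "displacement U F\<^sub>p F\<^sub>m x = (if x = 0 then 0 else q x - p x)"
proof -
  have lm: "lower_map U F\<^sub>m z = y" if "lower_half_return U F\<^sub>m z y" for z y
  proof -
    have "z \<noteq> 0" using that by (simp add: lower_half_return_iff)
    moreover have "(THE y. lower_half_return U F\<^sub>m z y) = y"
      using that half_return_unique_end[OF lip(2), of "\<lambda>v. v < 0"]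
      by (intro the_equality) (auto simp: lower_half_return_iff)
    ultimately show ?thesis by (simp add: lower_map_def)
  qed
  have um: "upper_map U F\<^sub>p z = y" if "upper_half_return U F\<^sub>p z y" for z y
  proof -
    have "z \<noteq> 0" using that by (simp add: upper_half_return_iff)
    moreover have "(THE y. upper_half_return U F\<^sub>p z y) = y"
      using that half_return_unique_end[OF lip(1), of "\<lambda>v. v > 0"]
      by (intro the_equality) (auto simp: upper_half_return_iff)
    ultimately show ?thesis by (simp add: upper_map_def)
  qed
  have inj: "inj_on (lower_map U F\<^sub>m) (dom_lower U F\<^sub>m)"
  proof (rule inj_onI)
    fix z z' assume z: "z \<in> dom_lower U F\<^sub>m" "z' \<in> dom_lower U F\<^sub>m" "lower_map U F\<^sub>m z = lower_map U F\<^sub>m z'"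
    \<comment> \<open>The value \<open>0\<close> at the artificial point \<open>0\<close> is
      separated from the positive ends of genuine half-returns, so adjoining the origin keeps the
      map injective.\<close>
    have cs: "v = 0 \<and> lower_map U F\<^sub>m v = 0 \<or> lower_half_return U F\<^sub>m v (lower_map U F\<^sub>m v) \<and> 0 <
        lower_map U F\<^sub>m v"
      if v: "v \<in> dom_lower U F\<^sub>m" for v
    proof (cases "v = 0")
      case True
      then show ?thesis by (simp add: lower_map_def)
    next
      case False
      then obtain y where y: "lower_half_return U F\<^sub>m v y" using v by (auto simp: dom_lower_def)
      then have "0 < y" by (simp add: lower_half_return_def)
      then show ?thesis using y lm[OF y] by simp
    qed
    show "z = z'"
      using cs[OF z(1)] cs[OF z(2)] z(3) half_return_unique_start[OF lip(2), of "\<lambda>v. v < 0"]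
      by (auto simp: lower_half_return_iff)
  qed
  have main: "x \<in> dom_upper U F\<^sub>p \<and> x \<in> lower_map U F\<^sub>m ` dom_lower U F\<^sub>m \<and>
    displacement U F\<^sub>p F\<^sub>m x = (if x = 0 then 0 else q x - p x)"
  proof (cases "x = 0")
    case True
    have d: "0 \<in> dom_lower U F\<^sub>m" "lower_map U F\<^sub>m 0 = 0" by (auto simp: dom_lower_def lower_map_def)
    have "inv_into (dom_lower U F\<^sub>m) (lower_map U F\<^sub>m) 0 = 0"
      using inv_into_f_f[OF inj d(1)] d(2) by simp
    then show ?thesis using True d by (force simp: displacement_def dom_upper_def upper_map_def)
  next
    case False
    then have x': "0 < x" using x by simp
    have d: "q x \<in> dom_lower U F\<^sub>m" "lower_map U F\<^sub>m (q x) = x"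
      using lo[OF x' x(2)] lm by (auto simp: dom_lower_def)
    have "inv_into (dom_lower U F\<^sub>m) (lower_map U F\<^sub>m) x = q x"
      using inv_into_f_f[OF inj d(1)] d(2) by simp
    moreover have "upper_map U F\<^sub>p x = p x" using um up[OF x' x(2)] by simp
    moreover have "x \<in> dom_upper U F\<^sub>p" using up[OF x' x(2)] by (auto simp: dom_upper_def)
    ultimately show ?thesis using False d by (force simp: displacement_def)
  qed
  then show "x \<in> dom_upper U F\<^sub>p" "x \<in> lower_map U F\<^sub>m ` dom_lower U F\<^sub>m"
    "displacement U F\<^sub>p F\<^sub>m x = (if x = 0 then 0 else q x - p x)" by blast+
qed

text \<open>After division by \<open>x ^ Suc n\<close> the constant term is
  \<open>V (Suc n)\<close>. The leading constant is thus read off from the displacement itself,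
  which connects an expansion known only to exist with the constructed branches.\<close>

lemma power_series_leading_limit:
  fixes V :: "nat \<Rightarrow> real"
  assumes s: "\<And>x. 0 < x \<Longrightarrow> x < r \<Longrightarrow> (\<lambda>k. V (Suc k) * x ^ Suc k) sums f x" and r: "0 < r"
    and zero: "\<And>i. 1 \<le> i \<Longrightarrow> i \<le> n \<Longrightarrow> V i = 0"
  shows "((\<lambda>x. f x / x ^ Suc n) \<longlongrightarrow> V (Suc n)) (at_right 0)"
proof -
  define a where "a = (\<lambda>k. V (Suc (k + n)))"
  have sa: "(\<lambda>k. a k * x ^ k) sums (f x / x ^ Suc n)" if x: "0 < x" "x < r" for x
  proof -
    have "(\<Sum>k<n. V (Suc k) * x ^ Suc k) = 0" by (rule sum.neutral) (use zero in auto)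
    then have "(\<lambda>k. V (Suc (k + n)) * x ^ Suc (k + n)) sums f x"
      using sums_iff_shift[of "\<lambda>k. V (Suc k) * x ^ Suc k" n "f x"] s[OF x] by simp
    then have "(\<lambda>k. V (Suc (k + n)) * x ^ Suc (k + n) / x ^ Suc n) sums (f x / x ^ Suc n)"
      by (rule sums_divide)
    then show ?thesis using x(1) by (simp add: a_def power_add)
  qed
  define G where "G = (\<lambda>x. \<Sum>k. a k * x ^ k)"
  have sm: "summable (\<lambda>k. a k * (r / 2) ^ k)" using sa[of "r / 2"] r sums_summable by auto
  have "(G \<longlongrightarrow> a 0) (at 0)"
  proof (rule powser_limit_0[of "r / 2"])
    show "(\<lambda>n. a n * x ^ n) sums G x" if "norm x < r / 2" for x
      unfolding G_def using powser_inside[OF sm, of x] that r by (simp add: summable_sums)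
  qed (use r in simp)
  then have "(G \<longlongrightarrow> a 0) (at_right 0)" by (rule filterlim_mono) (auto simp: at_le)
  then have "((\<lambda>x. f x / x ^ Suc n) \<longlongrightarrow> a 0) (at_right 0)"
  proof (rule Lim_transform_eventually)
    show "\<forall>\<^sub>F x in at_right 0. G x = f x / x ^ Suc n"
      by (rule eventually_at_rightI[OF _ r]) (use sa in \<open>auto simp: G_def sums_iff\<close>)
  qed
  then show ?thesis by (simp add: a_def)
qed

definition taylor_difference :: "(complex \<Rightarrow> complex) \<Rightarrow> (complex \<Rightarrow> complex) \<Rightarrow> nat \<Rightarrow> real" where
  "taylor_difference B A k = Re ((deriv ^^ k) (\<lambda>z. B z - A z) 0 / fact k)"

lemma lyapunov_constants_branches:
  assumes lip: "locally_lipschitz U F\<^sub>p" "locally_lipschitz U F\<^sub>m"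
    and A: "analytic_branch \<epsilon> A" and B: "analytic_branch \<epsilon> B"
    and up: "\<And>x. 0 < x \<Longrightarrow> x < \<epsilon> \<Longrightarrow> upper_half_return U F\<^sub>p x (Re (A (of_real x)))"
    and lo: "\<And>x. 0 < x \<Longrightarrow> x < \<epsilon> \<Longrightarrow> lower_half_return U F\<^sub>m (Re (B (of_real x))) x"
  shows "lyapunov_constants U F\<^sub>p F\<^sub>m (taylor_difference B A)"
  unfolding lyapunov_constants_def
proof (intro exI[of _ \<epsilon>] conjI ballI)
  show \<epsilon>: "0 < \<epsilon>" using A by (simp add: analytic_branch_def)
  fix x assume x: "x \<in> {0..<\<epsilon>}"
  show "x \<in> dom_upper U F\<^sub>p" "x \<in> lower_map U F\<^sub>m ` dom_lower U F\<^sub>m"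
    using displacement_eq(1,2)[OF lip up lo, of \<epsilon> x] x by auto
  let ?D = "\<lambda>z. B z - A z"
  have "?D holomorphic_on ball 0 \<epsilon>" using A B by (auto simp: analytic_branch_def intro!: holomorphic_intros)
  from holomorphic_power_series[OF this, of "of_real x"]
  have "(\<lambda>k. (deriv ^^ k) ?D 0 / fact k * of_real x ^ k) sums ?D (of_real x)" using x by simp
  have re: "Re (c * complex_of_real t) = Re c * t" for c t by simp
  from bounded_linear.sums[OF bounded_linear_Re \<open>(\<lambda>k. (deriv ^^ k) ?D 0 / fact k * of_real x ^ k) sums
      ?D (of_real x)\<close>]
  have "(\<lambda>k. taylor_difference B A k * x ^ k) sums Re (?D (of_real x))"
    unfolding taylor_difference_def of_real_power[symmetric] unfolding re .
  moreover have "taylor_difference B A 0 = 0"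
    using A B by (simp add: taylor_difference_def analytic_branch_def)
  ultimately have "(\<lambda>k. taylor_difference B A (Suc k) * x ^ Suc k) sums Re (?D (of_real x))"
    using sums_Suc_iff[of "\<lambda>k. taylor_difference B A k * x ^ k" "Re (?D (of_real x))"] by simp
  moreover have "displacement U F\<^sub>p F\<^sub>m x = Re (?D (of_real x))"
    using displacement_eq(3)[OF lip up lo, of \<epsilon> x] x A B by (auto simp: analytic_branch_def)
  ultimately show "(\<lambda>k. taylor_difference B A (Suc k) * x ^ Suc k) sums displacement U F\<^sub>p F\<^sub>m x" by simp
qed

text \<open>Holomorphy at \<open>0\<close> makes this limit two-sided, as required for evaluating
  the difference at negative points.\<close>

lemma branch_difference_limit:
  assumes A: "analytic_branch \<epsilon> A" and B: "analytic_branch \<epsilon> B"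
    and zero: "\<And>i. 1 \<le> i \<Longrightarrow> i < n \<Longrightarrow> taylor_difference B A i = 0"
  shows "((\<lambda>u. (Re (B (of_real u)) - Re (A (of_real u))) / u ^ n) \<longlongrightarrow> taylor_difference B A n) (at 0)"
proof -
  let ?D = "\<lambda>z. B z - A z"
  have \<epsilon>: "0 < \<epsilon>" using A by (simp add: analytic_branch_def)
  have h: "?D holomorphic_on ball 0 \<epsilon>" using A B
      by (auto simp: analytic_branch_def intro!: holomorphic_intros)
  have r: "?D z \<in> \<real>" if "z \<in> ball 0 \<epsilon>" "z \<in> \<real>" for z
    using A B that by (auto simp: analytic_branch_def intro!: Reals_diff)
  have dr: "(deriv ^^ k) ?D 0 \<in> \<real>" for k using higher_deriv_in_Reals[OF h r, of 0 k] \<epsilon> by simp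
  have td: "taylor_difference B A k = Re ((deriv ^^ k) ?D 0) / fact k" for k
  proof -
    have "(deriv ^^ k) ?D 0 / fact k = (deriv ^^ k) ?D 0 / of_real (fact k)" by simp
    then show ?thesis unfolding taylor_difference_def by (metis Re_divide_of_real)
  qed
  \<comment> \<open>Vanishing of \<open>taylor_difference\<close> concerns real parts only; reality
    on the axis makes the whole derivative vanish.\<close>
  have z: "(deriv ^^ k) ?D 0 = 0" if "k < n" for k
  proof (cases "k = 0")
    case True
    then show ?thesis using A B by (simp add: analytic_branch_def)
  next
    case False
    then have "Re ((deriv ^^ k) ?D 0) = 0" using zero[of k] that td[of k] by simp
    then show ?thesis using dr[of k] by (simp add: complex_eq_iff complex_is_Real_iff)
  qed
  obtain e where e: "e holomorphic_on ball 0 \<epsilon>" "\<And>z. z \<in> ball 0 \<epsilon> \<Longrightarrow> ?D z = z ^ n * e z"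
    "e 0 = (deriv ^^ n) ?D 0 / fact n"
    by (rule holomorphic_factor_power[OF h \<epsilon> z r]) (assumption | rule that | simp only:)+
  have "isCont (\<lambda>x. Re (e (of_real x))) 0"
    by (rule DERIV_isCont[OF has_real_derivative_Re[OF holomorphic_derivI[OF e(1) open_ball]]])
        (use \<epsilon> in simp)
  then have "((\<lambda>x. Re (e (of_real x))) \<longlongrightarrow> taylor_difference B A n) (at 0)"
    using e(3) by (simp add: isCont_def taylor_difference_def)
  then show ?thesis
  proof (rule Lim_transform_eventually)
    have "\<forall>\<^sub>F x in at 0. dist x 0 < \<epsilon> \<and> x \<noteq> (0::real)" using \<epsilon> by (auto simp: eventually_at)
    then show "\<forall>\<^sub>F x in at 0. Re (e (of_real x)) = (Re (B (of_real x)) - Re (A (of_real x))) / x ^ n"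
    proof eventually_elim
      case (elim x)
      then have "Re (?D (of_real x)) = x ^ n * Re (e (of_real x))"
        using e(2)[of "of_real x"] by (simp flip: of_real_power)
      then show ?case using elim by simp
    qed
  qed
qed

section \<open>The first nonvanishing Lyapunov constant\<close>

text \<open>For \<open>M > 0\<close> and \<open>n < 2 * M\<close>, the first nonzero coefficient
  equals \<open>(- 1) ^ Suc n\<close> times itself, so \<open>n\<close> is odd. At
  \<open>n = 2 * M\<close> twice the coefficient is \<open>c1 + c2\<close>, whose sign is
  \<open>\<kappa>\<close>. For \<open>M = 0\<close> the coefficient is the difference of the
  slopes.\<close>

lemma displacement_order:
  assumes A: "analytic_branch \<epsilon> A" and B: "analytic_branch \<epsilon> B"
    and neg: "\<And>x. 0 < x \<Longrightarrow> x < \<epsilon> \<Longrightarrow> Re (A (of_real x)) < 0" "\<And>x. 0 < x \<Longrightarrow> x < \<epsilon> \<Longrightarrow> Re (B (of_real x)) < 0"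
    and inv: "\<And>x. 0 < x \<Longrightarrow> x < \<epsilon> \<Longrightarrow> Re (A (of_real (a' x))) = x" "\<And>x. 0 < x \<Longrightarrow> x < \<epsilon> \<Longrightarrow> Re (B (of_real (b'
        x))) = x"
    and lim: "(a' \<longlongrightarrow> 0) (at_right 0)" "(b' \<longlongrightarrow> 0) (at_right 0)"
    and c1: "((\<lambda>x. (a' x - Re (A (of_real x))) / x ^ Suc (2 * M)) \<longlongrightarrow> c1) (at_right 0)"
    and c2: "((\<lambda>x. (Re (B (of_real x)) - b' x) / x ^ Suc (2 * M)) \<longlongrightarrow> c2) (at_right 0)"
    and \<kappa>: "\<kappa> = 1 \<or> \<kappa> = - 1" "0 \<le> \<kappa> * c1" "0 \<le> \<kappa> * c2" "0 < \<kappa> * (c1 + c2)"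
  obtains n where "n \<le> 2 * M" "\<And>i. 1 \<le> i \<Longrightarrow> i \<le> n \<Longrightarrow> taylor_difference B A i = 0"
    "n = 2 * M \<and> 0 < \<kappa> * taylor_difference B A (Suc n) \<or> odd n \<and> taylor_difference B A (Suc n) \<noteq> 0"
proof -
  let ?V = "taylor_difference B A" and ?m = "Suc (2 * M)"
  let ?a = "\<lambda>x. Re (A (of_real x))" and ?b = "\<lambda>x. Re (B (of_real x))"
  have \<epsilon>: "0 < \<epsilon>" using A by (simp add: analytic_branch_def)
  \<comment> \<open>The alternative \<open>n = 2 * M\<close> stops the search without presupposing a
    nonzero coefficient; that the coefficient after it is nonzero is proved below.\<close>
  define n where "n = (LEAST n. ?V (Suc n) \<noteq> 0 \<or> n = 2 * M)"
  have n: "?V (Suc n) \<noteq> 0 \<or> n = 2 * M" unfolding n_def by (rule LeastI[of _ "2 * M"]) simp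
  have nM: "n \<le> 2 * M" unfolding n_def by (rule Least_le) simp
  have z: "?V i = 0" if "1 \<le> i" "i \<le> n" for i
  proof (cases i)
    case (Suc k)
    then have "k < n" using that by simp
    then show ?thesis using not_less_Least[of k] Suc unfolding n_def by blast
  qed (use that in simp)
  have d: "((\<lambda>u. (?b u - ?a u) / u ^ Suc n) \<longlongrightarrow> ?V (Suc n)) (at 0)"
    by (rule branch_difference_limit[OF A B]) (use z in auto)
  have ev: "\<forall>\<^sub>F x in at_right 0. P x" if "\<And>x. 0 < x \<Longrightarrow> x < \<epsilon> \<Longrightarrow> P x" for P
    by (rule eventually_at_rightI[OF _ \<epsilon>]) (use that in auto)
  note evs = ev[OF neg(1)] ev[OF neg(2)] ev[OF inv(1)] ev[OF inv(2)]
  have zero: "?a 0 = 0" "?b 0 = 0" using A B by (simp_all add: analytic_branch_def)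
  note dA = analytic_branch_deriv[OF A] and dB = analytic_branch_deriv[OF B]
  show thesis
  proof (cases "M = 0")
    case True
    then have n0: "n = 0" using nM by simp
    have "?V 1 = Re (deriv B 0) - Re (deriv A 0)"
    proof -
      have "deriv (\<lambda>z. B z - A z) 0 = deriv B 0 - deriv A 0"
        using A B \<epsilon> by (intro deriv_diff) (auto simp: analytic_branch_def intro:
            holomorphic_on_imp_differentiable_at)
      then show ?thesis by (simp add: taylor_difference_def)
    qed
    moreover have "0 < \<kappa> * (Re (deriv B 0) - Re (deriv A 0))"
      by (rule displacement_rough_sign[OF _ _ zero evs lim _ _ \<kappa>])
        (use dA[of 0] dB[of 0] \<epsilon> c1 c2 True in simp_all)
    ultimately show thesis using that[of 0] True by simp
  next
    case False
    have cont: "isCont (\<lambda>x. Re (deriv A (of_real x))) 0"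
      by (rule DERIV_isCont[OF has_real_derivative_Re[OF holomorphic_derivI[OF _ open_ball]]])
        (use A in \<open>auto simp: analytic_branch_def intro: holomorphic_deriv\<close>)
    have eq: "?V (Suc n) = (- 1) ^ Suc n * ?V (Suc n) + (if Suc n = ?m then c1 + c2 else 0)"
      by (rule displacement_leading_coefficient[OF dA \<epsilon> cont dB[of 0] zero evs lim c1 c2 d])
        (use \<epsilon> False nM in auto)
    show thesis
    proof (rule that[OF nM z])
      show "n = 2 * M \<and> 0 < \<kappa> * ?V (Suc n) \<or> odd n \<and> ?V (Suc n) \<noteq> 0"
      proof (cases "n = 2 * M")
        case True
        then have "2 * ?V (Suc n) = c1 + c2" using eq by simp
        then have "\<kappa> * (2 * ?V (Suc n)) > 0" using \<kappa>(4) by simp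
        then show ?thesis using True by simp
      next
        case False
        then have "?V (Suc n) \<noteq> 0" using n by blast
        moreover have "odd n"
        proof
          assume "even n"
          then have "?V (Suc n) = - ?V (Suc n)" using eq False by simp
          then show False using calculation by simp
        qed
        ultimately show ?thesis by blast
      qed
    qed
  qed
qed

definition stability_sign :: "stability \<Rightarrow> real" where
  "stability_sign s = (case s of Stable \<Rightarrow> - 1 | Unstable \<Rightarrow> 1)"

text \<open>Two foci have to be compared at the same exponent \<open>Suc (2 * M)\<close>, with
  \<open>M\<close> the smaller order. A focus of that order contributes a constant of the sign of
  its stability, one of higher order contributes \<open>0\<close>.\<close>

lemma subsystem_focus_displacement_limit:
  assumes foc: "subsystem_focus U X Y \<sigma> s" and lip: "locally_lipschitz U (vector_field X Y)"
    and \<epsilon>: "0 < \<epsilon>"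
    and up: "\<And>x. 0 < x \<Longrightarrow> x < \<epsilon> \<Longrightarrow> upper_half_return U (vector_field X Y) x (p x)"
    and lo: "\<And>x. 0 < x \<Longrightarrow> x < \<epsilon> \<Longrightarrow> lower_half_return U (vector_field X Y) (q x) x"
    and M: "M \<le> \<sigma>"
  obtains c where "((\<lambda>x. (q x - p x) / x ^ Suc (2 * M)) \<longlongrightarrow> c) (at_right 0)"
    "if M = \<sigma> then 0 < stability_sign s * c else c = 0"
proof -
  let ?F = "vector_field X Y"
  obtain n V where n: "real \<sigma> = real n / 2" and ly: "lyapunov_constants U ?F ?F V"
    and z: "\<forall>i\<in>{1..n}. V i = 0" and st: "case s of Stable \<Rightarrow> V (n + 1) < 0 | Unstable \<Rightarrow> V (n + 1) > 0"
    using foc unfolding subsystem_focus_def focus_of_order_with_stability_def by blast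
  have n': "n = 2 * \<sigma>" using n by simp
  obtain r where r: "0 < r" "\<forall>x\<in>{0..<r}. x \<in> dom_upper U ?F \<and> x \<in> lower_map U ?F ` dom_lower U ?F \<and>
       (\<lambda>k. V (Suc k) * x ^ Suc k) sums displacement U ?F ?F x"
    using ly unfolding lyapunov_constants_def by blast
  have "((\<lambda>x. (q x - p x) / x ^ Suc (2 * M)) \<longlongrightarrow> V (Suc (2 * M))) (at_right 0)"
  proof (rule power_series_leading_limit[of "min r \<epsilon>"])
    show "(\<lambda>k. V (Suc k) * x ^ Suc k) sums (q x - p x)" if "0 < x" "x < min r \<epsilon>" for x
      using bspec[OF r(2), of x] displacement_eq(3)[OF lip lip up lo, of \<epsilon> x] that by simp
    show "V i = 0" if "1 \<le> i" "i \<le> 2 * M" for i using z that M n' by simp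
  qed (use r \<epsilon> in simp)
  moreover have "if M = \<sigma> then 0 < stability_sign s * V (Suc (2 * M)) else V (Suc (2 * M)) = 0"
  proof (cases "M = \<sigma>")
    case True
    then show ?thesis using st n' by (cases s) (auto simp: stability_sign_def)
  next
    case False
    then show ?thesis using z M n' by simp
  qed
  ultimately show thesis using that by blast
qed

lemma focus_order_of_branches:
  assumes lip: "locally_lipschitz U F\<^sub>p" "locally_lipschitz U F\<^sub>m"
    and A: "analytic_branch \<epsilon> A" and B: "analytic_branch \<epsilon> B"
    and up: "\<And>x. 0 < x \<Longrightarrow> x < \<epsilon> \<Longrightarrow> upper_half_return U F\<^sub>p x (Re (A (of_real x)))"
    and lo: "\<And>x. 0 < x \<Longrightarrow> x < \<epsilon> \<Longrightarrow> lower_half_return U F\<^sub>m (Re (B (of_real x))) x"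
    and inv: "\<And>x. 0 < x \<Longrightarrow> x < \<epsilon> \<Longrightarrow> Re (A (of_real (a' x))) = x" "\<And>x. 0 < x \<Longrightarrow> x < \<epsilon> \<Longrightarrow> Re (B (of_real (b'
        x))) = x"
    and lim: "(a' \<longlongrightarrow> 0) (at_right 0)" "(b' \<longlongrightarrow> 0) (at_right 0)"
    and c1: "((\<lambda>x. (a' x - Re (A (of_real x))) / x ^ Suc (2 * M)) \<longlongrightarrow> c1) (at_right 0)"
    and c2: "((\<lambda>x. (Re (B (of_real x)) - b' x) / x ^ Suc (2 * M)) \<longlongrightarrow> c2) (at_right 0)"
    and sign: "0 \<le> stability_sign s * c1" "0 \<le> stability_sign s * c2" "0 < stability_sign s * (c1 + c2)"
  shows "\<exists>\<sigma>\<in>admissible_orders M. focus_of_order U F\<^sub>p F\<^sub>m \<sigma> \<and>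
    (\<sigma> = real M \<longrightarrow> focus_of_order_with_stability U F\<^sub>p F\<^sub>m \<sigma> s)"
proof -
  let ?V = "taylor_difference B A"
  have neg: "Re (A (of_real x)) < 0" "Re (B (of_real x)) < 0" if "0 < x" "x < \<epsilon>" for x
    using up[OF that] lo[OF that] by (simp_all add: upper_half_return_iff lower_half_return_iff)
  have s1: "stability_sign s = 1 \<or> stability_sign s = - 1" by (cases s) (auto simp: stability_sign_def)
  obtain n where n: "n \<le> 2 * M" "\<And>i. 1 \<le> i \<Longrightarrow> i \<le> n \<Longrightarrow> ?V i = 0"
    and alt: "n = 2 * M \<and> 0 < stability_sign s * ?V (Suc n) \<or> odd n \<and> ?V (Suc n) \<noteq> 0"
    using displacement_order[OF A B neg inv lim c1 c2 s1 sign] by blast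
  note ly = lyapunov_constants_branches[OF lip A B up lo]
  have z: "\<forall>i\<in>{1..n}. ?V i = 0" using n(2) by simp
  from alt show ?thesis
  proof
    assume *: "n = 2 * M \<and> 0 < stability_sign s * ?V (Suc n)"
    then have m: "real M = real n / 2" by simp
    have "?V (n + 1) \<noteq> 0" using * by auto
    then have 1: "focus_of_order U F\<^sub>p F\<^sub>m (real M)"
      unfolding focus_of_order_def using m ly z by blast
    have "case s of Stable \<Rightarrow> ?V (n + 1) < 0 | Unstable \<Rightarrow> ?V (n + 1) > 0"
      using * by (cases s) (auto simp: stability_sign_def)
    then have 2: "focus_of_order_with_stability U F\<^sub>p F\<^sub>m (real M) s"
      unfolding focus_of_order_with_stability_def using m ly z by blast
    show ?thesis using 1 2 by (intro bexI[of _ "real M"]) (auto simp: admissible_orders_def)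
  next
    assume *: "odd n \<and> ?V (Suc n) \<noteq> 0"
    then obtain k where k: "n = 2 * k + 1" by (auto elim: oddE)
    have f: "focus_of_order U F\<^sub>p F\<^sub>m (real n / 2)"
      unfolding focus_of_order_def using * ly z by (intro exI[of _ n] exI[of _ ?V]) simp
    \<comment> \<open>An odd \<open>n\<close> gives a half-integral order, so the claim about
      stability at order \<open>M\<close> is vacuous.\<close>
    have "real n / 2 \<noteq> real M"
    proof
      assume "real n / 2 = real M"
      then have "n = 2 * M" by simp
      then show False using k by presburger
    qed
    \<comment> \<open>Since \<open>n = 2 * k + 1 = 2 * (k + 1) - 1\<close>, the index is
      \<open>k + 1\<close>, at most \<open>M\<close> because \<open>n \<le> 2 * M\<close>.\<close>
    moreover have "real n / 2 \<in> admissible_orders M"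
      unfolding admissible_orders_def
    proof (intro UnI1 UN_I[of "k + 1"])
      show "k + 1 \<in> {1..M}" using n(1) k by simp
      show "real n / 2 \<in> {(2 * real (k + 1) - 1) / 2}" using k by simp
    qed
    ultimately show ?thesis using f by blast
  qed
qed

section \<open>The two kinds of lower subsystem\<close>

theorem theorem3p2:
  fixes Xp Yp Xm Ym :: "real \<times> real \<Rightarrow> real"
    and U :: "(real \<times> real) set"
    and \<sigma>p :: nat
    and s :: stability
  assumes "open U" and "(0, 0) \<in> U"
    and "real_analytic_on Xp U" and "real_analytic_on Yp U"
    and "real_analytic_on Xm U" and "real_analytic_on Ym U"
    and "monodromic_singular_point U (vector_field Xp Yp) (vector_field Xm Ym)"
    and "rotates_counterclockwise U (vector_field Xp Yp) (vector_field Xm Ym)"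
    and "subsystem_focus U Xp Yp \<sigma>p s"
  shows
    "(\<forall>\<sigma>m. subsystem_focus U Xm Ym \<sigma>m s \<longrightarrow>
        (\<exists>\<sigma>\<in>admissible_orders (min \<sigma>p \<sigma>m).
           focus_of_order U (vector_field Xp Yp) (vector_field Xm Ym) \<sigma> \<and>
           (\<sigma> = real (min \<sigma>p \<sigma>m) \<longrightarrow>
              focus_of_order_with_stability U (vector_field Xp Yp) (vector_field Xm Ym) \<sigma> s)))
     \<and>
     (\<forall>l. invisible_tangent_lower Xm Ym l \<longrightarrow>
        (\<exists>\<sigma>\<in>admissible_orders \<sigma>p.
           focus_of_order U (vector_field Xp Yp) (vector_field Xm Ym) \<sigma> \<and>
           (\<sigma> = real \<sigma>p \<longrightarrow>
              focus_of_order_with_stability U (vector_field Xp Yp) (vector_field Xm Ym) \<sigma> s)))"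
proof -
  let ?Fp = "vector_field Xp Yp" and ?Fm = "vector_field Xm Ym"
  let ?re = "\<lambda>f x. Re (f (complex_of_real x))"
  have lip: "locally_lipschitz U ?Fp" "locally_lipschitz U ?Fm"
    using assms(3-6) by (auto intro: locally_lipschitz_vector_field)
  have ccw: "\<exists>r>0. \<forall>x\<in>{0<..<r}. \<exists>y. upper_half_return U ?Fp x y"
    "\<exists>r>0. \<forall>x\<in>{- r<..<0}. \<exists>y. lower_half_return U ?Fm x y"
    using assms(8) unfolding rotates_counterclockwise_def by blast+
  have foc: "linear_focus X Y" if "subsystem_focus U X Y \<sigma> s" for X Y \<sigma>
    using that by (simp add: subsystem_focus_def)
  obtain A A' \<epsilon>p where A: "analytic_branch \<epsilon>p A" "analytic_branch \<epsilon>p A'"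
    and upA: "\<And>x. 0 < x \<Longrightarrow> x < \<epsilon>p \<Longrightarrow> upper_half_return U ?Fp x (?re A x)"
    and loA: "\<And>x. 0 < x \<Longrightarrow> x < \<epsilon>p \<Longrightarrow> lower_half_return U ?Fp (?re A' x) x"
    and AA': "\<And>x. 0 < x \<Longrightarrow> x < \<epsilon>p \<Longrightarrow> A (A' (of_real x)) = of_real x"
    by (rule focus_branches[OF assms(1-4) foc[OF assms(9)] disjI1[OF ccw(1)]]) (assumption | rule that |
        simp only:)+
  have \<epsilon>p: "0 < \<epsilon>p" using A by (simp add: analytic_branch_def)
  have invA: "Re (A (of_real (?re A' x))) = x" if "0 < x" "x < \<epsilon>p" for x
    using AA'[OF that] analytic_branch_real[OF A(2), of x] that by simp
  show ?thesis
  proof (intro conjI allI impI)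
    fix \<sigma>m assume fm: "subsystem_focus U Xm Ym \<sigma>m s"
    let ?M = "min \<sigma>p \<sigma>m"
    \<comment> \<open>\<open>B'\<close> is the upper half-return of the lower subsystem and
      \<open>B\<close> the inverse of its lower half-return, so \<open>B - B'\<close> is the
      displacement of the smooth lower system. The piecewise-smooth system uses \<open>B\<close>
      only.\<close>
    obtain B' B \<epsilon>m where B: "analytic_branch \<epsilon>m B'" "analytic_branch \<epsilon>m B"
      and upB: "\<And>x. 0 < x \<Longrightarrow> x < \<epsilon>m \<Longrightarrow> upper_half_return U ?Fm x (?re B' x)"
      and loB: "\<And>x. 0 < x \<Longrightarrow> x < \<epsilon>m \<Longrightarrow> lower_half_return U ?Fm (?re B x) x"
      and BB': "\<And>x. 0 < x \<Longrightarrow> x < \<epsilon>m \<Longrightarrow> B (B' (of_real x)) = of_real x"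
      by (rule focus_branches[OF assms(1,2,5,6) foc[OF fm] disjI2[OF ccw(2)]]) (assumption | rule that |
          simp only:)+
    have \<epsilon>m: "0 < \<epsilon>m" using B by (simp add: analytic_branch_def)
    have invB: "Re (B (of_real (?re B' x))) = x" if "0 < x" "x < \<epsilon>m" for x
      using BB'[OF that] analytic_branch_real[OF B(1), of x] that by simp
    obtain c1 where c1: "((\<lambda>x. (?re A' x - ?re A x) / x ^ Suc (2 * ?M)) \<longlongrightarrow> c1) (at_right 0)"
      "if ?M = \<sigma>p then 0 < stability_sign s * c1 else c1 = 0"
      by (rule subsystem_focus_displacement_limit[OF assms(9) lip(1) \<epsilon>p upA loA min.cobounded1])
          (assumption | rule that | simp only:)+
    obtain c2 where c2: "((\<lambda>x. (?re B x - ?re B' x) / x ^ Suc (2 * ?M)) \<longlongrightarrow> c2) (at_right 0)"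
      "if ?M = \<sigma>m then 0 < stability_sign s * c2 else c2 = 0"
      by (rule subsystem_focus_displacement_limit[OF fm lip(2) \<epsilon>m upB loB min.cobounded2]) (assumption |
          rule that | simp only:)+
    define \<epsilon> where "\<epsilon> = min \<epsilon>p \<epsilon>m"
    have \<epsilon>: "0 < \<epsilon>" "\<epsilon> \<le> \<epsilon>p" "\<epsilon> \<le> \<epsilon>m" using \<epsilon>p \<epsilon>m by (auto simp: \<epsilon>_def)
    show "\<exists>\<sigma>\<in>admissible_orders ?M. focus_of_order U ?Fp ?Fm \<sigma> \<and>
        (\<sigma> = real ?M \<longrightarrow> focus_of_order_with_stability U ?Fp ?Fm \<sigma> s)"
    proof (rule focus_order_of_branches[OF lip analytic_branch_mono[OF A(1) \<epsilon>(1,2)]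
        analytic_branch_mono[OF B(2) \<epsilon>(1,3)]
          _ _ _ _ analytic_branch_tendsto[OF A(2)] analytic_branch_tendsto[OF B(1)] c1(1) c2(1)])
      show "0 \<le> stability_sign s * c1" "0 \<le> stability_sign s * c2"
          using c1(2) c2(2) by (auto split: if_splits)
      \<comment> \<open>At least one of the two orders equals the minimum, so one constant has the
        strict sign while the other has the same sign or is zero.\<close>
      show "0 < stability_sign s * (c1 + c2)"
        using c1(2) c2(2) by (cases "\<sigma>p \<le> \<sigma>m") (auto simp: distrib_left min_def split: if_splits)
    qed (use \<epsilon> upA loB invA invB in auto)
  next
    fix l assume tan: "invisible_tangent_lower Xm Ym l"
    obtain \<tau> \<epsilon>m where \<tau>: "analytic_branch \<epsilon>m \<tau>"
      and lo\<tau>: "\<And>x. 0 < x \<Longrightarrow> x < \<epsilon>m \<Longrightarrow> lower_half_return U ?Fm (?re \<tau> x) x"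
      and \<tau>\<tau>: "\<And>x. 0 < x \<Longrightarrow> x < \<epsilon>m \<Longrightarrow> \<tau> (\<tau> (of_real x)) = of_real x"
      by (rule tangent_branch[OF assms(1,2,5,6) tan ccw(2)]) (assumption | rule that | simp only:)+
    have \<epsilon>m: "0 < \<epsilon>m" using \<tau> by (simp add: analytic_branch_def)
    have inv\<tau>: "Re (\<tau> (of_real (?re \<tau> x))) = x" if "0 < x" "x < \<epsilon>m" for x
      using \<tau>\<tau>[OF that] analytic_branch_real[OF \<tau>, of x] that by simp
    obtain c1 where c1: "((\<lambda>x. (?re A' x - ?re A x) / x ^ Suc (2 * \<sigma>p)) \<longlongrightarrow> c1) (at_right 0)"
      "0 < stability_sign s * c1"
      by (rule subsystem_focus_displacement_limit[OF assms(9) lip(1) \<epsilon>p upA loA order_refl]) (assumption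
          | rule that | simp only: if_True | simp only:)+
    \<comment> \<open>The involution is its own inverse, so the lower subsystem adds nothing at any
      order and the sign is that of \<open>c1\<close>.\<close>
    have c2: "((\<lambda>x. (?re \<tau> x - ?re \<tau> x) / x ^ Suc (2 * \<sigma>p)) \<longlongrightarrow> 0) (at_right 0)" by simp
    define \<epsilon> where "\<epsilon> = min \<epsilon>p \<epsilon>m"
    have \<epsilon>: "0 < \<epsilon>" "\<epsilon> \<le> \<epsilon>p" "\<epsilon> \<le> \<epsilon>m" using \<epsilon>p \<epsilon>m by (auto simp: \<epsilon>_def)
    show "\<exists>\<sigma>\<in>admissible_orders \<sigma>p. focus_of_order U ?Fp ?Fm \<sigma> \<and>
        (\<sigma> = real \<sigma>p \<longrightarrow> focus_of_order_with_stability U ?Fp ?Fm \<sigma> s)"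
      by (rule focus_order_of_branches[OF lip analytic_branch_mono[OF A(1) \<epsilon>(1,2)]
          analytic_branch_mono[OF \<tau> \<epsilon>(1,3)]
          _ _ _ _ analytic_branch_tendsto[OF A(2)] analytic_branch_tendsto[OF \<tau>] c1(1) c2])
        (use \<epsilon> upA lo\<tau> invA inv\<tau> c1(2) in auto)
  qed
qed

end
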